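(* Let $\theta\in\{0,\tfrac12\}$ and let $\mathcal{SV}$ be the super-Virasoro algebra with basis $\{L_m,G_r,c\mid m\in\mathbb{Z},\ r\in\mathbb{Z}+\theta\}$. Any compatible left-symmetric superalgebra structure on $\mathcal{SV}$ whose multiplication has the form $$L_m\cdot L_n=f(m,n)L_{m+n}+\omega(L_m,L_n)c,\qquad L_m\cdot G_r=g(m,r)G_{m+r}+\omega(L_m,G_r)c,$$ $$G_r\cdot L_m=h(r,m)G_{m+r}+\omega(G_r,L_m)c,\qquad G_r\cdot G_s=d(r,s)L_{r+s}+\omega(G_r,G_s)c,$$ $$c\cdot c=c\cdot L_m=L_m\cdot c=c\cdot G_r=G_r\cdot c=0,$$ for all $m,n\in\mathbb{Z}$, $r,s\in\mathbb{Z}+\theta$ (where $f,g,h,d$ are complex-valued functions and $\omega$ is a complex-valued bilinear form on the span of the $L_m$ and $G_r$), is isomorphic to one of the following left-symmetric superalgebras, which are compatible structures on $\mathcal{SV}$ and are mutually non-isomorphic for distinct values of the parameter $\epsilon$: $$L_m\cdot L_n=\frac{-n(1+\epsilon n)}{1+\epsilon(m+n)}L_{m+n}+\frac{c}{24}\bigl(m^3-m+(\epsilon-\epsilon^{-1})m^2\bigr)\delta_{m+n,0},$$ $$L_m\cdot G_r=\frac{-(\frac{m}{2}+r)(1+2\epsilon r)}{1+2\epsilon(m+r)}G_{m+r},$$ $$G_r\cdot L_m=\frac{-m(1+\epsilon m)}{1+2\epsilon(m+r)}G_{m+r},$$ $$G_r\cdot G_s=\frac{1+2\epsilon s}{1+\epsilon(r+s)}L_{r+s}+\frac{c}{24}\bigl(4r^2-1+2(\epsilon-\epsilon^{-1})r\bigr)\delta_{r+s,0},$$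 for $m,n\in\mathbb{Z}$, $r,s\in\mathbb{Z}+\theta$, where $c$ is an annihilator (all products with $c$ vanish) and $\epsilon\in\mathbb{C}$ satisfies either $\mathrm{Re}\,\epsilon>0$ and $\epsilon^{-1}\notin\mathbb{Z}$, or $\mathrm{Re}\,\epsilon=0$ and $\mathrm{Im}\,\epsilon>0$.
   Context: All algebras are over $\mathbb{C}$. A superalgebra is an algebra $A$ whose underlying vector space is $\mathbb{Z}_2$-graded, $A=A_{\bar0}\oplus A_{\bar1}$, with $A_\alpha\cdot A_\beta\subset A_{\alpha+\beta}$. It is a left-symmetric superalgebra if the associator $(x,y,z)=(x\cdot y)\cdot z-x\cdot(y\cdot z)$ satisfies $(x,y,z)=(-1)^{\alpha\beta}(y,x,z)$ for all $x\in A_\alpha$, $y\in A_\beta$, $z\in A$, $\alpha,\beta\in\mathbb{Z}_2$. Then the super-commutator $[x,y]=x\cdot y-(-1)^{\alpha\beta}y\cdot x$ ($x\in A_\alpha$, $y\in A_\beta$) makes $A$ a Lie superalgebra $\mathcal{G}(A)$, and $A$ is called a compatible left-symmetric superalgebra structure on the Lie superalgebra $\mathcal{G}(A)$ (i.e. the super-commutator of the product equals the given Lie super-bracket). For $\theta=0$ (Ramond case) or $\theta=\frac12$ (Neveu-Schwarz case), the super-Virasoro algebra $\mathcal{SV}=\mathcal{SV}_{\bar0}\oplus\mathcal{SV}_{\bar1}$ is the Lie superalgebra with basis $\{L_m,G_r,c\mid m\in\mathbb{Z},r\in\mathbb{Z}+\theta\}$, where $\mathcal{SV}_{\bar0}$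 is spanned by the $L_m$ and $c$, $\mathcal{SV}_{\bar1}$ is spanned by the $G_r$, and $$[L_m,L_n]=(m-n)L_{m+n}+\tfrac{c}{12}(m^3-m)\delta_{m+n,0},\quad [L_m,G_r]=(\tfrac m2-r)G_{m+r},$$ $$[G_r,G_s]=2L_{r+s}+\tfrac{c}{12}(4r^2-1)\delta_{r+s,0},\quad [\mathcal{SV}_{\bar0},c]=[\mathcal{SV}_{\bar1},c]=0.$$ *)

theory Defs
  imports Complex_Main "HOL-Library.Poly_Mapping" "HOL-Library.Z2"
begin

section \<open>Left-symmetric superalgebras\<close>

text \<open>The group \<open>\<int>\<^sub>2\<close> is the type \<^typ>\<open>bit\<close>; the sign below is \<open>(-1)\<^bsup>\<alpha>\<beta>\<^esup>\<close>.\<close>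

definition super_sign :: "bit \<Rightarrow> bit \<Rightarrow> complex" where
  "super_sign \<alpha> \<beta> = (if \<alpha> * \<beta> = 1 then -1 else 1)"

definition associator :: "('a::ab_group_add \<Rightarrow> 'a \<Rightarrow> 'a) \<Rightarrow> 'a \<Rightarrow> 'a \<Rightarrow> 'a \<Rightarrow> 'a" where
  "associator mul x y z = mul (mul x y) z - mul x (mul y z)"

locale superalgebra = vector_space scale
  for scale :: "complex \<Rightarrow> 'a::ab_group_add \<Rightarrow> 'a" +
  fixes A :: "bit \<Rightarrow> 'a set"
    and mul :: "'a \<Rightarrow> 'a \<Rightarrow> 'a"
  assumes subspace_homogeneous: "subspace (A \<alpha>)"
    and direct_inter: "A 0 \<inter> A 1 = {0}"
    and direct_sum: "\<exists>a\<in>A 0. \<exists>b\<in>A 1. x = a + b"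
    and linear_mul_right: "Vector_Spaces.linear scale scale (\<lambda>y. mul x y)"
    and linear_mul_left: "Vector_Spaces.linear scale scale (\<lambda>x. mul x y)"
    and mul_homogeneous: "x \<in> A \<alpha> \<Longrightarrow> y \<in> A \<beta> \<Longrightarrow> mul x y \<in> A (\<alpha> + \<beta>)"

locale left_symmetric_superalgebra = superalgebra +
  assumes left_symmetric: "x \<in> A \<alpha> \<Longrightarrow> y \<in> A \<beta> \<Longrightarrow>
    associator mul x y z = scale (super_sign \<alpha> \<beta>) (associator mul y x z)"

text \<open>\<open>bracket\<close> is the super-bracket of a Lie superalgebra with homogeneous components \<open>A\<close>.\<close>

definition compatible_lss ::
  "(complex \<Rightarrow> 'a::ab_group_add \<Rightarrow> 'a) \<Rightarrow> (bit \<Rightarrow> 'a set) \<Rightarrow> ('a \<Rightarrow> 'a \<Rightarrow> 'a)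
    \<Rightarrow> ('a \<Rightarrow> 'a \<Rightarrow> 'a) \<Rightarrow> bool" where
  "compatible_lss scale A bracket mul \<longleftrightarrow>
     left_symmetric_superalgebra scale A mul \<and>
     (\<forall>\<alpha> \<beta>. \<forall>x\<in>A \<alpha>. \<forall>y\<in>A \<beta>.
        mul x y - scale (super_sign \<alpha> \<beta>) (mul y x) = bracket x y)"

text \<open>Isomorphisms of superalgebras are even, i.e. they preserve the grading.\<close>

definition superalgebra_iso ::
  "(complex \<Rightarrow> 'a::ab_group_add \<Rightarrow> 'a) \<Rightarrow> (bit \<Rightarrow> 'a set) \<Rightarrow> ('a \<Rightarrow> 'a \<Rightarrow> 'a)
    \<Rightarrow> (complex \<Rightarrow> 'b::ab_group_add \<Rightarrow> 'b) \<Rightarrow> (bit \<Rightarrow> 'b set) \<Rightarrow> ('b \<Rightarrow> 'b \<Rightarrow> 'b)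
    \<Rightarrow> ('a \<Rightarrow> 'b) \<Rightarrow> bool" where
  "superalgebra_iso scale A mul scale' A' mul' \<phi> \<longleftrightarrow>
     Vector_Spaces.linear scale scale' \<phi> \<and> bij \<phi> \<and>
     (\<forall>\<alpha>. \<phi> ` A \<alpha> = A' \<alpha>) \<and>
     (\<forall>x y. \<phi> (mul x y) = mul' (\<phi> x) (\<phi> y))"


section \<open>The super-Virasoro algebra\<close>

definition shifted_ints :: "real \<Rightarrow> real set" where
  "shifted_ints \<theta> = range (\<lambda>k::int. of_int k + \<theta>)"

text \<open>
  The space has a basis indexed by \<open>sv_index\<close>. The odd basis vectors are indexed by integers so
  that one type serves for both values of \<open>\<theta>\<close>: the index \<open>IG k\<close> belongs to \<open>G\<^sub>r\<close> with
  \<open>r = k + \<theta>\<close>. Accordingly \<open>sv_G \<theta> r\<close> is meaningful for \<open>r \<in> \<int> + \<theta>\<close> only.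
\<close>

datatype sv_index = IL int | IG int | IC

type_synonym sv = "sv_index \<Rightarrow>\<^sub>0 complex"

definition sv_scale :: "complex \<Rightarrow> sv \<Rightarrow> sv" where
  "sv_scale a v = Poly_Mapping.map ((*) a) v"

definition sv_L :: "int \<Rightarrow> sv" where
  "sv_L m = Poly_Mapping.single (IL m) 1"

definition sv_G :: "real \<Rightarrow> real \<Rightarrow> sv" where
  "sv_G \<theta> r = Poly_Mapping.single (IG \<lfloor>r - \<theta>\<rfloor>) 1"

definition sv_c :: sv where
  "sv_c = Poly_Mapping.single IC 1"

definition sv_grade :: "real \<Rightarrow> bit \<Rightarrow> sv set" where
  "sv_grade \<theta> \<alpha> =
     (if \<alpha> = 0 then module.span sv_scale (range sv_L \<union> {sv_c})
      else module.span sv_scale (sv_G \<theta> ` shifted_ints \<theta>))"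

definition bilinear_extension :: "(sv_index \<Rightarrow> sv_index \<Rightarrow> sv) \<Rightarrow> sv \<Rightarrow> sv \<Rightarrow> sv" where
  "bilinear_extension t x y =
     (\<Sum>i\<in>Poly_Mapping.keys x. \<Sum>j\<in>Poly_Mapping.keys y.
        sv_scale (Poly_Mapping.lookup x i * Poly_Mapping.lookup y j) (t i j))"

text \<open>
  In the tables below \<open>r + s\<close> is an integer for \<open>r, s \<in> \<int> + \<theta>\<close> and \<open>2 \<theta> \<in> \<int>\<close>; the floor only
  converts it to type \<^typ>\<open>int\<close>.
\<close>

fun sv_bracket_basis :: "real \<Rightarrow> sv_index \<Rightarrow> sv_index \<Rightarrow> sv" where
  "sv_bracket_basis \<theta> (IL m) (IL n) =
     sv_scale (of_int (m - n)) (sv_L (m + n)) +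
     (if m + n = 0 then sv_scale ((of_int m ^ 3 - of_int m) / 12) sv_c else 0)"
| "sv_bracket_basis \<theta> (IL m) (IG k) =
     (let r = of_int k + \<theta> in
      sv_scale (of_int m / 2 - of_real r) (sv_G \<theta> (of_int m + r)))"
| "sv_bracket_basis \<theta> (IG k) (IL m) =
     (let r = of_int k + \<theta> in
      - sv_scale (of_int m / 2 - of_real r) (sv_G \<theta> (of_int m + r)))"
| "sv_bracket_basis \<theta> (IG k) (IG l) =
     (let r = of_int k + \<theta>; s = of_int l + \<theta> in
      sv_scale 2 (sv_L \<lfloor>r + s\<rfloor>) +
      (if r + s = 0 then sv_scale ((4 * of_real r ^ 2 - 1) / 12) sv_c else 0))"
| "sv_bracket_basis \<theta> IC j = 0"
| "sv_bracket_basis \<theta> (IL m) IC = 0"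
| "sv_bracket_basis \<theta> (IG k) IC = 0"

definition sv_bracket :: "real \<Rightarrow> sv \<Rightarrow> sv \<Rightarrow> sv" where
  "sv_bracket \<theta> = bilinear_extension (sv_bracket_basis \<theta>)"

abbreviation sv_compatible :: "real \<Rightarrow> (sv \<Rightarrow> sv \<Rightarrow> sv) \<Rightarrow> bool" where
  "sv_compatible \<theta> \<equiv> compatible_lss sv_scale (sv_grade \<theta>) (sv_bracket \<theta>)"

definition sv_isomorphic :: "real \<Rightarrow> (sv \<Rightarrow> sv \<Rightarrow> sv) \<Rightarrow> (sv \<Rightarrow> sv \<Rightarrow> sv) \<Rightarrow> bool" where
  "sv_isomorphic \<theta> P Q \<longleftrightarrow>
     (\<exists>\<phi>. superalgebra_iso sv_scale (sv_grade \<theta>) P sv_scale (sv_grade \<theta>) Q \<phi>)"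


section \<open>The multiplications under consideration\<close>

definition bilinear_form_on :: "sv set \<Rightarrow> (sv \<Rightarrow> sv \<Rightarrow> complex) \<Rightarrow> bool" where
  "bilinear_form_on V \<omega> \<longleftrightarrow>
     (\<forall>x\<in>V. \<forall>y\<in>V. \<forall>z\<in>V. \<omega> (x + y) z = \<omega> x z + \<omega> y z \<and> \<omega> z (x + y) = \<omega> z x + \<omega> z y) \<and>
     (\<forall>a. \<forall>x\<in>V. \<forall>y\<in>V. \<omega> (sv_scale a x) y = a * \<omega> x y \<and> \<omega> x (sv_scale a y) = a * \<omega> x y)"

definition sv_form ::
  "real \<Rightarrow> (int \<Rightarrow> int \<Rightarrow> complex) \<Rightarrow> (int \<Rightarrow> real \<Rightarrow> complex) \<Rightarrow> (real \<Rightarrow> int \<Rightarrow> complex)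
    \<Rightarrow> (real \<Rightarrow> real \<Rightarrow> complex) \<Rightarrow> (sv \<Rightarrow> sv \<Rightarrow> complex) \<Rightarrow> (sv \<Rightarrow> sv \<Rightarrow> sv) \<Rightarrow> bool" where
  "sv_form \<theta> f g h d \<omega> P \<longleftrightarrow>
     bilinear_form_on (module.span sv_scale (range sv_L \<union> sv_G \<theta> ` shifted_ints \<theta>)) \<omega> \<and>
     (\<forall>m n. P (sv_L m) (sv_L n) =
        sv_scale (f m n) (sv_L (m + n)) + sv_scale (\<omega> (sv_L m) (sv_L n)) sv_c) \<and>
     (\<forall>m. \<forall>r\<in>shifted_ints \<theta>. P (sv_L m) (sv_G \<theta> r) =
        sv_scale (g m r) (sv_G \<theta> (of_int m + r)) + sv_scale (\<omega> (sv_L m) (sv_G \<theta> r)) sv_c) \<and>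
     (\<forall>r\<in>shifted_ints \<theta>. \<forall>m. P (sv_G \<theta> r) (sv_L m) =
        sv_scale (h r m) (sv_G \<theta> (of_int m + r)) + sv_scale (\<omega> (sv_G \<theta> r) (sv_L m)) sv_c) \<and>
     (\<forall>r\<in>shifted_ints \<theta>. \<forall>s\<in>shifted_ints \<theta>. P (sv_G \<theta> r) (sv_G \<theta> s) =
        sv_scale (d r s) (sv_L \<lfloor>r + s\<rfloor>) + sv_scale (\<omega> (sv_G \<theta> r) (sv_G \<theta> s)) sv_c) \<and>
     P sv_c sv_c = 0 \<and>
     (\<forall>m. P sv_c (sv_L m) = 0 \<and> P (sv_L m) sv_c = 0) \<and>
     (\<forall>r\<in>shifted_ints \<theta>. P sv_c (sv_G \<theta> r) = 0 \<and> P (sv_G \<theta> r) sv_c = 0)"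

fun sv_prod_basis :: "real \<Rightarrow> complex \<Rightarrow> sv_index \<Rightarrow> sv_index \<Rightarrow> sv" where
  "sv_prod_basis \<theta> \<epsilon> (IL m) (IL n) =
     sv_scale (- of_int n * (1 + \<epsilon> * of_int n) / (1 + \<epsilon> * of_int (m + n))) (sv_L (m + n)) +
     (if m + n = 0
      then sv_scale ((of_int m ^ 3 - of_int m + (\<epsilon> - inverse \<epsilon>) * of_int m ^ 2) / 24) sv_c
      else 0)"
| "sv_prod_basis \<theta> \<epsilon> (IL m) (IG k) =
     (let r = of_int k + \<theta> in
      sv_scale (- (of_int m / 2 + of_real r) * (1 + 2 * \<epsilon> * of_real r) /
          (1 + 2 * \<epsilon> * of_real (of_int m + r)))
        (sv_G \<theta> (of_int m + r)))"
| "sv_prod_basis \<theta> \<epsilon> (IG k) (IL m) =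
     (let r = of_int k + \<theta> in
      sv_scale (- of_int m * (1 + \<epsilon> * of_int m) / (1 + 2 * \<epsilon> * of_real (of_int m + r)))
        (sv_G \<theta> (of_int m + r)))"
| "sv_prod_basis \<theta> \<epsilon> (IG k) (IG l) =
     (let r = of_int k + \<theta>; s = of_int l + \<theta> in
      sv_scale ((1 + 2 * \<epsilon> * of_real s) / (1 + \<epsilon> * of_real (r + s))) (sv_L \<lfloor>r + s\<rfloor>) +
      (if r + s = 0
       then sv_scale ((4 * of_real r ^ 2 - 1 + 2 * (\<epsilon> - inverse \<epsilon>) * of_real r) / 24) sv_c
       else 0))"
| "sv_prod_basis \<theta> \<epsilon> IC j = 0"
| "sv_prod_basis \<theta> \<epsilon> (IL m) IC = 0"
| "sv_prod_basis \<theta> \<epsilon> (IG k) IC = 0"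

definition sv_prod :: "real \<Rightarrow> complex \<Rightarrow> sv \<Rightarrow> sv \<Rightarrow> sv" where
  "sv_prod \<theta> \<epsilon> = bilinear_extension (sv_prod_basis \<theta> \<epsilon>)"

definition admissible :: "complex \<Rightarrow> bool" where
  "admissible \<epsilon> \<longleftrightarrow> (Re \<epsilon> > 0 \<and> inverse \<epsilon> \<notin> \<int>) \<or> (Re \<epsilon> = 0 \<and> Im \<epsilon> > 0)"


section \<open>Structure constants on the basis vectors\<close>


lemma sv_scale_single: "sv_scale a (Poly_Mapping.single i b) = Poly_Mapping.single i (a * b)"
  by (simp add: sv_scale_def)

lemma lookup_sv_scale: "Poly_Mapping.lookup (sv_scale a v) i = a * Poly_Mapping.lookup v i"
  by (simp add: sv_scale_def Poly_Mapping.map.rep_eq when_def)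

lemma vector_space_sv: "vector_space sv_scale"
  by unfold_locales
    (auto intro!: poly_mapping_eqI simp: lookup_sv_scale lookup_add algebra_simps)

lemma bilinear_extension_single:
  "bilinear_extension t (Poly_Mapping.single i 1) (Poly_Mapping.single j 1) = t i j"
  by (auto intro!: poly_mapping_eqI simp: bilinear_extension_def lookup_sv_scale)

lemma sv_G_shift: "sv_G \<theta> (of_int k + \<theta>) = Poly_Mapping.single (IG k) 1"
  by (simp add: sv_G_def)

lemma sv_bracket_L_L: "sv_bracket \<theta> (sv_L m) (sv_L n) =
     sv_scale (of_int (m - n)) (sv_L (m + n)) +
     (if m + n = 0 then sv_scale ((of_int m ^ 3 - of_int m) / 12) sv_c else 0)"
  by (simp only: sv_bracket_def sv_L_def bilinear_extension_single sv_bracket_basis.simps)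

lemma sv_bracket_L_G: "r \<in> shifted_ints \<theta> \<Longrightarrow> sv_bracket \<theta> (sv_L m) (sv_G \<theta> r) =
     sv_scale (of_int m / 2 - of_real r) (sv_G \<theta> (of_int m + r))"
  by (auto simp: shifted_ints_def sv_G_shift sv_bracket_def sv_L_def bilinear_extension_single)

lemma sv_bracket_G_G: "r \<in> shifted_ints \<theta> \<Longrightarrow> s \<in> shifted_ints \<theta> \<Longrightarrow>
   sv_bracket \<theta> (sv_G \<theta> r) (sv_G \<theta> s) =
      sv_scale 2 (sv_L \<lfloor>r + s\<rfloor>) +
      (if r + s = 0 then sv_scale ((4 * of_real r ^ 2 - 1) / 12) sv_c else 0)"
  by (auto simp: shifted_ints_def sv_G_shift sv_bracket_def bilinear_extension_single Let_def simp del: of_real_add)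

lemma sv_prod_L_L: "sv_prod \<theta> \<epsilon> (sv_L m) (sv_L n) =
     sv_scale (- of_int n * (1 + \<epsilon> * of_int n) / (1 + \<epsilon> * of_int (m + n))) (sv_L (m + n)) +
     (if m + n = 0
      then sv_scale ((of_int m ^ 3 - of_int m + (\<epsilon> - inverse \<epsilon>) * of_int m ^ 2) / 24) sv_c
      else 0)"
  by (simp only: sv_prod_def sv_L_def bilinear_extension_single sv_prod_basis.simps)

lemma sv_prod_G_G: "r \<in> shifted_ints \<theta> \<Longrightarrow> s \<in> shifted_ints \<theta> \<Longrightarrow>
   sv_prod \<theta> \<epsilon> (sv_G \<theta> r) (sv_G \<theta> s) =
      sv_scale ((1 + 2 * \<epsilon> * of_real s) / (1 + \<epsilon> * of_real (r + s))) (sv_L \<lfloor>r + s\<rfloor>) +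
      (if r + s = 0
       then sv_scale ((4 * of_real r ^ 2 - 1 + 2 * (\<epsilon> - inverse \<epsilon>) * of_real r) / 24) sv_c
       else 0)"
  by (auto simp: shifted_ints_def sv_G_shift sv_prod_def bilinear_extension_single Let_def simp del: of_real_add)

lemma sv_prod_L_G: "r \<in> shifted_ints \<theta> \<Longrightarrow> sv_prod \<theta> \<epsilon> (sv_L m) (sv_G \<theta> r) =
   sv_scale (- (of_int m / 2 + of_real r) * (1 + 2 * \<epsilon> * of_real r) /
       (1 + 2 * \<epsilon> * of_real (of_int m + r)))
     (sv_G \<theta> (of_int m + r))"
  by (auto simp: shifted_ints_def sv_G_shift sv_prod_def sv_L_def bilinear_extension_single Let_def
      simp del: of_real_add)

lemma sv_prod_G_L: "r \<in> shifted_ints \<theta> \<Longrightarrow> sv_prod \<theta> \<epsilon> (sv_G \<theta> r) (sv_L m) =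
   sv_scale (- of_int m * (1 + \<epsilon> * of_int m) / (1 + 2 * \<epsilon> * of_real (of_int m + r)))
     (sv_G \<theta> (of_int m + r))"
  by (auto simp: shifted_ints_def sv_G_shift sv_prod_def sv_L_def bilinear_extension_single Let_def
      simp del: of_real_add)


end

theory Submission
  imports Defs
begin

text \<open>
  For a product whose super-commutator is the given bracket, left-symmetry means that left
  multiplications form a representation of the super-Virasoro algebra on itself. For products of the
  graded form this is a system of functional equations for the structure constants
  (\<open>compatible_graded_product_iff\<close>), and the theorem solves that system.

  Even part. \<open>L\<^sub>0\<close> acts on \<open>L\<^sub>n\<close> by \<open>-n\<close> plus a defect. The defect is either \<open>0\<close> or takes one and the
  same nonzero value at \<open>\<plusminus>1\<close> and \<open>\<plusminus>2\<close>, and the latter contradicts the shape of the central term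
  (\<open>L_L0_eq_zero\<close>). Now \<open>[L\<^sub>1, L\<^bsub>-1\<^esub>] = 2 L\<^sub>0\<close> and compatibility give a first order recursion for the
  constants of \<open>L\<^sub>1 \<cdot> L\<^sub>n\<close>, and the law for \<open>L\<^sub>2, L\<^bsub>-2\<^esub>\<close> relates its starting values (\<open>small_values\<close>). Apart
  from one degenerate branch the outcome is the family \<open>L\<^sub>m \<cdot> L\<^sub>n = -n u\<^sub>n / u\<^bsub>m+n\<^esub> L\<^bsub>m+n\<^esub>\<close> with \<open>u\<^sub>n = 1 + \<epsilon> n\<close>
  (\<open>f_formula\<close>), in other words the action of vector fields on functions in a rescaled basis. The
  degenerate branch, which contains \<open>\<epsilon> = 0\<close>, does not extend to the center (\<open>f_1_1_neq\<close>). The central term of the family is forced as well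
  (\<open>w_formula\<close>).

  Odd part. \<open>G\<^sub>r\<close> is a square root of \<open>L\<^bsub>2r\<^esub>\<close>, so the constants of \<open>G\<^sub>r \<cdot> G\<^sub>s\<close> determine those of \<open>G\<^sub>r \<cdot> L\<^sub>m\<close> and
  \<open>L\<^sub>m \<cdot> G\<^sub>r\<close>. The laws involving opposite weights relate the ratios between these constants and the
  expected ones for the pairs \<open>(\<plusminus>r, \<plusminus>s)\<close>; a ratio different from \<open>1\<close> would force \<open>r = s\<close>, where the ratio is
  \<open>1\<close> by compatibility (\<open>ratio_eq_1\<close>). Hence every product of the given form belongs to the family with
  some \<open>\<epsilon> \<noteq> 0\<close>, \<open>1/\<epsilon> \<notin> \<int>\<close> (\<open>compatible_graded_product_eq_sv_prod\<close>). Conversely all these are compatible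
  left-symmetric structures (\<open>sv_prod_compatible\<close>), which amounts to identities of rational functions.

  Isomorphisms. The reflection \<open>L\<^sub>m \<mapsto> -L\<^bsub>-m\<^esub>\<close>, \<open>G\<^sub>r \<mapsto> \<i> G\<^bsub>-r\<^esub>\<close>, \<open>c \<mapsto> -c\<close> exchanges \<open>\<epsilon>\<close> and \<open>-\<epsilon>\<close>, and the admissible
  parameters are a system of representatives for the sign. No other parameters are identified
  (\<open>isomorphism_parameters\<close>): an isomorphism preserves the line of \<open>L\<^sub>0\<close> modulo \<open>c\<close>, thus the eigenspaces of
  left multiplication by \<open>L\<^sub>0\<close> up to sign, and \<open>\<epsilon>\<close> can be read off from \<open>L\<^sub>1 \<cdot> L\<^bsub>-1\<^esub>\<close> and \<open>L\<^bsub>-1\<^esub> \<cdot> L\<^sub>1\<close>.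
\<close>

section \<open>Graded left-symmetric structures on the Witt algebra\<close>

text \<open>
  The structure constants of a product \<open>L\<^sub>m \<cdot> L\<^sub>n = f m n L\<^bsub>m+n\<^esub>\<close> whose commutator is the Witt bracket.
  For such a product left-symmetry says precisely that left multiplications represent the Witt
  algebra on itself.
\<close>

locale witt_lsa =
  fixes f :: "int \<Rightarrow> int \<Rightarrow> complex"
  assumes comm: "f m n - f n m = of_int (m - n)"
    and module_law: "of_int (m - n) * f (m + n) k = f n k * f m (n + k) - f m k * f n (m + k)"
begin

text \<open>
  The automorphism \<open>L\<^sub>m \<mapsto> - L\<^bsub>-m\<^esub>\<close> of the Witt algebra halves the case distinctions below.
\<close>

lemma reflected: "witt_lsa (\<lambda>m n. - f (- m) (- n))"
proof
  fix m n k
  show "- f (- m) (- n) - - f (- n) (- m) = of_int (m - n)"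
    using comm[of "-m" "-n"] by (simp add: algebra_simps)
  show "of_int (m - n) * - f (- (m + n)) (- k)
      = - f (- n) (- k) * - f (- m) (- (n + k)) - - f (- m) (- k) * - f (- n) (- (m + k))"
    using module_law[of "-m" "-n" "-k"] by (simp add: algebra_simps)
qed

text \<open>
  \<open>L\<^sub>0\<close> acts diagonally. Its eigenvalue on \<open>L\<^sub>n\<close> is \<open>-n\<close> up to the defect \<open>f n 0\<close>, which the next lemmas
  show to be constant along every nonzero product.
\<close>

lemma L0_action: "f 0 n = f n 0 - of_int n"
  using comm[of 0 n] by (simp add: algebra_simps)

text \<open>
  \<open>[L\<^sub>0, L\<^sub>n] = -n L\<^sub>n\<close>, so multiplication by \<open>L\<^sub>n\<close> shifts \<open>L\<^sub>0\<close>-eigenvalues by \<open>-n\<close>; comparing with the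
  degree, the defect does not change.
\<close>

lemma defect_constant:
  assumes "f n k \<noteq> 0"
  shows "f (n + k) 0 = f k 0"
proof -
  have "f n k * (f (n + k) 0 - f k 0) = 0"
    using module_law[of 0 n k] by (auto simp: L0_action algebra_simps)
  with assms show ?thesis by auto
qed

lemma defect_sum:
  assumes "m \<noteq> n"
  shows "f (m + n) 0 = f m 0 \<or> f (m + n) 0 = f n 0"
proof -
  have "f m n \<noteq> 0 \<or> f n m \<noteq> 0"
    using comm[of m n] assms by auto
  then show ?thesis
    using defect_constant[of m n] defect_constant[of n m] by (auto simp: add.commute)
qed

text \<open>
  Suppose that \<open>t = f 0 0 \<noteq> 0\<close>. Every defect is then \<open>0\<close> or \<open>t\<close>, and by \<open>defect_sum\<close> the indices of
  either kind are closed under sums of distinct indices. If \<open>1\<close>, respectively \<open>2\<close>, had defect \<open>0\<close>,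
  the indices of defect \<open>0\<close> near it would form an initial piece of a lowest weight module on which
  the operators \<open>L\<^sub>n\<close> with \<open>n \<le> 0\<close>, respectively \<open>n \<le> 1\<close>, act as in the adjoint representation. The
  representation law then prescribes two different values of \<open>f 2 1\<close>, respectively of \<open>f 2 2\<close>.
\<close>

lemma defect_nonzero_cases:
  assumes "f 0 0 \<noteq> 0"
  shows "f 1 0 \<noteq> 0" and "f (- 1) 0 \<noteq> 0 \<Longrightarrow> f 2 0 \<noteq> 0"
proof -
  have sums: "f (m + n) 0 = f m 0 \<or> f (m + n) 0 = f n 0" if "m \<noteq> n" for m n
    using that by (rule defect_sum)
  have z: "f n k = 0" if "f (n + k) 0 \<noteq> f k 0" for n k
    using that defect_constant by blast
  have opp: "f k 0 \<noteq> 0 \<or> f (- k) 0 \<noteq> 0" if "k \<noteq> 0" for k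
    using sums[of k "-k"] assms that by auto
  show one: "f 1 0 \<noteq> 0"
  proof
    assume d1: "f 1 0 = 0"
    have dm1: "f (-1) 0 \<noteq> 0" using opp[of 1] d1 by simp
    have d2: "f 2 0 = 0" using sums[of 2 "-1"] d1 dm1 by auto
    have d3: "f 3 0 = 0" using sums[of 1 2] d1 d2 by auto
    have dm2: "f (-2) 0 \<noteq> 0" using opp[of 2] d2 by simp
    have "f 0 1 = -1" using L0_action[of 1] d1 by simp
    have "f 2 (-1) = 0" "f 3 (-2) = 0" "f 3 (-1) = 0" "f (-1) 1 = 0" "f (-2) 1 = 0"
      by (rule z; use assms d1 d2 d3 dm1 dm2 in simp)+
    moreover from this have "f (-1) 2 = -3" "f (-2) 3 = -5" "f (-1) 3 = -4"
      using comm[of "-1" 2] comm[of "-2" 3] comm[of "-1" 3] by simp_all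
    ultimately have "3 * f 1 1 = -2" "5 * f 2 1 = -4" "3 * f 1 1 = 4 * f 2 1"
      using module_law[of 1 "-1" 1] module_law[of 2 "-2" 1] module_law[of 2 "-1" 1] \<open>f 0 1 = -1\<close>
      by (simp_all add: mult.commute)
    then show False by algebra
  qed
  show "f 2 0 \<noteq> 0" if dm1: "f (- 1) 0 \<noteq> 0"
  proof
    assume d2: "f 2 0 = 0"
    have dm2: "f (-2) 0 \<noteq> 0" using opp[of 2] d2 by simp
    have d3: "f 3 0 = 0" using sums[of 3 "-1"] d2 dm1 by auto
    have "f 0 2 = -2" using L0_action[of 2] d2 by simp
    have "f (-1) 2 = 0" "f 4 (-1) = 0" "f 2 1 = 0" "f (-2) 2 = 0" "f 4 (-2) = 0"
      by (rule z; use assms one d2 d3 dm1 dm2 in simp)+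
    moreover from this have "f (-1) 4 = -5" "f 1 2 = -1" "f (-2) 4 = -6"
      using comm[of "-1" 4] comm[of 1 2] comm[of "-2" 4] by simp_all
    ultimately have "5 * f 2 2 = -3" "6 * f 2 2 = -8"
      using module_law[of 2 "-1" 2] module_law[of 2 "-2" 2] \<open>f 0 2 = -2\<close>
      by (simp_all add: mult.commute)
    then show False by algebra
  qed
qed

end

text \<open>
  Products without defect: \<open>L\<^sub>0\<close> acts on \<open>L\<^sub>n\<close> by the scalar \<open>-n\<close>.
\<close>

locale weighted_witt_lsa = witt_lsa +
  assumes right_zero: "f n 0 = 0"
begin

lemma left_zero: "f 0 n = - of_int n"
  using L0_action[of n] by (simp add: right_zero)

lemma f_one_right: "f n 1 = f 1 n + of_int n - 1"
  using comm[of n 1] by (simp add: algebra_simps)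

lemma f_minus_one_right: "f n (- 1) = f (- 1) n + of_int n + 1"
  using comm[of n "-1"] by (simp add: algebra_simps)

text \<open>
  The commutator \<open>[L\<^sub>1, L\<^bsub>-1\<^esub>] = 2 L\<^sub>0\<close> fixes the increments of \<open>L\<^sub>1 L\<^bsub>-1\<^esub>\<close> along the degrees, and at \<open>k = 0\<close>
  there is the factor \<open>L\<^sub>1 \<cdot> L\<^sub>0 = 0\<close>.
\<close>

lemma ladder: "f 1 k * f (- 1) (k + 1) = of_int (k * (k + 1))"
proof -
  have step: "f 1 (k - 1) * f (- 1) (k - 1 + 1) = f 1 k * f (- 1) (k + 1) - 2 * of_int k" for k
    using module_law[of 1 "-1" k] by (simp add: left_zero algebra_simps)
  show ?thesis
  proof (induction k rule: int_induct[where k = 0])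
    case base
    then show ?case by (simp add: right_zero)
  next
    case (step1 k)
    have "f 1 (k + 1) * f (- 1) (k + 1 + 1) = f 1 k * f (- 1) (k + 1) + 2 * of_int (k + 1)"
      using step[of "k + 1"] by (simp del: of_int_add)
    also have "\<dots> = of_int ((k + 1) * (k + 1 + 1))"
      unfolding step1(2) by (simp add: algebra_simps)
    finally show ?case .
  next
    case (step2 k)
    have "f 1 (k - 1) * f (- 1) (k - 1 + 1) = of_int (k * (k + 1)) - 2 * of_int k"
      by (simp only: step[of k] step2(2))
    also have "\<dots> = of_int ((k - 1) * (k - 1 + 1))"
      by (simp add: algebra_simps)
    finally show ?case .
  qed
qed

lemma f_1_nonzero:
  assumes "k \<noteq> 0" "k \<noteq> - 1"
  shows "f 1 k \<noteq> 0"
proof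
  assume "f 1 k = 0"
  then have "k * (k + 1) = 0" using ladder[of k] by (simp del: of_int_mult)
  with assms show False by simp
qed

text \<open>
  The representation law for \<open>L\<^bsub>-1\<^esub>, L\<^sub>n\<close> acting on \<open>L\<^sub>1\<close>, with \<open>f (-1)\<close> eliminated by \<open>ladder\<close> and \<open>f n 1\<close>
  by compatibility. The recursion does not pass \<open>n = -1\<close>: it links the values \<open>f 1 n\<close> for \<open>n \<ge> 1\<close>,
  and separately those for \<open>n \<le> -2\<close>.
\<close>

lemma f_1_recursion:
  assumes "n \<noteq> - 1"
  shows "f 1 n * (f 1 (n - 1) + 2 * of_int n - 2) = - (of_int n * (of_int n - 1))"
proof -
  let ?n = "of_int n :: complex"
  have "- (?n + 1) * (f 1 (n - 1) + (?n - 1) - 1) = (f 1 n + ?n - 1) * f (- 1) (n + 1)"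
    using module_law[of "-1" n 1] by (simp add: right_zero f_one_right[of n] f_one_right[of "n - 1"] algebra_simps)
  moreover have "f 1 n * f (- 1) (n + 1) = ?n * (?n + 1)"
    using ladder[of n] by simp
  ultimately have "(?n + 1) * (f 1 n * (f 1 (n - 1) + 2 * ?n - 2) + ?n * (?n - 1)) = 0"
    by algebra
  moreover have "?n + 1 \<noteq> 0"
    using assms by (metis add.inverse_inverse eq_neg_iff_add_eq_0 of_int_eq_iff of_int_minus of_int_1)
  ultimately show ?thesis by (simp add: add_eq_0_iff2)
qed

lemma f_two_right:
  "f 1 1 * f n 2 = (f 1 n + of_int n - 1) * f 1 (n + 1) - (1 - of_int n) * (f 1 (n + 1) + of_int n)"
proof -
  have "(1 - of_int n) * f (n + 1) 1 = f n 1 * f 1 (n + 1) - f 1 1 * f n 2"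
    using module_law[of 1 n 1] by (simp add: add.commute)
  then show ?thesis
    using f_one_right[of n] f_one_right[of "n + 1"] by (simp add: algebra_simps)
qed

lemma f_minus_two_right:
  "f (- 1) (- 1) * f n (- 2)
     = (f (- 1) n + of_int n + 1) * f (- 1) (n - 1) + (1 + of_int n) * (f (- 1) (n - 1) + of_int n)"
  using module_law[of "-1" n "-1"]
  by (simp add: f_minus_one_right[of n] f_minus_one_right[of "n - 1"] algebra_simps)

text \<open>
  Relations between the starting values \<open>x\<close> and \<open>y\<close> of the two branches of the recursion and the
  value \<open>a\<close> between them. The relation between \<open>x\<close> and \<open>y\<close> is the law for \<open>L\<^sub>2, L\<^bsub>-2\<^esub>\<close> acting on \<open>L\<^sub>1\<close>; the one
  for \<open>a\<close> combines it with \<open>f 2 (-2) - f (-2) 2 = 4\<close>. All constants occurring in them are first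
  expressed through \<open>x, y, a\<close>. In the family with parameter \<open>\<epsilon>\<close> one has \<open>x = -(1 + \<epsilon>) / (1 + 2 \<epsilon>)\<close>,
  \<open>y = 2 (1 - 2 \<epsilon>) / (1 - \<epsilon>)\<close> and \<open>a = 1 - \<epsilon>\<close>; at \<open>x = -1\<close>, which is \<open>\<epsilon> = 0\<close>, these relations leave \<open>a\<close> free.
\<close>

lemma small_values:
  defines "x \<equiv> f 1 1" and "y \<equiv> f 1 (- 2)" and "a \<equiv> f 1 (- 1)"
  shows "x \<noteq> 0" "y \<noteq> 0" "y * (3 * x + 2) = 8 * x + 6" "(a - 1) * (2 * x + 1) * (x + 1) = (x + 1)\<^sup>2"
    and "x * f (- 2) 3 = y * (3 * x + 2) - 5 * x"
proof -
  show x: "x \<noteq> 0" and y: "y \<noteq> 0"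
    using f_1_nonzero by (simp_all add: x_def y_def)
  have A2: "f 1 2 * (x + 2) = - 2"
    using f_1_recursion[of 2] by (simp add: x_def add.commute)
  then have x2: "x + 2 \<noteq> 0" by auto
  have B2: "x * f (- 1) 2 = 2" and B3: "f 1 2 * f (- 1) 3 = 6" and Bm1: "y * f (- 1) (- 1) = 2"
    using ladder[of 1] ladder[of 2] ladder[of "-2"] by (simp_all add: x_def y_def)
  have B1: "f (- 1) 1 = a - 2"
    using comm[of 1 "-1"] by (auto simp: a_def algebra_simps)
  have B3': "f (- 1) 3 = - 3 * (x + 2)"
  proof -
    have "f 1 2 \<noteq> 0" using f_1_nonzero by simp
    moreover have "f 1 2 * (f (- 1) 3 + 3 * (x + 2)) = 0" using A2 B3 by algebra
    ultimately have "f (- 1) 3 + 3 * (x + 2) = 0" by simp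
    then show ?thesis by algebra
  qed
  have fm22: "x * f (- 2) 2 = (y - 3) * a - 3 * (a - 2)"
    using f_two_right[of "-2"] by (simp add: x_def y_def a_def)
  have f2m2: "2 * f 2 (- 2) = y * ((f (- 1) 2 + 3) * (a - 2) + 3 * a)"
    using f_minus_two_right[of 2] Bm1 B1 by simp algebra
  have d22: "f 2 (- 2) - f (- 2) 2 = 4"
    using comm[of 2 "-2"] by simp
  have R1: "(a - 1) * (3 * x * y + 6) = 4 * x + 2 * y"
  proof -
    have "2 * (x * f 2 (- 2)) = y * ((x * f (- 1) 2 + 3 * x) * (a - 2) + 3 * a * x)"
      using f2m2 by algebra
    then have "x * f 2 (- 2) = y * (a - 2 + 3 * (a - 1) * x)"
      unfolding B2 by algebra
    moreover have "x * f 2 (- 2) - x * f (- 2) 2 = 4 * x"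
      using d22 by (simp flip: right_diff_distrib)
    ultimately show ?thesis using fm22 by algebra
  qed
  have f3m2: "2 * f 3 (- 2) = y * ((f (- 1) 3 + 4) * f (- 1) 2 + 4 * (f (- 1) 2 + 3))"
    using f_minus_two_right[of 3] Bm1 by simp algebra
  have fm23: "f (- 2) 3 = f 3 (- 2) - 5"
    using comm[of "-2" 3] by (simp add: algebra_simps)
  show fm23x: "x * f (- 2) 3 = y * (3 * x + 2) - 5 * x"
    using f3m2 fm23 B2 B3' by algebra
  have f21: "f 2 1 * (x + 2) = x"
    using A2 f_one_right[of 2] by simp algebra
  have f2m1: "x * f 2 (- 1) = 2 + 3 * x"
    using B2 f_minus_one_right[of 2] by (simp add: distrib_left)
  have fm21: "f (- 2) 1 = y - 3"
    using f_one_right[of "-2"] by (simp add: y_def)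
  have "- 4 = f 2 (- 1) * f (- 2) 1 - f 2 1 * f (- 2) 3"
    using module_law[of 2 "-2" 1] by (simp add: left_zero algebra_simps)
  then have "- 4 * (x + 2) * x = (2 + 3 * x) * (y - 3) * (x + 2) - (y * (3 * x + 2) - 5 * x) * x"
    using fm23x f21 f2m1 fm21 x x2 by algebra
  then have "2 * (y * (3 * x + 2)) = 2 * (8 * x + 6)"
    by algebra
  then show R2: "y * (3 * x + 2) = 8 * x + 6"
    by (rule mult_left_cancel[OF zero_neq_numeral[symmetric], THEN iffD1])
  have "12 * ((a - 1) * (2 * x + 1) * (x + 1)) = 12 * (x + 1)\<^sup>2"
    using R1 R2 by algebra
  then show "(a - 1) * (2 * x + 1) * (x + 1) = (x + 1)\<^sup>2"
    by (rule mult_left_cancel[OF zero_neq_numeral[symmetric], THEN iffD1])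
qed

text \<open>
  Away from \<open>x = -1\<close> the relations of \<open>small_values\<close> put \<open>x, y, a\<close> on the curve parametrised by \<open>\<epsilon>\<close>, and
  the recursion propagates the formula. It also yields \<open>u n = 1 + \<epsilon> n \<noteq> 0\<close>: a zero of \<open>u\<close> would make the
  recursion unsolvable on the branch \<open>n \<ge> 1\<close>, and would make a value of \<open>f 1\<close> vanish on the branch \<open>n \<le> -2\<close>,
  where \<open>ladder\<close> excludes this.
\<close>

lemma f_1_formula:
  assumes "f 1 1 \<noteq> - 1"
  obtains \<epsilon> where "\<epsilon> \<noteq> 0" "\<And>n. 1 + \<epsilon> * of_int n \<noteq> 0"
    and "\<And>n. f 1 n * (1 + \<epsilon> * of_int (n + 1)) = - of_int n * (1 + \<epsilon> * of_int n)"
proof -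
  define x y a where "x = f 1 1" and "y = f 1 (- 2)" and "a = f 1 (- 1)"
  have x0: "x \<noteq> 0" and y0: "y \<noteq> 0" and y: "y * (3 * x + 2) = 8 * x + 6"
    and "(a - 1) * (2 * x + 1) * (x + 1) = (x + 1)\<^sup>2"
    using small_values by (simp_all add: x_def y_def a_def)
  moreover have x1: "x + 1 \<noteq> 0"
    using assms by (simp add: x_def add_eq_0_iff2)
  ultimately have a: "(a - 1) * (2 * x + 1) = x + 1"
    by (simp add: power2_eq_square)
  then have x2: "2 * x + 1 \<noteq> 0" using x1 by auto
  have x3: "3 * x + 2 \<noteq> 0"
  proof
    assume "3 * x + 2 = 0"
    moreover from this have "8 * x + 6 = 0" using y by simp
    ultimately have "(2 :: complex) = 0" by algebra
    then show False by simp
  qed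
  \<comment> \<open>solves \<open>x = -(1 + \<epsilon>) / (1 + 2 \<epsilon>)\<close>\<close>
  define \<epsilon> where "\<epsilon> = - (x + 1) / (2 * x + 1)"
  have \<epsilon>: "\<epsilon> * (2 * x + 1) = - (x + 1)"
    using x2 by (simp add: \<epsilon>_def)
  define u where "u n = 1 + \<epsilon> * of_int n" for n :: int
  have u_add: "u (m + n) = u m + \<epsilon> * of_int n" for m n
    by (simp add: u_def algebra_simps)
  have u1: "u 1 * (2 * x + 1) = x" and u2: "u 2 * (2 * x + 1) = - 1"
    and um1: "u (- 1) * (2 * x + 1) = 3 * x + 2" and um2: "u (- 2) * (2 * x + 1) = 4 * x + 3"
    unfolding u_def using \<epsilon> by simp_all algebra+
  have pos: "u (n + 1) \<noteq> 0 \<and> f 1 n * u (n + 1) = - of_int n * u n" if "1 \<le> n" for n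
    using that
  proof (induction n rule: int_ge_induct)
    case base
    have "(x * u 2 + u 1) * (2 * x + 1) = x * (u 2 * (2 * x + 1)) + u 1 * (2 * x + 1)"
      by (simp add: algebra_simps)
    then have "(x * u 2 + u 1) * (2 * x + 1) = 0" by (simp add: u1 u2)
    moreover have "u 2 \<noteq> 0" using u2 by auto
    ultimately show ?case using x2 by (simp add: x_def add_eq_0_iff2)
  next
    case (step n)
    let ?n = "of_int n :: complex"
    have n: "?n \<noteq> 0" "?n + 1 \<noteq> 0"
      using step.hyps of_int_eq_0_iff[of "n + 1", where 'a = complex] by simp_all
    have rec: "f 1 (n + 1) * (f 1 n + 2 * ?n) = - ((?n + 1) * ?n)"
      using f_1_recursion[of "n + 1"] step.hyps by (simp add: algebra_simps)
    have "(f 1 n + 2 * ?n) * u (n + 1) = ?n * u (n + 2)"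
      using step.IH u_add[of n 1] u_add[of n 2] by simp algebra
    then have "f 1 (n + 1) * (?n * u (n + 2)) = - ((?n + 1) * ?n) * u (n + 1)"
      using rec by algebra
    then have "?n * (f 1 (n + 1) * u (n + 2)) = ?n * (- (?n + 1) * u (n + 1))"
      by (simp add: algebra_simps)
    then have F: "f 1 (n + 1) * u (n + 2) = - (?n + 1) * u (n + 1)"
      using n(1) mult_left_cancel by blast
    have "u (n + 2) \<noteq> 0"
    proof
      assume "u (n + 2) = 0"
      then have "(?n + 1) * u (n + 1) = 0" using F by algebra
      then show False using n(2) step.IH by simp
    qed
    with F show ?case by (simp add: add.commute add.left_commute)
  qed
  have neg: "u n \<noteq> 0 \<and> f 1 n * u (n + 1) = - of_int n * u n" if "n \<le> - 2" for n
    using that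
  proof (induction n rule: int_le_induct)
    case base
    have "(y * u (- 1) - 2 * u (- 2)) * (2 * x + 1) = 0" using um1 um2 y by algebra
    then have "y * u (- 1) = 2 * u (- 2)" using x2 by simp
    moreover have "u (- 2) \<noteq> 0"
    proof
      assume "u (- 2) = 0"
      then have "4 * x + 3 = 0" using um2 by simp
      then have "y * (3 * x + 2) = 0" using y by algebra
      then show False using y0 x3 by simp
    qed
    ultimately show ?case unfolding y_def by simp
  next
    case (step n)
    let ?n = "of_int n :: complex"
    have n: "?n \<noteq> 0" "?n - 1 \<noteq> 0"
      using step.hyps of_int_eq_0_iff[of "n - 1", where 'a = complex] by simp_all
    have rec: "f 1 n * (f 1 (n - 1) + 2 * ?n - 2) = - (?n * (?n - 1))"
      using f_1_recursion[of n] step.hyps by simp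
    have "?n * (u n * (f 1 (n - 1) + 2 * ?n - 2) - (?n - 1) * u (n + 1)) = 0"
      using rec step.IH by algebra
    then have "u n * (f 1 (n - 1) + 2 * ?n - 2) = (?n - 1) * u (n + 1)"
      using n(1) by simp
    moreover have "u (n + 1) = u n + \<epsilon>" and "u (n - 1) = u n - \<epsilon>"
      using u_add[of n 1] u_add[of n "-1"] by simp_all
    ultimately have F: "f 1 (n - 1) * u n = - (?n - 1) * u (n - 1)"
      by algebra
    have "f 1 (n - 1) \<noteq> 0" using f_1_nonzero[of "n - 1"] step.hyps by simp
    then have "u (n - 1) \<noteq> 0" using F n step.IH by auto
    with F show ?case by simp
  qed
  have um1': "u (- 1) \<noteq> 0" and u1': "u 1 \<noteq> 0" using um1 x3 u1 x0 by auto
  have a': "a = u (- 1)"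
  proof -
    have "(a - u (- 1)) * (2 * x + 1) = 0" using a um1 by algebra
    then show ?thesis using x2 by simp
  qed
  have trichotomy: "1 \<le> n \<or> n = 0 \<or> n = - 1 \<or> n \<le> - 2" for n :: int by arith
  show ?thesis
  proof (rule that)
    show "\<epsilon> \<noteq> 0"
    proof
      assume "\<epsilon> = 0"
      then have "x + 1 = 0" using \<epsilon> by algebra
      with x1 show False ..
    qed
    show "1 + \<epsilon> * of_int n \<noteq> 0" for n
    proof -
      have "u n \<noteq> 0"
      proof (cases "n \<ge> 2")
        case True
        then show ?thesis using pos[of "n - 1"] by simp
      next
        case False
        then have "n = 1 \<or> n = 0 \<or> n = - 1 \<or> n \<le> - 2" by arith
        then show ?thesis using neg[of n] u1' um1' by (auto simp: u_def)
      qed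
      then show ?thesis by (simp only: u_def) simp
    qed
    show "f 1 n * (1 + \<epsilon> * of_int (n + 1)) = - of_int n * (1 + \<epsilon> * of_int n)" for n
      using trichotomy[of n] pos[of n] neg[of n] a' unfolding u_def
      by (auto simp: right_zero a_def)
  qed
qed

text \<open>
  In the basis \<open>L\<^sub>n / u n\<close> the product becomes the action of the vector fields \<open>L\<^sub>m\<close> on functions,
  \<open>F m n = -n\<close>. Knowing this for \<open>m = \<plusminus>1\<close> and for \<open>n = \<plusminus>1\<close>, the laws for \<open>L\<^bsub>\<plusminus>1\<^esub>, L\<^sub>m\<close> acting on \<open>L\<^sub>n\<close> spread it
  to all \<open>n\<close>.
\<close>

lemma f_formula:
  assumes "f 1 1 \<noteq> - 1"
  obtains \<epsilon> where "\<epsilon> \<noteq> 0" "\<And>n. 1 + \<epsilon> * of_int n \<noteq> 0"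
    and "\<And>m n. f m n * (1 + \<epsilon> * of_int (m + n)) = - of_int n * (1 + \<epsilon> * of_int n)"
proof -
  obtain \<epsilon> where \<epsilon>: "\<epsilon> \<noteq> 0" "\<And>n. 1 + \<epsilon> * of_int n \<noteq> 0"
    "\<And>n. f 1 n * (1 + \<epsilon> * of_int (n + 1)) = - of_int n * (1 + \<epsilon> * of_int n)"
    using f_1_formula[OF assms] by blast
  define u where "u n = 1 + \<epsilon> * of_int n" for n :: int
  have u0: "u n \<noteq> 0" for n using \<epsilon>(2) by (simp add: u_def)
  define F where "F m n = f m n * u (m + n) / u n" for m n
  have f: "f m n = F m n * u n / u (m + n)" for m n
    using u0 by (simp add: F_def)
  have F_law: "of_int (m - n) * F (m + n) k = F n k * F m (n + k) - F m k * F n (m + k)" for m n k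
  proof -
    have *: "u (m + (n + k)) = u (m + n + k)" "u (n + (m + k)) = u (m + n + k)"
      by (simp_all add: algebra_simps)
    have "u k * (of_int (m - n) * F (m + n) k) = u k * (F n k * F m (n + k) - F m k * F n (m + k))"
      using module_law[of m n k] u0[of k] u0[of "n + k"] u0[of "m + k"] u0[of "m + n + k"]
      by (simp add: f * field_simps)
    then show ?thesis using u0[of k] by simp
  qed
  have F1: "F 1 n = - of_int n" for n
    using \<epsilon>(3)[of n] u0[of n] by (simp add: F_def u_def field_simps)
  have F0: "F n 0 = 0" for n
    by (simp add: F_def right_zero)
  have Fn1: "F n 1 = - 1" for n
  proof -
    have "F n 1 * u 1 = (f 1 n + of_int n - 1) * u (n + 1)"
      using u0[of 1] by (simp add: F_def f_one_right)
    also have "\<dots> = - of_int n * u n + (of_int n - 1) * u (n + 1)"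
      using \<epsilon>(3)[of n] by (simp add: u_def algebra_simps)
    also have "\<dots> = - u 1"
      by (simp add: u_def algebra_simps)
    finally show ?thesis using u0[of 1] mult_right_cancel[of "u 1" "F n 1" "- 1"] by simp
  qed
  have Fm1: "F (- 1) n = - of_int n" for n
  proof -
    consider "n = 0" | "n = 1" | "n - 1 \<noteq> 0" "n \<noteq> 0" by fastforce
    then show ?thesis
    proof cases
      case 3
      have "f 1 (n - 1) \<noteq> 0" using f_1_nonzero[of "n - 1"] 3 by simp
      have "F 1 (n - 1) * F (- 1) n = f 1 (n - 1) * f (- 1) n"
        using u0[of n] u0[of "n - 1"] by (simp add: F_def)
      also have "\<dots> = of_int ((n - 1) * n)" using ladder[of "n - 1"] by simp
      finally have "(1 - of_int n) * F (- 1) n = (of_int n - 1) * of_int n"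
        by (simp add: F1)
      then have "(1 - of_int n) * (F (- 1) n + of_int n) = 0"
        by algebra
      then show ?thesis using 3 by (auto simp: add_eq_0_iff2)
    qed (use F0 Fn1 in auto)
  qed
  have Fnm1: "F n (- 1) = 1" for n
  proof -
    have "f (- 1) n * u (n - 1) = - of_int n * u n"
      using Fm1[of n] u0[of n] by (simp add: F_def field_simps)
    moreover have "F n (- 1) * u (- 1) = (f (- 1) n + of_int n + 1) * u (n - 1)"
      using u0[of "- 1"] by (simp add: F_def f_minus_one_right)
    ultimately have "F n (- 1) * u (- 1) = u (- 1)"
      by (simp add: u_def algebra_simps)
    then show ?thesis using u0[of "-1"] by simp
  qed
  have F: "F n k = - of_int k" for n k
  proof -
    have "\<forall>n. F n k = - of_int k" if "k \<ge> 1" for k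
      using that
    proof (induction k rule: int_ge_induct)
      case base
      then show ?case by (simp add: Fn1)
    next
      case (step k)
      have "of_int k * (F n (k + 1) + of_int (k + 1)) = 0" for n
        using F_law[of 1 n k] step.IH by (simp add: F1 add.commute algebra_simps)
      then show ?case using step.hyps by (auto simp: add_eq_0_iff2 simp flip: of_int_add)
    qed
    moreover have "\<forall>n. F n k = - of_int k" if "k \<le> - 1" for k
      using that
    proof (induction k rule: int_le_induct)
      case base
      then show ?case by (simp add: Fnm1)
    next
      case (step k)
      have "of_int k * (F n (k - 1) + of_int (k - 1)) = 0" for n
        using F_law[of "-1" n k] step.IH by (simp add: Fm1 add.commute algebra_simps)
      then show ?case using step.hyps by (auto simp: add_eq_0_iff2 simp flip: of_int_diff)
    qed
    moreover have "k \<ge> 1 \<or> k = 0 \<or> k \<le> - 1" by arith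
    ultimately show ?thesis using F0 by auto
  qed
  have "f m n * u (m + n) = - of_int n * u n" for m n
    using u0 by (simp add: f F)
  with \<epsilon>(1,2) show ?thesis
    by (intro that[of \<epsilon>]) (simp_all only: u_def not_False_eq_True)
qed

end

section \<open>The Virasoro algebra\<close>

text \<open>
  Now \<open>w m n\<close> is the coefficient of \<open>c\<close> in \<open>L\<^sub>m \<cdot> L\<^sub>n\<close>, where \<open>c\<close> annihilates everything.
\<close>

locale virasoro_lsa = witt_lsa +
  fixes w :: "int \<Rightarrow> int \<Rightarrow> complex"
  assumes w_comm: "w m n - w n m = (if m + n = 0 then (of_int m ^ 3 - of_int m) / 12 else 0)"
    and w_module: "of_int (m - n) * w (m + n) k = f n k * w m (n + k) - f m k * w n (m + k)"
begin

text \<open>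
  The defect vanishes. Otherwise \<open>\<plusminus>1\<close> and \<open>\<plusminus>2\<close> all have the defect \<open>t = f 0 0\<close>, and the \<open>c\<close>-coefficients
  of the representation law give \<open>t (w k (-k) - w (-k) k) = 2 k w 0 0\<close> for \<open>k = 1\<close> and \<open>k = 2\<close>. That
  is linear in \<open>k\<close>, whereas the Virasoro cocycle vanishes at \<open>k = 1\<close> but not at \<open>k = 2\<close>.
\<close>

lemma L_L0_eq_zero: "f n 0 = 0"
proof -
  have "f 0 0 = 0"
  proof (rule ccontr)
    assume t: "f 0 0 \<noteq> 0"
    interpret r: witt_lsa "\<lambda>m n. - f (- m) (- n)" by (rule reflected)
    have "f 1 0 \<noteq> 0" "f (-1) 0 \<noteq> 0"
      using defect_nonzero_cases(1) r.defect_nonzero_cases(1) t by auto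
    moreover from this have "f 2 0 \<noteq> 0" "f (-2) 0 \<noteq> 0"
      using defect_nonzero_cases(2) r.defect_nonzero_cases(2) t by auto
    ultimately have d: "f k 0 = f 0 0" if "k \<in> {1, -1, 2, -2}" for k
      using that defect_constant[of k 0] by auto
    have w0: "w (- k) k * f 0 0 = f (- k) k * w 0 0" if "k \<in> {1, -1, 2, -2}" for k
    proof -
      have "of_int k * w (- k) k = f (- k) k * w 0 0 - f 0 k * w (- k) k"
        using w_module[of 0 "- k" k] by simp
      then show ?thesis using d[OF that] L0_action[of k] by algebra
    qed
    have "f (- k) k - f k (- k) = of_int (- 2 * k)" for k
      using comm[of "-k" k] by simp
    have "(w k (-k) - w (-k) k) * f 0 0 = 2 * of_int k * w 0 0" if "k \<in> {1, 2}" for k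
    proof -
      have "(w k (-k) - w (-k) k) * f 0 0 = (f k (- k) - f (- k) k) * w 0 0"
        using w0[of k] w0[of "-k"] that by (auto simp: algebra_simps)
      then show ?thesis using comm[of k "-k"] by simp
    qed
    from this[of 1] this[of 2] show False
      using w_comm[of 1 "-1"] w_comm[of 2 "-2"] t by simp
  qed
  then show ?thesis using defect_constant[of n 0] by force
qed

end

sublocale virasoro_lsa \<subseteq> weighted_witt_lsa
  by unfold_locales (rule L_L0_eq_zero)

context virasoro_lsa
begin

text \<open>
  As \<open>L\<^sub>0\<close> has eigenvalue \<open>-n\<close> on \<open>L\<^sub>n\<close> and \<open>0\<close> on \<open>c\<close>, the representation law expresses \<open>w n k\<close> through
  \<open>w 0 (n + k)\<close>. The symmetry of \<open>w\<close> off the antidiagonal then forces \<open>w 0 p = 0\<close> for \<open>p \<noteq> 0\<close>.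
\<close>

lemma w_off_diagonal:
  assumes "n + k \<noteq> 0"
  shows "w n k = 0"
proof -
  have step: "of_int (n + k) * w n k = - f n k * w 0 (n + k)" for n k
  proof -
    have "- of_int n * w n k = f n k * w 0 (n + k) + of_int k * w n k"
      using w_module[of 0 n k] by (simp add: left_zero)
    then show ?thesis unfolding of_int_add by algebra
  qed
  have w0: "w 0 p = 0" if "p \<noteq> 0" for p
  proof -
    have "of_int (2 * n - p) * w 0 p = 0" for n
    proof -
      have "f n (p - n) * w 0 p = f (p - n) n * w 0 p"
        using step[of n "p - n"] step[of "p - n" n] w_comm[of n "p - n"] that by auto
      moreover have "f n (p - n) - f (p - n) n = of_int (2 * n - p)"
        using comm[of n "p - n"] by (simp add: algebra_simps)
      ultimately show ?thesis by algebra
    qed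
    from this[of p] show ?thesis using that by simp
  qed
  have "of_int (n + k) * w n k = 0" using step[of n k] w0[OF assms] by simp
  then show ?thesis using assms by (simp only: mult_eq_0_iff of_int_eq_0_iff) simp
qed

text \<open>
  The branch of \<open>small_values\<close> with a free parameter, where \<open>L\<^sub>1 \<cdot> L\<^sub>n = -n L\<^bsub>n+1\<^esub>\<close> for \<open>n \<noteq> -1\<close>, admits no
  central extension: there \<open>w 3 (-3)\<close> depends on \<open>w 2 (-2)\<close> and \<open>w 1 (-1)\<close> like a quadratic polynomial
  without constant term, and so does \<open>w (-3) 3\<close>; the difference is the cocycle \<open>(m\<^sup>3 - m) / 12\<close>, which
  is not of this kind.
\<close>

lemma f_1_1_neq: "f 1 1 \<noteq> - 1"
proof
  assume x: "f 1 1 = - 1"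
  have y: "f 1 (- 2) = 2" using small_values(3) x by simp
  have "f (- 2) 3 = - 3" using small_values(5) x y by (simp add: minus_equation_iff)
  have "f (- 1) 2 = - 2" "f (- 1) 3 = - 3"
  proof -
    have A2: "f 1 2 = - 2" using f_1_recursion[of 2] x by simp
    show "f (- 1) 2 = - 2" using ladder[of 1] x by (simp add: minus_equation_iff)
    show "f (- 1) 3 = - 3" using ladder[of 2] A2 by (simp add: minus_equation_iff)
  qed
  have "f 1 (- 3) = 3"
    using f_1_recursion[of "-2"] y by (simp add: algebra_simps)
  have "f (- 3) 2 = - 2"
    using f_two_right[of "-3"] x y \<open>f 1 (- 3) = 3\<close> by (simp add: minus_equation_iff)
  then have "f 2 (- 3) = 3" using comm[of 2 "-3"] by simp
  have "w 3 (- 3) = 3 * w 2 (- 2) - 3 * w 1 (- 1)"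
    using w_module[of 2 1 "-3"] \<open>f 1 (- 3) = 3\<close> \<open>f 2 (- 3) = 3\<close> by simp
  moreover have "w (- 3) 3 = 3 * w (- 2) 2 - 3 * w (- 1) 1"
    using w_module[of "-2" "-1" 3] \<open>f (- 1) 3 = - 3\<close> \<open>f (- 2) 3 = - 3\<close>
    by (simp add: algebra_simps)
  ultimately have "w 3 (- 3) - w (- 3) 3 = 3 * (w 2 (- 2) - w (- 2) 2) - 3 * (w 1 (- 1) - w (- 1) 1)"
    by simp
  then show False
    using w_comm[of 3 "-3"] w_comm[of 2 "-2"] w_comm[of 1 "-1"] by simp
qed

text \<open>
  After division by \<open>u (-m)\<close> the representation law turns into
  \<open>(m - n) b (m + n) = (m + n) (b m - b n)\<close>, whose solutions are the quadratic polynomials without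
  constant term. The two coefficients are then read off from the odd part of \<open>m \<mapsto> w m (-m)\<close>,
  which is half the Virasoro cocycle.
\<close>

lemma w_formula:
  assumes \<epsilon>: "\<epsilon> \<noteq> 0" "\<And>n. 1 + \<epsilon> * of_int n \<noteq> 0"
    and f: "\<And>m n. f m n * (1 + \<epsilon> * of_int (m + n)) = - of_int n * (1 + \<epsilon> * of_int n)"
  shows "w m (- m) = (of_int m ^ 3 - of_int m + (\<epsilon> - inverse \<epsilon>) * of_int m ^ 2) / 24"
proof -
  define u where "u n = 1 + \<epsilon> * of_int n" for n :: int
  have u0: "u n \<noteq> 0" for n using \<epsilon>(2) by (simp add: u_def)
  define b where "b m = w m (- m) / u (- m)" for m
  have w: "w m (- m) = b m * u (- m)" for m using u0 by (simp add: b_def)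
  have b_law: "of_int (m - n) * b (m + n) = of_int (m + n) * (b m - b n)" for m n
  proof -
    have f': "f n (- (m + n)) * u (- m) = of_int (m + n) * u (- (m + n))" for m n
      using f[of n "- (m + n)"] unfolding u_def by simp
    have "of_int (m - n) * w (m + n) (- (m + n))
        = f n (- (m + n)) * w m (- m) - f m (- (m + n)) * w n (- n)"
      using w_module[of m n "- (m + n)"] by simp
    also have "\<dots> = (f n (- (m + n)) * u (- m)) * b m - (f m (- (n + m)) * u (- n)) * b n"
      unfolding w by (simp add: algebra_simps)
    also have "\<dots> = of_int (m + n) * (b m - b n) * u (- (m + n))"
      unfolding f' by (simp add: algebra_simps)
    finally have "of_int (m - n) * b (m + n) * u (- (m + n))
        = of_int (m + n) * (b m - b n) * u (- (m + n))"
      by (simp only: w mult.assoc)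
    then show ?thesis
      by (rule mult_right_cancel[OF u0, THEN iffD1])
  qed
  \<comment> \<open>the quadratic polynomial through the values of \<open>b\<close> at \<open>0\<close>, \<open>1\<close> and \<open>2\<close>\<close>
  obtain \<kappa> \<mu> where b12: "b 1 = \<kappa> + \<mu>" "b 2 = 4 * \<kappa> + 2 * \<mu>"
  proof
    show "b 1 = (b 2 - 2 * b 1) / 2 + (2 * b 1 - b 2 / 2)" by (simp add: field_simps)
    show "b 2 = 4 * ((b 2 - 2 * b 1) / 2) + 2 * (2 * b 1 - b 2 / 2)" by (simp add: field_simps)
  qed
  have b: "b m = of_int m * (\<kappa> * of_int m + \<mu>)" for m
  proof -
    have b0: "b 0 = 0" using b_law[of 1 "-1"] by simp
    have pos: "b m = of_int m * (\<kappa> * of_int m + \<mu>)" if "m \<ge> 2" for m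
      using that
    proof (induction m rule: int_ge_induct)
      case base
      then show ?case by (simp add: b12)
    next
      case (step m)
      let ?m = "of_int m :: complex"
      have "(?m - 1) * b (m + 1) = (?m + 1) * (?m * (\<kappa> * ?m + \<mu>) - (\<kappa> + \<mu>))"
        using b_law[of m 1] step.IH b12 by simp
      also have "\<dots> = (?m - 1) * ((?m + 1) * (\<kappa> * (?m + 1) + \<mu>))"
        by algebra
      finally show ?case using step.hyps by simp
    qed
    have nonneg: "b m = of_int m * (\<kappa> * of_int m + \<mu>)" if "m \<ge> 0" for m
    proof -
      have "m = 0 \<or> m = 1 \<or> m \<ge> 2" using that by arith
      then show ?thesis using b0 b12 pos by auto
    qed
    have "b (- m) = - of_int m * (- (\<kappa> * of_int m) + \<mu>)" if "m \<ge> 0" for m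
    proof -
      have "of_int (2 * m + 1) * b 1 = b (m + 1) - b (- m)"
        using b_law[of "m + 1" "- m"] by simp
      then show ?thesis
        using nonneg[of "m + 1"] that b12 by simp algebra
    qed
    from this[of "-m"] nonneg[of m] show ?thesis by (cases "m \<ge> 0") auto
  qed
  have odd: "2 * (\<mu> * of_int m - \<epsilon> * \<kappa> * of_int m ^ 3) = (of_int m ^ 3 - of_int m) / 12" for m
  proof -
    have "2 * (\<mu> * of_int m - \<epsilon> * \<kappa> * of_int m ^ 3) = w m (- m) - w (- m) m"
    proof -
      have p: "w m (- m) = of_int m * (\<kappa> * of_int m + \<mu>) * (1 - \<epsilon> * of_int m)"
        using w[of m] by (simp add: b u_def)
      have n: "w (- m) m = - of_int m * (- (\<kappa> * of_int m) + \<mu>) * (1 + \<epsilon> * of_int m)"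
        using w[of "- m"] by (simp add: b u_def)
      show ?thesis unfolding p n by (simp add: algebra_simps power3_eq_cube)
    qed
    then show ?thesis using w_comm[of m "-m"] by simp
  qed
  have "\<mu> = \<epsilon> * \<kappa>" using odd[of 1] by simp
  moreover have "24 * \<mu> = - 1"
    using odd[of 2] unfolding \<open>\<mu> = \<epsilon> * \<kappa>\<close> by (simp add: field_simps minus_equation_iff)
  ultimately have coeffs: "\<mu> = - (1 / 24)" "\<kappa> = - (1 / 24) * inverse \<epsilon>"
    using \<epsilon>(1) by (simp_all add: field_simps)
  show ?thesis
    unfolding w b u_def coeffs using \<epsilon>(1)
    by (simp add: field_simps power3_eq_cube power2_eq_square)
qed

end

section \<open>The odd part of the super-Virasoro algebra\<close>

text \<open>
  The algebra behind \<open>ratio_eq_1\<close> below. Here \<open>1 + a\<close> is the unknown ratio for a pair of odd weights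
  \<open>(s, r)\<close>, and \<open>b, a', b', e, e'\<close> are the deviations for \<open>(r, s)\<close>, \<open>(-r, -s)\<close>, \<open>(-s, -r)\<close>, \<open>(s, -r)\<close>,
  \<open>(-r, s)\<close>. If \<open>a \<noteq> 0\<close>, then the equations for \<open>a, b, a', b'\<close> determine \<open>a\<close>, and so do those for
  \<open>a, b, e, e'\<close>; equality of both values is a condition on \<open>r\<close>, \<open>s\<close> and \<open>\<epsilon>\<close> alone.
\<close>

lemma deformation_quadratic:
  fixes \<epsilon> r s a b a' b' e e' :: complex
  defines "V \<equiv> \<lambda>x. 1 + 2 * \<epsilon> * x" and "u \<equiv> \<lambda>x. 1 + \<epsilon> * x"
  assumes "\<epsilon> \<noteq> 0" "a \<noteq> 0"
    and ab: "a * V r + b * V s = 0" and ab': "a' * V (- s) + b' * V (- r) = 0"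
    and aa': "a + a' + 2 * a * a' = 0" and bb': "b + b' + 2 * b * b' = 0"
    and ee': "e * V (- r) + e' * V s = 0"
    and e'a: "V s * e' * (1 + a) = u (r - s) * a" and be: "V s * b * (1 + e) = u (- (r + s)) * e"
  shows "2 * s - \<epsilon> * (3 * r ^ 2 + 2 * r * s + 3 * s ^ 2) + 4 * \<epsilon> ^ 2 * r * s * (r + s) = 0"
proof -
  note defs = V_def u_def
  \<comment> \<open>the first value of \<open>a\<close>: eliminate \<open>a'\<close>, \<open>b'\<close>, and then \<open>b\<close>\<close>
  have "a * (V (- s) * (V s - 2 * a * V r)) = a * (V r * V (- r) * (1 + 2 * a))"
  proof -
    have a1: "a' * (1 + 2 * a) = - a" and b1: "b' * (1 + 2 * b) = - b"
      using aa' bb' by algebra+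
    have "(a' * (1 + 2 * a)) * V (- s) * (1 + 2 * b) + (b' * (1 + 2 * b)) * V (- r) * (1 + 2 * a) = 0"
      using ab' by algebra
    then have "a * V (- s) * (1 + 2 * b) + b * V (- r) * (1 + 2 * a) = 0"
      unfolding a1 b1 by algebra
    then have "a * V (- s) * (V s + 2 * (b * V s)) + (b * V s) * V (- r) * (1 + 2 * a) = 0"
      by algebra
    moreover have "b * V s = - (a * V r)" using ab by algebra
    ultimately show ?thesis by algebra
  qed
  then have "V (- s) * (V s - 2 * a * V r) = V r * V (- r) * (1 + 2 * a)"
    using \<open>a \<noteq> 0\<close> by simp
  then have "4 * (a * V r * u (- (r + s))) = 4 * (\<epsilon> ^ 2 * (r ^ 2 - s ^ 2))"
    unfolding defs by algebra
  then have 1: "a * V r * u (- (r + s)) = \<epsilon> ^ 2 * (r ^ 2 - s ^ 2)"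
    by simp
  \<comment> \<open>the second value of \<open>a\<close>: eliminate \<open>e\<close>, \<open>e'\<close>, and then \<open>b\<close>\<close>
  have "a * (V r * (V (- r) * (1 + a) - u (r - s) * a)) = a * (u (- (r + s)) * u (r - s))"
  proof -
    have "V s * b * (V (- r) + e * V (- r)) = u (- (r + s)) * (e * V (- r))"
      using be by algebra
    moreover have "e * V (- r) = - (e' * V s)" "V s * b = - (a * V r)" using ee' ab by algebra+
    ultimately have "a * V r * (V (- r) - e' * V s) = u (- (r + s)) * (e' * V s)"
      by algebra
    then have "a * V r * (V (- r) * (1 + a) - V s * e' * (1 + a)) = u (- (r + s)) * (V s * e' * (1 + a))"
      by algebra
    then show ?thesis unfolding e'a by algebra
  qed
  then have "V r * (V (- r) * (1 + a) - u (r - s) * a) = u (- (r + s)) * u (r - s)"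
    using \<open>a \<noteq> 0\<close> by simp
  then have "\<epsilon> * (a * V r * (3 * r - s)) = \<epsilon> * (2 * s - \<epsilon> * (3 * r ^ 2 + s ^ 2))"
    unfolding defs by algebra
  then have 2: "a * V r * (3 * r - s) = 2 * s - \<epsilon> * (3 * r ^ 2 + s ^ 2)"
    using \<open>\<epsilon> \<noteq> 0\<close> by simp
  have "(3 * r - s) * (\<epsilon> ^ 2 * (r ^ 2 - s ^ 2)) = (2 * s - \<epsilon> * (3 * r ^ 2 + s ^ 2)) * u (- (r + s))"
    unfolding 1[symmetric] 2[symmetric] by algebra
  then show ?thesis unfolding defs by algebra
qed

lemma reciprocal_sum:
  fixes a a' :: complex
  assumes "1 / (a + 1) + 1 / (a' + 1) = 2" "a + 1 \<noteq> 0" "a' + 1 \<noteq> 0"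
  shows "a + a' + 2 * a * a' = 0"
proof -
  have "1 / (a + 1) * ((a + 1) * (a' + 1)) = a' + 1" "1 / (a' + 1) * ((a + 1) * (a' + 1)) = a + 1"
    using assms(2,3) by simp_all
  then have "2 * ((a + 1) * (a' + 1)) = (a' + 1) + (a + 1)"
    unfolding assms(1)[symmetric] distrib_right by (simp only:)
  then show ?thesis by algebra
qed

text \<open>
  The odd basis vectors are numbered by integers: \<open>G\<^sub>k\<close> stands for \<open>G\<^sub>r\<close> with \<open>r = \<rho> k = k + T/2\<close>, where
  \<open>T = 2 \<theta>\<close>. In particular \<open>G\<^sub>k\<close> and \<open>G\<^bsub>-k-T\<^esub>\<close> have opposite weights. The constants describe
  \<^item> \<open>L\<^sub>m \<cdot> L\<^sub>n = f m n L\<^bsub>m+n\<^esub> + w m n c\<close>,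
  \<^item> \<open>L\<^sub>m \<cdot> G\<^sub>k = g m k G\<^bsub>k+m\<^esub>\<close> and \<open>G\<^sub>k \<cdot> L\<^sub>m = h k m G\<^bsub>k+m\<^esub>\<close>,
  \<^item> \<open>G\<^sub>k \<cdot> G\<^sub>l = d k l L\<^bsub>k+l+T\<^esub> + v k l c\<close>.

  The assumptions on sums and differences of two constants are compatibility with the super-bracket. The
  others, named after triples of basis vectors, say that left multiplications represent the
  super-Virasoro algebra.
\<close>

locale super_structure_constants = virasoro_lsa f w
  for T :: int and f w :: "int \<Rightarrow> int \<Rightarrow> complex" +
  fixes g h d v :: "int \<Rightarrow> int \<Rightarrow> complex" and \<rho> :: "int \<Rightarrow> complex"
  defines "\<rho> k \<equiv> of_int (2 * k + T) / 2"
  assumes L_G_comm: "g m k - h k m = of_int m / 2 - \<rho> k"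
    and G_G_comm: "d k l + d l k = 2"
    and v_comm: "v k l + v l k = (if k + l + T = 0 then (4 * \<rho> k ^ 2 - 1) / 12 else 0)"
    and L_L_G: "of_int (m - n) * g (m + n) k = g n k * g m (k + n) - g m k * g n (k + m)"
    and L_G_L: "(of_int m / 2 - \<rho> k) * h (k + m) n = h k n * g m (k + n) - f m n * h k (m + n)"
    and L_G_G: "(of_int m / 2 - \<rho> k) * d (k + m) l = d k l * f m (k + l + T) - g m l * d k (l + m)"
    and v_L_G_G: "(of_int m / 2 - \<rho> k) * v (k + m) l = d k l * w m (k + l + T) - g m l * v k (l + m)"
    and G_G_L: "2 * f (k + l + T) n = h l n * d k (l + n) + h k n * d l (k + n)"
    and v_G_G_L: "2 * w (k + l + T) n = h l n * v k (l + n) + h k n * v l (k + n)"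
    and G_G_G: "2 * g (k + l + T) j = d l j * h k (l + j + T) + d k j * h l (k + j + T)"
begin

lemma h_zero: "h k 0 = 0"
  using G_G_L[of k k 0] G_G_comm[of k k] by (simp add: right_zero)

lemma d_diag: "d k k = 1"
  using G_G_comm[of k k] by simp

context
  fixes \<epsilon> :: complex
  assumes \<epsilon>0: "\<epsilon> \<noteq> 0" and u_nonzero: "1 + \<epsilon> * of_int n \<noteq> 0"
    and f_eq: "f m n * (1 + \<epsilon> * of_int (m + n)) = - of_int n * (1 + \<epsilon> * of_int n)"
begin

definition u :: "int \<Rightarrow> complex" where "u n = 1 + \<epsilon> * of_int n"

lemma u0: "u n \<noteq> 0"
  using u_nonzero by (simp add: u_def)

lemma f_u: "f m n = - of_int n * u n / u (m + n)"
proof -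
  have "f m n * u (m + n) = - of_int n * u n"
    using f_eq[of m n] by (simp only: u_def)
  then show ?thesis by (simp only: nonzero_eq_divide_eq[OF u0] not_False_eq_True)
qed

text \<open>
  The constants \<open>d\<close> relative to the ones of the family with parameter \<open>\<epsilon>\<close>. The aim is to show that
  this ratio is \<open>1\<close>. Note that \<open>u (2 * l + T)\<close> is \<open>1 + 2 \<epsilon> r\<close> for the weight \<open>r = l + T/2\<close>.
\<close>

definition ratio :: "int \<Rightarrow> int \<Rightarrow> complex" where "ratio k l = d k l * u (k + l + T) / u (2 * l + T)"

lemma d_ratio: "d k l = ratio k l * u (2 * l + T) / u (k + l + T)"
  using u0 by (simp add: ratio_def)

text \<open>
  \<open>G\<^sub>k\<close> is a square root of \<open>L\<^bsub>2k+T\<^esub>\<close>: \<open>[G\<^sub>k, G\<^sub>k] = 2 L\<^bsub>2k+T\<^esub>\<close>, so applying \<open>G\<^sub>k\<close> twice to \<open>L\<^sub>n\<close> is the known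
  multiplication by \<open>L\<^bsub>2k+T\<^esub>\<close>. Hence \<open>d\<close> determines \<open>h\<close>, and compatibility then gives \<open>g\<close>.
\<close>

lemma h_ratio: "h k n * ratio k (k + n) = - of_int n * u n / u (2 * k + 2 * n + T)"
proof -
  have "f (2 * k + T) n = h k n * d k (k + n)"
    using G_G_L[of k k n] by simp
  then show ?thesis
    using u0 by (simp add: f_u ratio_def field_simps)
qed

lemma ratio_nonzero: "ratio k l \<noteq> 0"
proof (cases "l = k")
  case True
  then show ?thesis using d_diag[of k] u0 by (simp add: ratio_def)
next
  case False
  then show ?thesis using h_ratio[of k "l - k"] u0 by auto
qed

lemma h_eq: "h k n = - of_int n * u n / (u (2 * k + 2 * n + T) * ratio k (k + n))"
  using h_ratio[of k n] ratio_nonzero[of k "k + n"] u0 by (simp add: field_simps)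

lemma ratio_diag: "ratio k k = 1"
  using d_diag[of k] u0 by (simp add: ratio_def)

lemma ratio_comm: "(ratio k l - 1) * u (2 * l + T) + (ratio l k - 1) * u (2 * k + T) = 0"
proof -
  have "ratio k l * u (2 * l + T) + ratio l k * u (2 * k + T) = 2 * u (k + l + T)"
    using G_G_comm[of k l] u0[of "k + l + T"] by (simp add: d_ratio field_simps)
  also have "\<dots> = u (2 * k + T) + u (2 * l + T)" by (simp add: u_def algebra_simps)
  finally show ?thesis by (simp add: algebra_simps)
qed

text \<open>
  If \<open>m\<close> is minus twice the weight of \<open>G\<^sub>k\<close>, then \<open>[L\<^sub>m, G\<^bsub>k+m\<^esub>] = 0\<close>. The representation law applied to
  \<open>L\<^bsub>-m\<^esub>\<close> therefore gives \<open>L\<^sub>m \<cdot> G\<^sub>k = 0\<close>, and compatibility determines \<open>G\<^sub>k \<cdot> L\<^sub>m\<close>.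
\<close>

lemma ratio_opposite: "ratio k (- k - T) = 1"
proof (cases "2 * k + T = 0")
  case True
  then have "- k - T = k" by simp
  then show ?thesis by (simp only: ratio_diag)
next
  case False
  define m where "m = - (2 * k + T)"
  have m: "m \<noteq> 0" "k + m = - k - T" "\<rho> (k + m) = of_int m / 2"
    using False by (auto simp: m_def \<rho>_def)
  have "h (k + m) (- m) * g m k = 0"
    using L_G_L[of m "k + m" "- m"] m(3) by (simp add: h_zero)
  moreover have "h (k + m) (- m) \<noteq> 0"
    using m(1) u0 ratio_nonzero by (simp add: h_eq)
  ultimately have "- h k m = of_int m / 2 - \<rho> k"
    using L_G_comm[of m k] by simp
  also have "\<dots> = of_int m" by (simp add: m_def \<rho>_def field_simps)
  finally have "h k m = - of_int m" by (simp add: minus_equation_iff)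
  moreover have "2 * k + 2 * m + T = m" by (simp add: m_def)
  ultimately have "- of_int m * ratio k (- k - T) = - of_int m * u m / u m"
    using h_ratio[of k m] by (simp only: m(2))
  then show ?thesis using m(1) u0[of m] by simp
qed

text \<open>
  The law for two odd vectors of weights \<open>r\<close> and \<open>-s\<close> acting on \<open>L\<^bsub>s-r\<^esub>\<close>: both products \<open>G \<cdot> G\<close> in it
  have opposite weights, so that \<open>ratio_opposite\<close> evaluates them.
\<close>

lemma ratio_reflect:
  assumes "k \<noteq> l"
  shows "1 / ratio k l + 1 / ratio (- l - T) (- k - T) = 2"
proof -
  define k' l' where "k' = - k - T" and "l' = - l - T"
  define n where "n = l - k"
  have n: "n \<noteq> 0" "k + l' + T = - n" "k + n = l" "l' + n = k'" using assms by (simp_all add: n_def k'_def l'_def)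
  have opp: "ratio k k' = 1" "ratio l' l = 1"
    using ratio_opposite[of k] ratio_opposite[of "- l - T"] by (simp_all add: k'_def l'_def)
  have d1: "d k k' = u (2 * k' + T)" "d l' l = u (2 * l + T)"
    using opp by (simp_all add: d_ratio u_def[of 0] k'_def l'_def)
  have "h l' n * d k k' + h k n * d l' l = 2 * f (- n) n"
    using G_G_L[of k l' n] by (simp only: n)
  moreover have "h l' n = - of_int n * u n / (u (2 * k' + T) * ratio l' k')"
    "h k n = - of_int n * u n / (u (2 * l + T) * ratio k l)"
    using h_eq[of l' n] h_eq[of k n] unfolding n(3,4) by (simp_all add: n_def k'_def l'_def)
  ultimately have "(- of_int n * u n) * (1 / ratio k l + 1 / ratio l' k') = (- of_int n * u n) * 2"
    using d1 u0[of "2 * k' + T"] u0[of "2 * l + T"] by (simp add: f_u u_def[of 0] field_simps)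
  then show ?thesis using n(1) u0[of n] unfolding k'_def[symmetric] l'_def[symmetric] by simp
qed

text \<open>
  The law for \<open>L\<^sub>m, G\<^sub>k\<close> acting on \<open>G\<^sub>l\<close> in total degree \<open>0\<close>, where again \<open>ratio_opposite\<close> evaluates all
  products \<open>G \<cdot> G\<close> except \<open>G\<^sub>k \<cdot> G\<^sub>l\<close>. The second ratio comes from \<open>L\<^sub>m \<cdot> G\<^sub>l\<close> through \<open>h_eq\<close>.
\<close>

lemma ratio_mixed:
  assumes "k + l + T \<noteq> 0"
  shows "u (2 * l + T) * (ratio k l - 1) = u (- (k + l + T)) * (1 - 1 / ratio l (- k - T))"
proof -
  define m where "m = - (k + l + T)"
  have m: "m \<noteq> 0" "k + m = - l - T" "l + m = - k - T" "k + l + T = - m"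
    using assms by (simp_all add: m_def)
  have d1: "d (- l - T) l = u (2 * l + T)" "d k (- k - T) = u (2 * (- k - T) + T)"
    using ratio_opposite[of k] ratio_opposite[of "- l - T"] by (simp_all add: d_ratio u_def[of 0])
  have "(of_int m / 2 - \<rho> k) * d (- l - T) l = d k l * f m (- m) - g m l * d k (- k - T)"
    using L_G_G[of m k l] by (simp only: m)
  moreover have "g m l = h l m + of_int m / 2 - \<rho> l"
    using L_G_comm[of m l] by (simp add: diff_eq_eq)
  moreover have "h l m * u (2 * (- k - T) + T) = - of_int m * u m / ratio l (- k - T)"
    using h_eq[of l m] m(3) u0[of "2 * (- k - T) + T"] by (simp add: m_def)
  moreover have "d k l * f m (- m) = of_int m * ratio k l * u (2 * l + T)"
    using m(4) u0[of "- m"] by (simp add: d_ratio f_u u_def[of 0])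
  ultimately have "(of_int m / 2 - \<rho> k) * u (2 * l + T) = of_int m * ratio k l * u (2 * l + T)
      - (- of_int m * u m / ratio l (- k - T) + (of_int m / 2 - \<rho> l) * u (2 * (- k - T) + T))"
    unfolding d1 by (simp add: algebra_simps)
  moreover have "(of_int m / 2 - \<rho> k) * u (2 * l + T) + (of_int m / 2 - \<rho> l) * u (2 * (- k - T) + T)
      = of_int m * u (2 * l + T) + of_int m * u m"
    by (simp add: m_def u_def \<rho>_def field_simps)
  ultimately have "of_int m * (u (2 * l + T) * (ratio k l - 1)) = of_int m * (u m * (1 - 1 / ratio l (- k - T)))"
    by (simp add: algebra_simps)
  then show ?thesis using m(1) unfolding m_def[symmetric] by simp
qed

text \<open>
  The condition of \<open>deformation_quadratic\<close> must hold for a pair of weights and, since a deviation of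
  \<open>ratio k l\<close> from \<open>1\<close> entails one of \<open>ratio l k\<close>, also for the interchanged pair. The difference of
  the two conditions says that the weights coincide.
\<close>

lemma ratio_eq_1: "ratio k l = 1"
proof (rule ccontr)
  assume "ratio k l \<noteq> 1"
  have quad: "2 * \<rho> k - \<epsilon> * (3 * \<rho> l ^ 2 + 2 * \<rho> l * \<rho> k + 3 * \<rho> k ^ 2)
      + 4 * \<epsilon> ^ 2 * \<rho> l * \<rho> k * (\<rho> l + \<rho> k) = 0"
    if "ratio k l \<noteq> 1" "k \<noteq> l" "k + l + T \<noteq> 0" for k l
  proof -
    define a b a' b' e e' where "a = ratio k l - 1" and "b = ratio l k - 1"
      and "a' = ratio (- l - T) (- k - T) - 1" and "b' = ratio (- k - T) (- l - T) - 1"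
      and "e = ratio k (- l - T) - 1" and "e' = ratio (- l - T) k - 1"
    note defs = a_def b_def a'_def b'_def e_def e'_def
    have V: "1 + 2 * \<epsilon> * \<rho> j = u (2 * j + T)" "1 + 2 * \<epsilon> * - \<rho> j = u (2 * (- j - T) + T)" for j
      by (simp_all add: u_def \<rho>_def algebra_simps)
    show ?thesis
    proof (rule deformation_quadratic[where \<epsilon> = \<epsilon> and r = "\<rho> l" and s = "\<rho> k" and a = a and b = b and a' = a' and b' = b' and e = e and e' = e'])
      show "\<epsilon> \<noteq> 0" by (rule \<epsilon>0)
      show "a \<noteq> 0" using that by (simp add: a_def)
      show "a * (1 + 2 * \<epsilon> * \<rho> l) + b * (1 + 2 * \<epsilon> * \<rho> k) = 0"
        unfolding V defs by (rule ratio_comm)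
      show "a' * (1 + 2 * \<epsilon> * - \<rho> k) + b' * (1 + 2 * \<epsilon> * - \<rho> l) = 0"
        unfolding V defs by (rule ratio_comm)
      show "a + a' + 2 * a * a' = 0"
        using ratio_reflect[of k l] ratio_nonzero that by (intro reciprocal_sum) (simp_all add: defs)
      show "b + b' + 2 * b * b' = 0"
        using ratio_reflect[of l k] ratio_nonzero that by (intro reciprocal_sum) (simp_all add: defs)
      show "e * (1 + 2 * \<epsilon> * - \<rho> l) + e' * (1 + 2 * \<epsilon> * \<rho> k) = 0"
        unfolding V defs by (rule ratio_comm)
      have "u (2 * k + T) * e' = u (- (- l - T + k + T)) * (1 - 1 / ratio k l)"
        using ratio_mixed[of "- l - T" k] that(2) by (simp add: e'_def)
      moreover have "u (- (- l - T + k + T)) = 1 + \<epsilon> * (\<rho> l - \<rho> k)"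
        by (simp add: u_def \<rho>_def field_simps)
      ultimately have "u (2 * k + T) * e' = (1 + \<epsilon> * (\<rho> l - \<rho> k)) * (1 - 1 / ratio k l)"
        by simp
      then show "(1 + 2 * \<epsilon> * \<rho> k) * e' * (1 + a) = (1 + \<epsilon> * (\<rho> l - \<rho> k)) * a"
        unfolding V a_def using ratio_nonzero[of k l] by (simp add: left_diff_distrib)
      have "u (2 * k + T) * b = u (- (l + k + T)) * (1 - 1 / ratio k (- l - T))"
        using ratio_mixed[of l k] that(3) by (simp add: b_def add.commute)
      moreover have "u (- (l + k + T)) = 1 + \<epsilon> * - (\<rho> l + \<rho> k)"
        by (simp add: u_def \<rho>_def field_simps)
      ultimately have "u (2 * k + T) * b = (1 + \<epsilon> * - (\<rho> l + \<rho> k)) * (1 - 1 / ratio k (- l - T))"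
        by simp
      then show "(1 + 2 * \<epsilon> * \<rho> k) * b * (1 + e) = (1 + \<epsilon> * - (\<rho> l + \<rho> k)) * e"
        unfolding V e_def using ratio_nonzero[of k "- l - T"] by (simp add: left_diff_distrib)
    qed
  qed
  have kl: "k \<noteq> l" "k + l + T \<noteq> 0"
  proof -
    show "k \<noteq> l" using \<open>ratio k l \<noteq> 1\<close> ratio_diag by auto
    show "k + l + T \<noteq> 0"
    proof
      assume "k + l + T = 0"
      then have "l = - k - T" by simp
      then show False using \<open>ratio k l \<noteq> 1\<close> ratio_opposite by simp
    qed
  qed
  moreover have "ratio l k \<noteq> 1"
    using ratio_comm[of k l] \<open>ratio k l \<noteq> 1\<close> u0[of "2 * l + T"] by auto
  ultimately have "2 * \<rho> k - \<epsilon> * (3 * \<rho> l ^ 2 + 2 * \<rho> l * \<rho> k + 3 * \<rho> k ^ 2)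
        + 4 * \<epsilon> ^ 2 * \<rho> l * \<rho> k * (\<rho> l + \<rho> k) = 0"
    and "2 * \<rho> l - \<epsilon> * (3 * \<rho> k ^ 2 + 2 * \<rho> k * \<rho> l + 3 * \<rho> l ^ 2)
        + 4 * \<epsilon> ^ 2 * \<rho> k * \<rho> l * (\<rho> k + \<rho> l) = 0"
    using quad[of k l] quad[of l k] \<open>ratio k l \<noteq> 1\<close> by (simp_all add: add.commute)
  then have "2 * \<rho> k = 2 * \<rho> l" by algebra
  then show False using kl(1) by (simp add: \<rho>_def)
qed

lemma d_formula: "d k l = u (2 * l + T) / u (k + l + T)"
  by (simp add: d_ratio ratio_eq_1)

lemma h_formula: "h k n = - of_int n * u n / u (2 * k + 2 * n + T)"
  by (simp add: h_eq ratio_eq_1)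

lemma g_formula: "g m k = - (of_int m / 2 + \<rho> k) * u (2 * k + T) / u (2 * k + 2 * m + T)"
proof -
  have "g m k = of_int m / 2 - \<rho> k - of_int m * u m / u (2 * k + 2 * m + T)"
    using L_G_comm[of m k] h_formula[of k m] by (simp add: algebra_simps)
  also have "\<dots> * u (2 * k + 2 * m + T) = - (of_int m / 2 + \<rho> k) * u (2 * k + T)"
    using u0[of "2 * k + 2 * m + T"] by (simp add: left_diff_distrib) (simp add: u_def \<rho>_def field_simps)
  finally show ?thesis using u0[of "2 * k + 2 * m + T"] by (simp add: nonzero_eq_divide_eq)
qed

text \<open>
  The central terms of the odd products follow from those of the even ones because \<open>G\<^sub>k\<close> is a square
  root of \<open>L\<^bsub>2k+T\<^esub>\<close>. Only \<open>G\<^sub>k \<cdot> G\<^sub>k\<close> escapes this, and it is half of a super-bracket.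
\<close>

lemma v_formula:
  "v k l = (if k + l + T = 0
      then (4 * \<rho> k ^ 2 - 1 + 2 * (\<epsilon> - inverse \<epsilon>) * \<rho> k) / 24 else 0)"
proof -
  have key: "w (2 * k + T) n = h k n * v k (k + n)" for n
    using v_G_G_L[of k k n] by simp
  show ?thesis
  proof (cases "k = l")
    case True
    have val: "v k k = (if k + k + T = 0 then (4 * \<rho> k ^ 2 - 1) / 12 else 0) / 2"
      unfolding v_comm[symmetric] by simp
    show ?thesis unfolding True[symmetric] val by (auto simp: \<rho>_def)
  next
    case False
    then have "h k (l - k) \<noteq> 0" using u0 by (simp add: h_formula)
    show ?thesis
    proof (cases "k + l + T = 0")
      case True
      then have l: "l - k = - (2 * k + T)" by simp
      have "h k (l - k) = 2 * \<rho> k"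
      proof -
        have "2 * k + 2 * (l - k) + T = l - k" using l by simp
        then have "h k (l - k) = - of_int (l - k) * u (l - k) / u (l - k)"
          using h_formula[of k "l - k"] by (simp only:)
        also have "\<dots> = - of_int (l - k)" using u0[of "l - k"] by (simp del: of_int_diff)
        finally show ?thesis unfolding l by (simp add: \<rho>_def)
      qed
      moreover have "w (2 * k + T) (l - k)
          = ((2 * \<rho> k) ^ 3 - 2 * \<rho> k + (\<epsilon> - inverse \<epsilon>) * (2 * \<rho> k) ^ 2) / 24"
      proof -
        have "2 * \<rho> k = of_int (2 * k + T)" by (simp add: \<rho>_def)
        then show ?thesis
          using w_formula[OF \<epsilon>0 u_nonzero f_eq, of "2 * k + T"] by (simp only: l)
      qed
      ultimately have "(2 * \<rho> k) * v k l = ((2 * \<rho> k) ^ 3 - 2 * \<rho> k + (\<epsilon> - inverse \<epsilon>) * (2 * \<rho> k) ^ 2) / 24"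
        using key[of "l - k"] by simp
      also have "\<dots> = (2 * \<rho> k) * ((4 * \<rho> k ^ 2 - 1 + 2 * (\<epsilon> - inverse \<epsilon>) * \<rho> k) / 24)"
        by (simp add: field_simps power3_eq_cube power2_eq_square)
      finally have "(2 * \<rho> k) * v k l = (2 * \<rho> k) * ((4 * \<rho> k ^ 2 - 1 + 2 * (\<epsilon> - inverse \<epsilon>) * \<rho> k) / 24)" .
      moreover have "2 * \<rho> k \<noteq> 0"
        using \<open>h k (l - k) \<noteq> 0\<close> \<open>h k (l - k) = 2 * \<rho> k\<close> by simp
      ultimately have "v k l = (4 * \<rho> k ^ 2 - 1 + 2 * (\<epsilon> - inverse \<epsilon>) * \<rho> k) / 24"
        using mult_left_cancel by blast
      then show ?thesis using True by simp
    next
      case F: False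
      then have "w (2 * k + T) (l - k) = 0" by (intro w_off_diagonal) simp
      then show ?thesis using key[of "l - k"] \<open>h k (l - k) \<noteq> 0\<close> F by simp
    qed
  qed
qed

end
end

section \<open>Bilinear maps on the space with basis \<open>L\<^sub>m, G\<^sub>r, c\<close>\<close>

interpretation sv: vector_space sv_scale by (rule vector_space_sv)

interpretation sv_pair: vector_space_pair sv_scale sv_scale by unfold_locales

abbreviation sv_e :: "sv_index \<Rightarrow> sv" where "sv_e i \<equiv> Poly_Mapping.single i 1"

abbreviation sv_linear :: "(sv \<Rightarrow> sv) \<Rightarrow> bool" where
  "sv_linear \<equiv> Vector_Spaces.linear sv_scale sv_scale"

definition sv_bilinear :: "(sv \<Rightarrow> sv \<Rightarrow> sv) \<Rightarrow> bool" where
  "sv_bilinear F \<longleftrightarrow> (\<forall>y. sv_linear (\<lambda>x. F x y)) \<and> (\<forall>x. sv_linear (F x))"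

fun sv_parity :: "sv_index \<Rightarrow> bit" where
  "sv_parity (IL m) = 0" | "sv_parity (IG k) = 1" | "sv_parity IC = 0"

lemma sv_linear_iff: "sv_linear f \<longleftrightarrow> (\<forall>x y. f (x + y) = f x + f y) \<and> (\<forall>c x. f (sv_scale c x) = sv_scale c (f x))"
  by (simp add: Vector_Spaces.linear_iff vector_space_sv)

lemma lookup_sv_e: "Poly_Mapping.lookup (sv_e i) j = (if i = j then 1 else 0)"
  by (simp add: lookup_single when_def)

lemma sv_e_nonzero: "sv_e i \<noteq> 0"
  by (metis lookup_single_eq lookup_zero zero_neq_one)

lemma span_sv_e: "sv.span (sv_e ` S) = {v. Poly_Mapping.keys v \<subseteq> S}"
proof
  have "sv.subspace {v. Poly_Mapping.keys v \<subseteq> S}"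
  proof (rule sv.subspaceI)
    show "x + y \<in> {v. Poly_Mapping.keys v \<subseteq> S}"
      if "x \<in> {v. Poly_Mapping.keys v \<subseteq> S}" "y \<in> {v. Poly_Mapping.keys v \<subseteq> S}" for x y
      using that Poly_Mapping.keys_add[of x y] by auto
  qed (auto simp: in_keys_iff lookup_sv_scale)
  then show "sv.span (sv_e ` S) \<subseteq> {v. Poly_Mapping.keys v \<subseteq> S}"
    by (intro sv.span_minimal) auto
  show "{v. Poly_Mapping.keys v \<subseteq> S} \<subseteq> sv.span (sv_e ` S)"
  proof clarify
    fix v :: sv
    assume v: "Poly_Mapping.keys v \<subseteq> S"
    have "v = (\<Sum>i\<in>Poly_Mapping.keys v. sv_scale (Poly_Mapping.lookup v i) (sv_e i))"
      by (rule poly_mapping_eqI)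
        (simp add: lookup_sum lookup_sv_scale lookup_sv_e if_distrib sum.delta in_keys_iff cong: if_cong)
    also have "\<dots> \<in> sv.span (sv_e ` S)"
      using v by (intro sv.span_sum sv.span_scale sv.span_base) auto
    finally show "v \<in> sv.span (sv_e ` S)" .
  qed
qed

lemma image_sv_G: "sv_G \<theta> ` shifted_ints \<theta> = sv_e ` range IG"
  by (auto simp: shifted_ints_def sv_G_shift image_iff)

lemma sv_grade_eq_span: "sv_grade \<theta> \<alpha> = sv.span (sv_e ` {i. sv_parity i = \<alpha>})"
proof -
  have "sv_parity i = 0 \<longleftrightarrow> i \<in> range IL \<union> {IC}" and "sv_parity i = 1 \<longleftrightarrow> i \<in> range IG" for i
    by (cases i; auto)+
  then have "{i. sv_parity i = 0} = range IL \<union> {IC}" and "{i. sv_parity i = 1} = range IG"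
    by blast+
  moreover have "sv_e ` (range IL \<union> {IC}) = range sv_L \<union> {sv_c}"
    by (auto simp: sv_L_def sv_c_def)
  ultimately show ?thesis
    by (cases \<alpha>) (simp_all only: sv_grade_def image_sv_G if_True if_False one_neq_zero simp_thms)
qed

lemma sv_grade_iff: "v \<in> sv_grade \<theta> \<alpha> \<longleftrightarrow> (\<forall>i. Poly_Mapping.lookup v i \<noteq> 0 \<longrightarrow> sv_parity i = \<alpha>)"
  by (auto simp: sv_grade_eq_span span_sv_e in_keys_iff subset_iff)

lemma sv_e_in_grade: "sv_e i \<in> sv_grade \<theta> (sv_parity i)"
  by (auto simp: sv_grade_iff lookup_sv_e)

lemma sv_bilinear_add_left: "sv_bilinear F \<Longrightarrow> F (x + y) z = F x z + F y z"
  and sv_bilinear_add_right: "sv_bilinear F \<Longrightarrow> F z (x + y) = F z x + F z y"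
  and sv_bilinear_scale_left: "sv_bilinear F \<Longrightarrow> F (sv_scale c x) y = sv_scale c (F x y)"
  and sv_bilinear_scale_right: "sv_bilinear F \<Longrightarrow> F x (sv_scale c y) = sv_scale c (F x y)"
  by (simp_all add: sv_bilinear_def sv_linear_iff)

lemma sv_bilinear_zero_left: "sv_bilinear F \<Longrightarrow> F 0 y = 0"
  and sv_bilinear_zero_right: "sv_bilinear F \<Longrightarrow> F y 0 = 0"
  using sv_bilinear_scale_left[of F 0 0 y] sv_bilinear_scale_right[of F y 0 0] by simp_all

lemmas sv_bilinear_simps = sv_bilinear_add_left sv_bilinear_add_right sv_bilinear_scale_left
  sv_bilinear_scale_right sv_bilinear_zero_left sv_bilinear_zero_right

lemma sv_bilinear_diff_left: "sv_bilinear F \<Longrightarrow> F (x - y) z = F x z - F y z"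
  using sv_bilinear_add_left[of F "x - y" y z] by simp

lemma sv_linear_eqI:
  assumes "sv_linear f" "sv_linear g" "\<And>i. f (sv_e i) = g (sv_e i)"
  shows "f x = g x"
  by (rule sv_pair.linear_eq_on_span[OF assms(1,2), of "range sv_e"])
    (use assms(3) in \<open>auto simp: span_sv_e\<close>)

lemma sv_linear_eq_on_grade:
  assumes "sv_linear f" "sv_linear g" "\<And>i. sv_parity i = \<alpha> \<Longrightarrow> f (sv_e i) = g (sv_e i)"
    and "x \<in> sv_grade \<theta> \<alpha>"
  shows "f x = g x"
  by (rule sv_pair.linear_eq_on_span[OF assms(1,2), of "sv_e ` {i. sv_parity i = \<alpha>}"])
    (use assms(3,4) in \<open>auto simp: sv_grade_eq_span\<close>)

lemma sv_bilinear_eq_on_grades: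
  assumes F: "sv_bilinear F" and G: "sv_bilinear G"
    and eq: "\<And>i j. sv_parity i = \<alpha> \<Longrightarrow> sv_parity j = \<beta> \<Longrightarrow> F (sv_e i) (sv_e j) = G (sv_e i) (sv_e j)"
    and x: "x \<in> sv_grade \<theta> \<alpha>" and y: "y \<in> sv_grade \<theta> \<beta>"
  shows "F x y = G x y"
proof (rule sv_linear_eq_on_grade[of "\<lambda>x. F x y" "\<lambda>x. G x y", OF _ _ _ x])
  show "sv_linear (\<lambda>x. F x y)" "sv_linear (\<lambda>x. G x y)"
    using F G by (simp_all add: sv_bilinear_def)
  show "F (sv_e i) y = G (sv_e i) y" if "sv_parity i = \<alpha>" for i
    by (rule sv_linear_eq_on_grade[of "F (sv_e i)" "G (sv_e i)", OF _ _ _ y])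
      (use that F G eq in \<open>simp_all add: sv_bilinear_def\<close>)
qed

lemma sv_bilinear_eqI:
  assumes F: "sv_bilinear F" and G: "sv_bilinear G"
    and eq: "\<And>i j. F (sv_e i) (sv_e j) = G (sv_e i) (sv_e j)"
  shows "F = G"
proof (intro ext)
  fix x y
  have "F (sv_e i) y = G (sv_e i) y" for i
    by (rule sv_linear_eqI[of "F (sv_e i)" "G (sv_e i)"])
      (use F G eq in \<open>simp_all add: sv_bilinear_def\<close>)
  then show "F x y = G x y"
    using F G by - (rule sv_linear_eqI[of "\<lambda>x. F x y" "\<lambda>x. G x y"], simp_all add: sv_bilinear_def)
qed

lemma bilinear_extension_eq_sum:
  assumes "finite I" "Poly_Mapping.keys x \<subseteq> I" "finite J" "Poly_Mapping.keys y \<subseteq> J"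
  shows "bilinear_extension t x y = (\<Sum>i\<in>I. \<Sum>j\<in>J.
    sv_scale (Poly_Mapping.lookup x i * Poly_Mapping.lookup y j) (t i j))"
proof -
  have "(\<Sum>j\<in>Poly_Mapping.keys y. sv_scale (Poly_Mapping.lookup x i * Poly_Mapping.lookup y j) (t i j))
      = (\<Sum>j\<in>J. sv_scale (Poly_Mapping.lookup x i * Poly_Mapping.lookup y j) (t i j))" for i
    using assms(3,4) by (intro sum.mono_neutral_left) (auto simp: in_keys_iff)
  then show ?thesis
    unfolding bilinear_extension_def using assms(1,2)
    by (simp, intro sum.mono_neutral_left) (auto simp: in_keys_iff)
qed

lemma bilinear_extension_bilinear: "sv_bilinear (bilinear_extension t)"
proof -
  let ?k = "Poly_Mapping.keys :: sv \<Rightarrow> _"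
  have add_left: "bilinear_extension t (x + x') y = bilinear_extension t x y + bilinear_extension t x' y"
    for x x' y
  proof -
    let ?I = "?k x \<union> ?k x'"
    have "?k (x + x') \<subseteq> ?I" by (rule Poly_Mapping.keys_add)
    then show ?thesis
      by (simp add: bilinear_extension_eq_sum[of ?I _ "?k y"] lookup_add distrib_right
          sv.scale_left_distrib sum.distrib)
  qed
  have add_right: "bilinear_extension t y (x + x') = bilinear_extension t y x + bilinear_extension t y x'"
    for x x' y
  proof -
    let ?I = "?k x \<union> ?k x'"
    have "?k (x + x') \<subseteq> ?I" by (rule Poly_Mapping.keys_add)
    then show ?thesis
      by (simp add: bilinear_extension_eq_sum[of "?k y" _ ?I] lookup_add distrib_left
          sv.scale_left_distrib sum.distrib)
  qed
  have keys_scale: "?k (sv_scale c x) \<subseteq> ?k x" for c x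
    by (auto simp: in_keys_iff lookup_sv_scale)
  have scale_left: "bilinear_extension t (sv_scale c x) y = sv_scale c (bilinear_extension t x y)" for c x y
    using keys_scale[of c x]
    by (simp add: bilinear_extension_eq_sum[of "?k x" _ "?k y"] lookup_sv_scale sv.scale_sum_right mult.assoc)
  have scale_right: "bilinear_extension t x (sv_scale c y) = sv_scale c (bilinear_extension t x y)" for c x y
    using keys_scale[of c y]
    by (simp add: bilinear_extension_eq_sum[of "?k x" _ "?k y"] lookup_sv_scale sv.scale_sum_right mult.left_commute)
  show ?thesis
    by (simp add: sv_bilinear_def sv_linear_iff add_left add_right scale_left scale_right)
qed

lemma superalgebra_bilinear:
  assumes "superalgebra sv_scale A F"
  shows "sv_bilinear F"
proof -
  interpret superalgebra sv_scale A F by fact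
  show ?thesis using linear_mul_left linear_mul_right by (simp add: sv_bilinear_def)
qed

lemma sv_superalgebraI:
  assumes F: "sv_bilinear F" and hom: "\<And>i j. F (sv_e i) (sv_e j) \<in> sv_grade \<theta> (sv_parity i + sv_parity j)"
  shows "superalgebra sv_scale (sv_grade \<theta>) F"
proof (rule superalgebra.intro[OF vector_space_sv superalgebra_axioms.intro])
  show "sv.subspace (sv_grade \<theta> \<alpha>)" for \<alpha>
    by (simp add: sv_grade_eq_span)
  have "x = 0" if "x \<in> sv_grade \<theta> 0" "x \<in> sv_grade \<theta> 1" for x
  proof (rule poly_mapping_eqI)
    fix i
    show "Poly_Mapping.lookup x i = Poly_Mapping.lookup 0 i"
      using that unfolding sv_grade_iff by (metis lookup_zero zero_neq_one)
  qed
  moreover have "0 \<in> sv_grade \<theta> \<alpha>" for \<alpha>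
    by (simp add: sv_grade_iff)
  ultimately show "sv_grade \<theta> 0 \<inter> sv_grade \<theta> 1 = {0}"
    by blast
  show "\<exists>a\<in>sv_grade \<theta> 0. \<exists>b\<in>sv_grade \<theta> 1. x = a + b" for x
  proof -
    have "x \<in> sv.span (sv_e ` {i. sv_parity i = 0} \<union> sv_e ` {i. sv_parity i = 1})"
    proof -
      have "{i. sv_parity i = 0} \<union> {i. sv_parity i = 1} = UNIV"
        by (metis (mono_tags, lifting) UNIV_eq_I Un_iff bit_not_one_iff mem_Collect_eq)
      then show ?thesis by (simp add: span_sv_e flip: image_Un)
    qed
    then show ?thesis
      by (auto simp: sv.span_Un sv_grade_eq_span)
  qed
  show "sv_linear (\<lambda>y. F x y)" for x
    using F by (simp add: sv_bilinear_def)
  show "sv_linear (\<lambda>x. F x y)" for y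
    using F by (simp add: sv_bilinear_def)
  show "F x y \<in> sv_grade \<theta> (\<alpha> + \<beta>)" if x: "x \<in> sv_grade \<theta> \<alpha>" and y: "y \<in> sv_grade \<theta> \<beta>" for x y \<alpha> \<beta>
  proof -
    have sub: "sv.subspace (sv_grade \<theta> \<gamma>)" for \<gamma> by (simp add: sv_grade_eq_span)
    have e: "F (sv_e i) y \<in> sv_grade \<theta> (sv_parity i + \<beta>)" for i
    proof -
      have "sv.subspace {y. F (sv_e i) y \<in> sv_grade \<theta> (sv_parity i + \<beta>)}"
        using sub[of "sv_parity i + \<beta>"] F unfolding sv.subspace_def
        by (auto simp: sv_bilinear_simps simp del: add_bit_eq_xor)
      then have "sv_grade \<theta> \<beta> \<subseteq> {y. F (sv_e i) y \<in> sv_grade \<theta> (sv_parity i + \<beta>)}"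
        unfolding sv_grade_eq_span[of \<theta> \<beta>] using hom[of i]
        by (intro sv.span_minimal image_subsetI) (auto simp del: add_bit_eq_xor)
      then show ?thesis using y by auto
    qed
    have "sv.subspace {x. F x y \<in> sv_grade \<theta> (\<alpha> + \<beta>)}"
      using sub[of "\<alpha> + \<beta>"] F unfolding sv.subspace_def
      by (auto simp: sv_bilinear_simps simp del: add_bit_eq_xor)
    then have "sv_grade \<theta> \<alpha> \<subseteq> {x. F x y \<in> sv_grade \<theta> (\<alpha> + \<beta>)}"
      unfolding sv_grade_eq_span[of \<theta> \<alpha>] using e
      by (intro sv.span_minimal image_subsetI) (auto simp del: add_bit_eq_xor)
    then show ?thesis using x by auto
  qed
qed

text \<open>
  For a product whose super-commutator is the bracket \<open>B\<close>, left-symmetry is the statement that left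
  multiplications represent \<open>B\<close>.
\<close>

lemma left_multiplication_bracket:
  assumes "compatible_lss sv_scale (sv_grade \<theta>) B F" and "x \<in> sv_grade \<theta> \<alpha>" "y \<in> sv_grade \<theta> \<beta>"
  shows "F (B x y) z = F x (F y z) - sv_scale (super_sign \<alpha> \<beta>) (F y (F x z))"
proof -
  interpret left_symmetric_superalgebra sv_scale "sv_grade \<theta>" F
    using assms(1) by (simp add: compatible_lss_def)
  have F: "sv_bilinear F" by (rule superalgebra_bilinear) unfold_locales
  have "B x y = F x y - sv_scale (super_sign \<alpha> \<beta>) (F y x)"
    using assms by (simp add: compatible_lss_def)
  then have "F (B x y) z = F (F x y) z - sv_scale (super_sign \<alpha> \<beta>) (F (F y x) z)"
    by (simp add: sv_bilinear_diff_left[OF F] sv_bilinear_scale_left[OF F])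
  also have "\<dots> = F x (F y z) - sv_scale (super_sign \<alpha> \<beta>) (F y (F x z))"
    using left_symmetric[OF assms(2,3), of z]
    by (simp add: associator_def sv.scale_right_diff_distrib algebra_simps)
  finally show ?thesis .
qed

text \<open>
  The converse, with all conditions tested on basis vectors only.
\<close>

lemma compatible_lssI:
  assumes F: "sv_bilinear F" and B: "sv_bilinear B"
    and hom: "\<And>i j. F (sv_e i) (sv_e j) \<in> sv_grade \<theta> (sv_parity i + sv_parity j)"
    and bracket: "\<And>i j. F (sv_e i) (sv_e j) - sv_scale (super_sign (sv_parity i) (sv_parity j)) (F (sv_e j) (sv_e i))
       = B (sv_e i) (sv_e j)"
    and module: "\<And>i j k. F (B (sv_e i) (sv_e j)) (sv_e k) = F (sv_e i) (F (sv_e j) (sv_e k))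
       - sv_scale (super_sign (sv_parity i) (sv_parity j)) (F (sv_e j) (F (sv_e i) (sv_e k)))"
  shows "compatible_lss sv_scale (sv_grade \<theta>) B F"
proof -
  have bil: "sv_bilinear (\<lambda>x y. F x y - sv_scale s (F y x))"
    "sv_bilinear (\<lambda>x y. F (B x y) z)"
    "sv_bilinear (\<lambda>x y. F x (F y z) - sv_scale s (F y (F x z)))" for s z
    using F B by (simp_all add: sv_bilinear_def sv_linear_iff
        sv.scale_right_distrib sv.scale_right_diff_distrib mult.commute)
  have super: "superalgebra sv_scale (sv_grade \<theta>) F"
    by (rule sv_superalgebraI[OF F hom])
  have comm: "F x y - sv_scale (super_sign \<alpha> \<beta>) (F y x) = B x y"
    if "x \<in> sv_grade \<theta> \<alpha>" "y \<in> sv_grade \<theta> \<beta>" for x y \<alpha> \<beta>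
    by (rule sv_bilinear_eq_on_grades[OF bil(1) B _ that]) (use bracket in auto)
  have law: "F (B x y) z = F x (F y z) - sv_scale (super_sign \<alpha> \<beta>) (F y (F x z))"
    if "x \<in> sv_grade \<theta> \<alpha>" "y \<in> sv_grade \<theta> \<beta>" for x y z \<alpha> \<beta>
  proof (rule sv_bilinear_eq_on_grades[OF bil(2) bil(3) _ that])
    fix i j
    assume "sv_parity i = \<alpha>" "sv_parity j = \<beta>"
    then show "F (B (sv_e i) (sv_e j)) z = F (sv_e i) (F (sv_e j) z)
        - sv_scale (super_sign \<alpha> \<beta>) (F (sv_e j) (F (sv_e i) z))"
      using module[of i j] F
      by - (rule sv_linear_eqI[of "F (B (sv_e i) (sv_e j))"
            "\<lambda>z. F (sv_e i) (F (sv_e j) z) - sv_scale (super_sign \<alpha> \<beta>) (F (sv_e j) (F (sv_e i) z))"],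
        auto simp: sv_linear_iff sv_bilinear_simps
          sv.scale_right_distrib sv.scale_right_diff_distrib mult.commute)
  qed
  have "left_symmetric_superalgebra sv_scale (sv_grade \<theta>) F"
  proof (rule left_symmetric_superalgebra.intro[OF super left_symmetric_superalgebra_axioms.intro])
    fix x y z \<alpha> \<beta>
    assume x: "x \<in> sv_grade \<theta> \<alpha>" and y: "y \<in> sv_grade \<theta> \<beta>"
    have "F (F x y) z - sv_scale (super_sign \<alpha> \<beta>) (F (F y x) z)
        = F x (F y z) - sv_scale (super_sign \<alpha> \<beta>) (F y (F x z))"
      using law[OF x y, of z] unfolding comm[OF x y, symmetric]
      by (simp add: sv_bilinear_scale_left[OF F] sv_bilinear_diff_left[OF F])
    then show "associator F x y z = sv_scale (super_sign \<alpha> \<beta>) (associator F y x z)"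
      by (simp add: associator_def sv.scale_right_diff_distrib algebra_simps)
  qed
  then show ?thesis using comm by (simp add: compatible_lss_def)
qed

section \<open>Products given by structure constants\<close>

text \<open>
  All products considered below, including the super-bracket itself, have this shape. Products of even
  with odd vectors are odd, so they involve no \<open>c\<close>.
\<close>

fun graded_table ::
  "int \<Rightarrow> (int \<Rightarrow> int \<Rightarrow> complex) \<Rightarrow> (int \<Rightarrow> int \<Rightarrow> complex) \<Rightarrow> (int \<Rightarrow> int \<Rightarrow> complex) \<Rightarrow> (int \<Rightarrow> int \<Rightarrow> complex)
    \<Rightarrow> (int \<Rightarrow> int \<Rightarrow> complex) \<Rightarrow> (int \<Rightarrow> int \<Rightarrow> complex) \<Rightarrow> sv_index \<Rightarrow> sv_index \<Rightarrow> sv" where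
  "graded_table T f w g h d v (IL m) (IL n)
     = sv_scale (f m n) (sv_e (IL (m + n))) + sv_scale (w m n) (sv_e IC)"
| "graded_table T f w g h d v (IL m) (IG k) = sv_scale (g m k) (sv_e (IG (k + m)))"
| "graded_table T f w g h d v (IG k) (IL m) = sv_scale (h k m) (sv_e (IG (k + m)))"
| "graded_table T f w g h d v (IG k) (IG l)
     = sv_scale (d k l) (sv_e (IL (k + l + T))) + sv_scale (v k l) (sv_e IC)"
| "graded_table T f w g h d v IC j = 0"
| "graded_table T f w g h d v (IL m) IC = 0"
| "graded_table T f w g h d v (IG k) IC = 0"

definition graded_product where
  "graded_product T f w g h d v = bilinear_extension (graded_table T f w g h d v)"

lemma graded_product_bilinear: "sv_bilinear (graded_product T f w g h d v)"
  unfolding graded_product_def by (rule bilinear_extension_bilinear)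

lemma graded_product_e:
  "graded_product T f w g h d v (sv_e i) (sv_e j) = graded_table T f w g h d v i j"
  by (simp add: graded_product_def bilinear_extension_single)

lemma graded_product_c_left: "graded_product T f w g h d v (sv_e IC) x = 0"
  by (rule sv_linear_eqI[of "graded_product T f w g h d v (sv_e IC)" "\<lambda>_. 0"])
    (use graded_product_bilinear in \<open>auto simp: sv_bilinear_def sv_linear_iff[of "\<lambda>_. 0"] graded_product_e\<close>)

text \<open>
  With the integer \<open>T = 2 \<theta>\<close> the sum of two odd weights \<open>k + \<theta>\<close> and \<open>l + \<theta>\<close> is visibly the integer \<open>k + l + T\<close>,
  for both values of \<open>\<theta>\<close> at once.
\<close>

locale half_integer =
  fixes \<theta> :: real and T :: int
  assumes two_theta: "2 * \<theta> = of_int T"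
begin

definition wt :: "int \<Rightarrow> complex" where "wt k = of_int (2 * k + T) / 2"

lemma of_real_index: "complex_of_real (of_int k + \<theta>) = wt k"
proof -
  have "of_int k + \<theta> = of_int (2 * k + T) / 2" using two_theta by simp
  then have "complex_of_real (of_int k + \<theta>) = of_real (of_int (2 * k + T) / 2)" by (simp only:)
  then show ?thesis by (simp add: wt_def)
qed

lemma index_sum: "(of_int k + \<theta>) + (of_int l + \<theta>) = of_int (k + l + T)"
  using two_theta by simp

lemma index_sum_zero_iff: "(of_int k + \<theta>) + (of_int l + \<theta>) = 0 \<longleftrightarrow> k + l + T = 0"
  unfolding index_sum by (rule of_int_eq_0_iff)

lemma sv_G_index: "sv_G \<theta> (of_int m + (of_int k + \<theta>)) = sv_e (IG (k + m))"
  using sv_G_shift[of \<theta> "k + m"] by (simp add: add.assoc add.left_commute)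

lemma sv_bracket_eq_graded:
  "sv_bracket \<theta> = graded_product T
     (\<lambda>m n. of_int (m - n)) (\<lambda>m n. if m + n = 0 then (of_int m ^ 3 - of_int m) / 12 else 0)
     (\<lambda>m k. of_int m / 2 - wt k) (\<lambda>k m. - (of_int m / 2 - wt k))
     (\<lambda>k l. 2) (\<lambda>k l. if k + l + T = 0 then (4 * wt k ^ 2 - 1) / 12 else 0)"
  (is "_ = graded_product T ?f ?w ?g ?h ?d ?v")
proof -
  have "sv_bracket_basis \<theta> i j = graded_table T ?f ?w ?g ?h ?d ?v i j" for i j
    by (cases i; cases j)
      (simp_all add: Let_def of_real_index index_sum index_sum_zero_iff sv_G_index sv_L_def sv_c_def
        sv_scale_single single_uminus[symmetric] del: of_real_add)
  then have "sv_bracket_basis \<theta> = graded_table T ?f ?w ?g ?h ?d ?v" by (intro ext)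
  then show ?thesis by (simp only: sv_bracket_def graded_product_def)
qed

end
lemma sv_poly_eqI:
  assumes "\<And>p. Poly_Mapping.lookup x (IL p) = Poly_Mapping.lookup y (IL p)"
    "\<And>p. Poly_Mapping.lookup x (IG p) = Poly_Mapping.lookup y (IG p)"
    "Poly_Mapping.lookup x IC = Poly_Mapping.lookup y IC"
  shows "x = (y :: sv)"
proof (rule poly_mapping_eqI)
  show "Poly_Mapping.lookup x i = Poly_Mapping.lookup y i" for i
    using assms by (cases i) auto
qed

lemmas sv_lookup_simps = lookup_add lookup_minus lookup_sv_scale lookup_sv_e

context half_integer
begin

lemmas graded_simps = graded_product_e sv_bilinear_simps[OF graded_product_bilinear]
  sv.scale_right_distrib

text \<open>
  Left-symmetry and compatibility, spelled out for structure constants. The mixed laws for \<open>G, L\<close> are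
  those for \<open>L, G\<close> with the opposite sign.
\<close>

lemma compatible_graded_product_iff:
  "sv_compatible \<theta> (graded_product T f w g h d v) \<longleftrightarrow> super_structure_constants T f w g h d v"
proof
  let ?P = "graded_product T f w g h d v" and ?B = "sv_bracket \<theta>"
  let ?s = "\<lambda>i j. super_sign (sv_parity i) (sv_parity j)"
  assume P: "sv_compatible \<theta> ?P"
  have comm: "?P (sv_e i) (sv_e j) - sv_scale (?s i j) (?P (sv_e j) (sv_e i)) = ?B (sv_e i) (sv_e j)" for i j
    using P sv_e_in_grade by (simp add: compatible_lss_def)
  have law: "?P (?B (sv_e i) (sv_e j)) (sv_e k) = ?P (sv_e i) (?P (sv_e j) (sv_e k))
       - sv_scale (?s i j) (?P (sv_e j) (?P (sv_e i) (sv_e k)))" for i j k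
    using left_multiplication_bracket[OF P sv_e_in_grade sv_e_in_grade] .
  note coeff = arg_cong[where f = "\<lambda>x. Poly_Mapping.lookup x _"]
  note simps = sv_bracket_eq_graded graded_simps sv_lookup_simps super_sign_def
  show "super_structure_constants T f w g h d v"
  proof (standard, unfold wt_def[symmetric])
    fix m n p k l j :: int
    show "f m n - f n m = of_int (m - n)"
      using coeff[OF comm[of "IL m" "IL n"], of "IL (m + n)"] by (simp add: simps add.commute)
    show "w m n - w n m = (if m + n = 0 then (of_int m ^ 3 - of_int m) / 12 else 0)"
      using coeff[OF comm[of "IL m" "IL n"], of IC] by (simp add: simps)
    show "g m k - h k m = of_int m / 2 - wt k"
      using coeff[OF comm[of "IL m" "IG k"], of "IG (k + m)"] by (simp add: simps)
    show "d k l + d l k = 2"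
      using coeff[OF comm[of "IG k" "IG l"], of "IL (k + l + T)"] by (simp add: simps add.commute)
    show "v k l + v l k = (if k + l + T = 0 then (4 * wt k ^ 2 - 1) / 12 else 0)"
      using coeff[OF comm[of "IG k" "IG l"], of IC] by (simp add: simps)
    show "of_int (m - n) * f (m + n) p = f n p * f m (n + p) - f m p * f n (m + p)"
      using coeff[OF law[of "IL m" "IL n" "IL p"], of "IL (m + n + p)"] by (simp add: simps add_ac)
    show "of_int (m - n) * w (m + n) p = f n p * w m (n + p) - f m p * w n (m + p)"
      using coeff[OF law[of "IL m" "IL n" "IL p"], of IC] by (simp add: simps)
    show "of_int (m - n) * g (m + n) k = g n k * g m (k + n) - g m k * g n (k + m)"
      using coeff[OF law[of "IL m" "IL n" "IG k"], of "IG (k + (m + n))"] by (simp add: simps add_ac)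
    show "(of_int m / 2 - wt k) * h (k + m) n = h k n * g m (k + n) - f m n * h k (m + n)"
      using coeff[OF law[of "IL m" "IG k" "IL n"], of "IG (k + m + n)"] by (simp add: simps add_ac)
    show "(of_int m / 2 - wt k) * d (k + m) l = d k l * f m (k + l + T) - g m l * d k (l + m)"
      using coeff[OF law[of "IL m" "IG k" "IG l"], of "IL (k + m + l + T)"] by (simp add: simps add_ac)
    show "(of_int m / 2 - wt k) * v (k + m) l = d k l * w m (k + l + T) - g m l * v k (l + m)"
      using coeff[OF law[of "IL m" "IG k" "IG l"], of IC] by (simp add: simps)
    show "2 * f (k + l + T) n = h l n * d k (l + n) + h k n * d l (k + n)"
      using coeff[OF law[of "IG k" "IG l" "IL n"], of "IL (k + l + T + n)"] by (simp add: simps add_ac)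
    show "2 * w (k + l + T) n = h l n * v k (l + n) + h k n * v l (k + n)"
      using coeff[OF law[of "IG k" "IG l" "IL n"], of IC] by (simp add: simps)
    show "2 * g (k + l + T) j = d l j * h k (l + j + T) + d k j * h l (k + j + T)"
      using coeff[OF law[of "IG k" "IG l" "IG j"], of "IG (j + (k + l + T))"] by (simp add: simps add_ac)
  qed
next
  let ?P = "graded_product T f w g h d v" and ?B = "sv_bracket \<theta>"
  let ?s = "\<lambda>i j. super_sign (sv_parity i) (sv_parity j)"
  assume "super_structure_constants T f w g h d v"
  then interpret c: super_structure_constants T f w g h d v "\<lambda>k. of_int (2 * k + T) / 2" .
  note eqs = c.comm c.w_comm c.L_G_comm c.G_G_comm c.v_comm c.module_law c.w_module c.L_L_G c.L_G_L
    c.L_G_G c.v_L_G_G c.G_G_L c.v_G_G_L c.G_G_G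
  note e = eqs[folded wt_def]
  note simps = sv_bracket_eq_graded graded_simps sv_lookup_simps super_sign_def
  show "sv_compatible \<theta> ?P"
  proof (rule compatible_lssI)
    show "sv_bilinear ?P" "sv_bilinear ?B"
      by (simp_all add: graded_product_bilinear sv_bracket_eq_graded)
    show "?P (sv_e i) (sv_e j) \<in> sv_grade \<theta> (sv_parity i + sv_parity j)" for i j
      by (cases i; cases j) (auto simp: sv_grade_iff graded_simps sv_lookup_simps split: if_splits)
    show "?P (sv_e i) (sv_e j) - sv_scale (?s i j) (?P (sv_e j) (sv_e i)) = ?B (sv_e i) (sv_e j)" for i j
    proof (cases i; cases j)
      fix k m assume "i = IG k" "j = IL m"
      then show ?thesis
        using arg_cong[OF e(3)[of m k], of uminus] by (intro sv_poly_eqI) (auto simp: simps)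
    qed (use e(1,2,3,4,5) in \<open>auto intro!: sv_poly_eqI simp: simps add_ac\<close>)
    have LG: "?P (?B (sv_e (IL m)) (sv_e (IG l))) (sv_e k) = ?P (sv_e (IL m)) (?P (sv_e (IG l)) (sv_e k))
       - ?P (sv_e (IG l)) (?P (sv_e (IL m)) (sv_e k))" for m l k
    proof (cases k)
      case (IL n)
      then show ?thesis
        using e(9)[of m l n] by (intro sv_poly_eqI) (auto simp: simps add_ac)
    next
      case (IG j)
      then show ?thesis
        using e(10,11)[of m l j] by (intro sv_poly_eqI) (auto simp: simps add_ac)
    qed (simp add: graded_simps sv_bracket_eq_graded)
    show "?P (?B (sv_e i) (sv_e j)) (sv_e k) = ?P (sv_e i) (?P (sv_e j) (sv_e k))
       - sv_scale (?s i j) (?P (sv_e j) (?P (sv_e i) (sv_e k)))" for i j k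
    proof (cases i)
      case i: (IL m)
      show ?thesis
      proof (cases j)
        case j: (IL n)
        show ?thesis
        proof (cases k)
          case (IL p)
          with i j show ?thesis
            using e(6,7)[of m n p] by (intro sv_poly_eqI) (auto simp: simps add_ac)
        next
          case (IG l)
          with i j show ?thesis
            using e(8)[of m n l] by (intro sv_poly_eqI) (auto simp: simps add_ac)
        qed (simp add: i j graded_simps sv_bracket_eq_graded)
      next
        case j: (IG l)
        show ?thesis using LG[of m l k] by (simp add: i j super_sign_def)
      qed (simp add: i graded_simps sv_bracket_eq_graded super_sign_def graded_product_c_left)
    next
      case i: (IG l)
      show ?thesis
      proof (cases j)
        case j: (IL m)
        have "?P (?B (sv_e i) (sv_e j)) (sv_e k) = - ?P (?B (sv_e j) (sv_e i)) (sv_e k)"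
          by (simp add: i j graded_simps sv_bracket_eq_graded sv.scale_minus_left[symmetric]
              del: sv.scale_minus_left)
        then show ?thesis
          using LG[of m l k] by (simp add: i j super_sign_def)
      next
        case j: (IG r)
        show ?thesis
        proof (cases k)
          case (IL p)
          with i j show ?thesis
            using e(12,13)[of l r p] by (intro sv_poly_eqI) (auto simp: simps add_ac)
        next
          case (IG q)
          with i j show ?thesis
            using e(14)[of l r q] by (intro sv_poly_eqI) (auto simp: simps add_ac)
        qed (simp add: i j graded_simps sv_bracket_eq_graded)
      qed (simp add: i graded_simps sv_bracket_eq_graded super_sign_def graded_product_c_left)
    qed (simp add: graded_simps sv_bracket_eq_graded graded_product_c_left)
  qed
qed

end

section \<open>The family of products\<close>

text \<open>
  The parameters for which no denominator in the formulas of the family vanishes, \<open>1/\<epsilon>\<close> included. Up to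
  sign they are the admissible ones.
\<close>

definition nondegenerate :: "complex \<Rightarrow> bool" where
  "nondegenerate \<epsilon> \<longleftrightarrow> \<epsilon> \<noteq> 0 \<and> (\<forall>n::int. 1 + \<epsilon> * of_int n \<noteq> 0)"

lemma nondegenerate_iff: "nondegenerate \<epsilon> \<longleftrightarrow> \<epsilon> \<noteq> 0 \<and> inverse \<epsilon> \<notin> \<int>"
proof -
  have "1 + \<epsilon> * of_int n = 0 \<longleftrightarrow> inverse \<epsilon> = of_int (- n)" if "\<epsilon> \<noteq> 0" for n
    using that by (auto simp: field_simps add_eq_0_iff2)
  moreover have "inverse \<epsilon> \<in> \<int> \<longleftrightarrow> (\<exists>n. inverse \<epsilon> = of_int (- n))"
    by (metis Ints_cases Ints_of_int minus_minus)
  ultimately show ?thesis by (auto simp: nondegenerate_def)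
qed

lemma admissible_nondegenerate: "admissible \<epsilon> \<Longrightarrow> nondegenerate \<epsilon>"
proof -
  assume *: "admissible \<epsilon>"
  have "inverse \<epsilon> \<notin> \<int>" if "Re \<epsilon> = 0" "Im \<epsilon> > 0"
  proof
    assume "inverse \<epsilon> \<in> \<int>"
    then obtain n where "inverse \<epsilon> = of_int n" by (auto elim: Ints_cases)
    then have "of_int n * \<epsilon> = 1" using that by (metis inverse_zero_imp_zero left_inverse less_irrefl zero_complex.sel(2))
    then have "Re (of_int n * \<epsilon>) = 1" by simp
    then show False using that by simp
  qed
  then show "nondegenerate \<epsilon>"
    using * by (auto simp: admissible_def nondegenerate_iff)
qed

lemma nondegenerate_cases:
  assumes "nondegenerate \<epsilon>"
  shows "admissible \<epsilon> \<or> admissible (- \<epsilon>)"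
proof -
  have "- inverse \<epsilon> \<notin> \<int>" using assms by (simp add: nondegenerate_iff)
  moreover have "Im \<epsilon> \<noteq> 0" if "Re \<epsilon> = 0"
    using assms that by (auto simp: nondegenerate_iff complex_eq_iff)
  ultimately show ?thesis
    using assms unfolding admissible_def nondegenerate_iff by (simp add: inverse_minus_eq) linarith
qed

context
  fixes \<epsilon> :: complex
begin

text \<open>
  The structure constants of the family as functions of complex weights, \<open>c..\<close> for the coefficients of
  \<open>L\<close> and \<open>G\<close>, \<open>z..\<close> for those of \<open>c\<close>. In each law the inner denominators cancel: with respect to
  the basis \<open>L\<^sub>n / den n\<close>, \<open>G\<^sub>r / den (2 r)\<close> of the space acted on, the left multiplications have polynomial
  coefficients.
\<close>

definition den where "den x = 1 + \<epsilon> * x"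

definition "cLL x y = - y * den y / den (x + y)"
definition "cLG x a = - (x / 2 + a) * den (2 * a) / den (2 * (a + x))"
definition "cGL a x = - x * den x / den (2 * (a + x))"
definition "cGG a b = den (2 * b) / den (a + b)"

text \<open>
  The central coefficients on the antidiagonals \<open>x + y = 0\<close> and \<open>a + b = 0\<close>. The polynomials in the
  definition of the family factor there: \<open>x\<^sup>3 - x + (\<epsilon> - 1/\<epsilon>) x\<^sup>2 = x (x + \<epsilon>) (x - 1/\<epsilon>)\<close>, and the last
  factor is a multiple of \<open>den (-x)\<close>.
\<close>

definition "zLL x y = - x * (x + \<epsilon>) * den y / (24 * \<epsilon>)"
definition "zGG a b = - (2 * a + \<epsilon>) * den (2 * b) / (24 * \<epsilon>)"

lemma cLL_comm: "den (x + y) \<noteq> 0 \<Longrightarrow> cLL x y - cLL y x = x - y"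
  by (simp add: cLL_def add.commute[of y] flip: diff_divide_distrib)
    (simp add: field_simps den_def)

lemma cLG_cGL_comm: "den (2 * (a + x)) \<noteq> 0 \<Longrightarrow> cLG x a - cGL a x = x / 2 - a"
proof -
  assume nz: "den (2 * (a + x)) \<noteq> 0"
  have "- (x / 2 + a) * den (2 * a) - - x * den x = (x / 2 - a) * den (2 * (a + x))"
    by (simp add: den_def field_simps)
  then have "cLG x a - cGL a x = (x / 2 - a) * den (2 * (a + x)) / den (2 * (a + x))"
    unfolding cLG_def cGL_def by (simp only: diff_divide_distrib[symmetric])
  then show ?thesis using nz by simp
qed

lemma cGG_comm: "den (a + b) \<noteq> 0 \<Longrightarrow> cGG a b + cGG b a = 2"
  by (simp add: cGG_def add.commute[of b] flip: add_divide_distrib) (simp add: field_simps den_def)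

lemma cLL_law:
  assumes "den (y + z) \<noteq> 0" "den (x + z) \<noteq> 0"
  shows "(x - y) * cLL (x + y) z = cLL y z * cLL x (y + z) - cLL x z * cLL y (x + z)"
proof -
  have "cLL y z * cLL x (y + z) - cLL x z * cLL y (x + z)
      = z * (y + z) * den z / den (x + y + z) - z * (x + z) * den z / den (x + y + z)"
    using assms by (simp add: cLL_def add_ac) (simp add: algebra_simps add_divide_distrib diff_divide_distrib)
  also have "\<dots> = (z * (y + z) - z * (x + z)) * den z / den (x + y + z)"
    by (simp only: left_diff_distrib diff_divide_distrib)
  also have "z * (y + z) - z * (x + z) = (x - y) * - z"
    by (simp add: algebra_simps)
  finally show ?thesis by (simp add: cLL_def)
qed

lemma cLG_law:
  assumes "den (2 * (a + x)) \<noteq> 0" "den (2 * (a + y)) \<noteq> 0"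
  shows "(x - y) * cLG (x + y) a = cLG y a * cLG x (a + y) - cLG x a * cLG y (a + x)"
proof -
  have "cLG y a * cLG x (a + y) - cLG x a * cLG y (a + x)
      = (y / 2 + a) * (x / 2 + (a + y)) * den (2 * a) / den (2 * (a + x + y))
        - (x / 2 + a) * (y / 2 + (a + x)) * den (2 * a) / den (2 * (a + x + y))"
    using assms by (simp add: cLG_def add_ac) (simp add: algebra_simps add_divide_distrib diff_divide_distrib)
  also have "\<dots> = ((y / 2 + a) * (x / 2 + (a + y)) - (x / 2 + a) * (y / 2 + (a + x)))
      * den (2 * a) / den (2 * (a + x + y))"
    by (simp add: left_diff_distrib diff_divide_distrib)
  also have "(y / 2 + a) * (x / 2 + (a + y)) - (x / 2 + a) * (y / 2 + (a + x))
      = (x - y) * - ((x + y) / 2 + a)"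
    by (simp add: field_simps)
  finally show ?thesis by (simp add: cLG_def add_ac)
qed

lemma cGL_law:
  assumes "den (2 * (a + y)) \<noteq> 0" "den (x + y) \<noteq> 0"
  shows "(x / 2 - a) * cGL (a + x) y = cGL a y * cLG x (a + y) - cLL x y * cGL a (x + y)"
proof -
  have "cGL a y * cLG x (a + y) - cLL x y * cGL a (x + y)
      = y * (x / 2 + (a + y)) * den y / den (2 * (a + x + y)) - y * (x + y) * den y / den (2 * (a + x + y))"
    using assms by (simp add: cLL_def cLG_def cGL_def add_ac) (simp add: algebra_simps add_divide_distrib diff_divide_distrib)
  also have "\<dots> = (y * (x / 2 + (a + y)) - y * (x + y)) * den y / den (2 * (a + x + y))"
    by (simp add: left_diff_distrib diff_divide_distrib)
  also have "y * (x / 2 + (a + y)) - y * (x + y) = (x / 2 - a) * - y"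
    by (simp add: field_simps)
  finally show ?thesis by (simp add: cGL_def add_ac)
qed

lemma cGG_law:
  assumes "den (a + b) \<noteq> 0" "den (2 * (b + x)) \<noteq> 0"
  shows "(x / 2 - a) * cGG (a + x) b = cGG a b * cLL x (a + b) - cLG x b * cGG a (b + x)"
proof -
  have "cGG a b * cLL x (a + b) - cLG x b * cGG a (b + x)
      = - (a + b) * den (2 * b) / den (a + x + b) - - (x / 2 + b) * den (2 * b) / den (a + x + b)"
    using assms by (simp add: cLL_def cLG_def cGG_def add_ac)
  also have "\<dots> = (- (a + b) - - (x / 2 + b)) * den (2 * b) / den (a + x + b)"
    by (simp only: left_diff_distrib diff_divide_distrib)
  also have "- (a + b) - - (x / 2 + b) = x / 2 - a"
    by simp
  finally show ?thesis by (simp add: cGG_def)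
qed

lemma cGL_cGG_law:
  assumes "den (2 * (a + y)) \<noteq> 0" "den (2 * (b + y)) \<noteq> 0"
  shows "2 * cLL (a + b) y = cGL b y * cGG a (b + y) + cGL a y * cGG b (a + y)"
  using assms by (simp add: cLL_def cGL_def cGG_def add_ac)

lemma cGG_cGL_law:
  assumes "den (b + c) \<noteq> 0" "den (a + c) \<noteq> 0"
  shows "2 * cLG (a + b) c = cGG b c * cGL a (b + c) + cGG a c * cGL b (a + c)"
proof -
  have "cGG b c * cGL a (b + c) + cGG a c * cGL b (a + c)
      = - (b + c) * den (2 * c) / den (2 * (a + b + c)) + - (a + c) * den (2 * c) / den (2 * (a + b + c))"
    using assms by (simp add: cGL_def cGG_def add_ac) (simp add: algebra_simps add_divide_distrib diff_divide_distrib)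
  also have "\<dots> = (- (b + c) + - (a + c)) * den (2 * c) / den (2 * (a + b + c))"
    by (simp only: distrib_right add_divide_distrib)
  also have "- (b + c) + - (a + c) = 2 * - ((a + b) / 2 + c)"
    by (simp add: field_simps)
  finally show ?thesis by (simp add: cLG_def add_ac)
qed

lemma zLL_law:
  assumes "x + y + z = 0" "den (y + z) \<noteq> 0" "den (x + z) \<noteq> 0"
  shows "(x - y) * zLL (x + y) z = cLL y z * zLL x (y + z) - cLL x z * zLL y (x + z)"
proof -
  have "cLL y z * zLL x (y + z) - cLL x z * zLL y (x + z)
      = z * (x * (x + \<epsilon>)) * den z / (24 * \<epsilon>) - z * (y * (y + \<epsilon>)) * den z / (24 * \<epsilon>)"
    using assms(2,3) by (simp add: cLL_def zLL_def) (simp add: algebra_simps add_divide_distrib diff_divide_distrib)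
  also have "\<dots> = (z * (x * (x + \<epsilon>)) - z * (y * (y + \<epsilon>))) * den z / (24 * \<epsilon>)"
    by (simp only: left_diff_distrib diff_divide_distrib)
  also have "z * (x * (x + \<epsilon>)) - z * (y * (y + \<epsilon>)) = (x - y) * (- (x + y) * (x + y + \<epsilon>))"
    using assms(1) by algebra
  finally show ?thesis by (simp add: zLL_def)
qed

lemma zGG_law:
  assumes "x + a + b = 0" "den (a + b) \<noteq> 0" "den (2 * (b + x)) \<noteq> 0"
  shows "(x / 2 - a) * zGG (a + x) b = cGG a b * zLL x (a + b) - cLG x b * zGG a (b + x)"
proof -
  have "cGG a b * zLL x (a + b) - cLG x b * zGG a (b + x)
      = - x * (x + \<epsilon>) * den (2 * b) / (24 * \<epsilon>) - (x / 2 + b) * (2 * a + \<epsilon>) * den (2 * b) / (24 * \<epsilon>)"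
    using assms(2,3) by (simp add: cGG_def cLG_def zLL_def zGG_def) (simp add: algebra_simps add_divide_distrib diff_divide_distrib)
  also have "\<dots> = (- x * (x + \<epsilon>) - (x / 2 + b) * (2 * a + \<epsilon>)) * den (2 * b) / (24 * \<epsilon>)"
    by (simp only: left_diff_distrib diff_divide_distrib)
  also have "- x * (x + \<epsilon>) - (x / 2 + b) * (2 * a + \<epsilon>) = (x / 2 - a) * - (2 * (a + x) + \<epsilon>)"
  proof -
    have b: "b = - (x + a)" using assms(1) by algebra
    show ?thesis unfolding b by (simp add: field_simps)
  qed
  finally show ?thesis by (simp add: zGG_def)
qed

lemma cGL_zGG_law:
  assumes "a + b + y = 0" "den (2 * (a + y)) \<noteq> 0" "den (2 * (b + y)) \<noteq> 0"
  shows "2 * zLL (a + b) y = cGL b y * zGG a (b + y) + cGL a y * zGG b (a + y)"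
proof -
  have "cGL b y * zGG a (b + y) + cGL a y * zGG b (a + y)
      = y * (2 * a + \<epsilon>) * den y / (24 * \<epsilon>) + y * (2 * b + \<epsilon>) * den y / (24 * \<epsilon>)"
    using assms(2,3) by (simp add: cGL_def zGG_def) (simp add: algebra_simps add_divide_distrib diff_divide_distrib)
  also have "\<dots> = (y * (2 * a + \<epsilon>) + y * (2 * b + \<epsilon>)) * den y / (24 * \<epsilon>)"
    by (simp only: distrib_right add_divide_distrib)
  also have "y * (2 * a + \<epsilon>) + y * (2 * b + \<epsilon>) = 2 * (- (a + b) * (a + b + \<epsilon>))"
    using assms(1) by algebra
  finally show ?thesis by (simp add: zLL_def)
qed

end

context half_integer
begin

lemma wt_add: "wt (k + m) = wt k + of_int m"
  by (simp add: wt_def field_simps)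

lemma of_int_weights: "of_int (k + l + T) = wt k + wt l"
  by (simp add: wt_def field_simps)

abbreviation prod_f where "prod_f \<epsilon> m n \<equiv> - of_int n * (1 + \<epsilon> * of_int n) / (1 + \<epsilon> * of_int (m + n))"
abbreviation prod_w :: "complex \<Rightarrow> int \<Rightarrow> int \<Rightarrow> complex" where
  "prod_w \<epsilon> m n \<equiv> (if m + n = 0 then (of_int m ^ 3 - of_int m + (\<epsilon> - inverse \<epsilon>) * of_int m ^ 2) / 24 else 0)"
abbreviation prod_g where
  "prod_g \<epsilon> m k \<equiv> - (of_int m / 2 + wt k) * (1 + 2 * \<epsilon> * wt k) / (1 + 2 * \<epsilon> * wt (k + m))"
abbreviation prod_h where
  "prod_h \<epsilon> k m \<equiv> - of_int m * (1 + \<epsilon> * of_int m) / (1 + 2 * \<epsilon> * wt (k + m))"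
abbreviation prod_d where
  "prod_d \<epsilon> k l \<equiv> (1 + 2 * \<epsilon> * wt l) / (1 + \<epsilon> * of_int (k + l + T))"
abbreviation prod_v where
  "prod_v \<epsilon> k l \<equiv> (if k + l + T = 0 then (4 * wt k ^ 2 - 1 + 2 * (\<epsilon> - inverse \<epsilon>) * wt k) / 24 else 0)"

lemma sv_prod_eq_graded:
  "sv_prod \<theta> \<epsilon> = graded_product T (prod_f \<epsilon>) (prod_w \<epsilon>) (prod_g \<epsilon>) (prod_h \<epsilon>) (prod_d \<epsilon>) (prod_v \<epsilon>)"
proof -
  have mG: "complex_of_real (of_int m + (of_int k + \<theta>)) = wt (k + m)" for m k
    using of_real_index[of "k + m"] by (simp add: add_ac)
  have GG: "complex_of_real ((of_int k + \<theta>) + (of_int l + \<theta>)) = of_int (k + l + T)" for k l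
    unfolding index_sum by simp
  have "sv_prod_basis \<theta> \<epsilon> i j
      = graded_table T (prod_f \<epsilon>) (prod_w \<epsilon>) (prod_g \<epsilon>) (prod_h \<epsilon>) (prod_d \<epsilon>) (prod_v \<epsilon>) i j" for i j
    by (cases i; cases j)
      (simp_all add: Let_def mG GG of_real_index index_sum index_sum_zero_iff sv_G_index sv_L_def sv_c_def
        sv_scale_single single_uminus del: of_real_add of_int_add)
  then have "sv_prod_basis \<theta> \<epsilon>
      = graded_table T (prod_f \<epsilon>) (prod_w \<epsilon>) (prod_g \<epsilon>) (prod_h \<epsilon>) (prod_d \<epsilon>) (prod_v \<epsilon>)"
    by (intro ext)
  then show ?thesis by (simp only: sv_prod_def graded_product_def)
qed

lemma sv_prod_compatible:
  assumes "nondegenerate \<epsilon>"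
  shows "sv_compatible \<theta> (sv_prod \<theta> \<epsilon>)"
proof -
  have U0: "den \<epsilon> (of_int n) \<noteq> 0" and \<epsilon>0: "\<epsilon> \<noteq> 0" for n
    using assms by (simp_all add: den_def nondegenerate_def)
  have V0: "den \<epsilon> (2 * (wt k + of_int m)) \<noteq> 0" for k m
  proof -
    have "2 * (wt k + of_int m) = of_int (2 * (k + m) + T)" by (simp add: wt_def field_simps)
    then show ?thesis using U0 by (simp only: not_False_eq_True)
  qed
  have W0: "den \<epsilon> (wt k + wt l) \<noteq> 0" for k l
    using U0[of "k + l + T"] by (simp only: of_int_weights not_False_eq_True)
  have X0: "den \<epsilon> (of_int m + of_int n) \<noteq> 0" for m n
    using U0[of "m + n"] by simp
  note nonzero = U0 V0 W0 X0
  define f w g h d v where "f = prod_f \<epsilon>" and "w = prod_w \<epsilon>" and "g = prod_g \<epsilon>"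
    and "h = prod_h \<epsilon>" and "d = prod_d \<epsilon>" and "v = prod_v \<epsilon>"
  have f: "f m n = cLL \<epsilon> (of_int m) (of_int n)" for m n
    by (simp add: f_def cLL_def den_def)
  have g: "g m k = cLG \<epsilon> (of_int m) (wt k)" for m k
    by (simp add: g_def cLG_def den_def wt_add mult.left_commute mult.assoc)
  have h: "h k m = cGL \<epsilon> (wt k) (of_int m)" for m k
    by (simp add: h_def cGL_def den_def wt_add mult.left_commute mult.assoc)
  have d: "d k l = cGG \<epsilon> (wt k) (wt l)" for k l
    unfolding d_def cGG_def den_def of_int_weights by (simp add: mult.left_commute mult.assoc)
  have w: "w m n = (if m + n = 0 then zLL \<epsilon> (of_int m) (of_int n) else 0)" for m n
  proof -
    have "(x ^ 3 - x + (\<epsilon> - inverse \<epsilon>) * x ^ 2) / 24 = zLL \<epsilon> x (- x)" for x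
      using \<epsilon>0 by (simp add: zLL_def den_def field_simps power2_eq_square power3_eq_cube)
    then show ?thesis by (simp add: w_def add_eq_0_iff)
  qed
  have opposite: "wt l = - wt k" if "k + l + T = 0" for k l
  proof -
    have "wt k + wt l = 0" using of_int_weights[of k l] unfolding that by simp
    then show ?thesis by (simp add: eq_neg_iff_add_eq_0 add.commute)
  qed
  have v: "v k l = (if k + l + T = 0 then zGG \<epsilon> (wt k) (wt l) else 0)" for k l
  proof -
    have "(4 * x ^ 2 - 1 + 2 * (\<epsilon> - inverse \<epsilon>) * x) / 24 = zGG \<epsilon> x (- x)" for x
      using \<epsilon>0 by (simp add: zGG_def den_def field_simps power2_eq_square power3_eq_cube)
    then show ?thesis by (simp add: v_def opposite)
  qed
  have "super_structure_constants T f w g h d v"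
  proof (standard, unfold wt_def[symmetric])
    fix m n p k l j :: int
    show "f m n - f n m = of_int (m - n)"
      using cLL_comm[OF X0] by (simp add: f)
    show "w m n - w n m = (if m + n = 0 then (of_int m ^ 3 - of_int m) / 12 else 0)"
    proof (cases "m + n = 0")
      case True
      then have n: "n = - m" by simp
      show ?thesis unfolding n by (simp add: w_def field_simps)
    qed (simp add: w_def add.commute)
    show "g m k - h k m = of_int m / 2 - wt k"
      using cLG_cGL_comm[OF V0] by (simp add: g h)
    show "d k l + d l k = 2"
      using cGG_comm[OF W0] by (simp add: d)
    show "v k l + v l k = (if k + l + T = 0 then (4 * wt k ^ 2 - 1) / 12 else 0)"
      using opposite[of k l] by (auto simp: v_def add.commute field_simps)
    show "of_int (m - n) * f (m + n) p = f n p * f m (n + p) - f m p * f n (m + p)"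
      using cLL_law[OF X0 X0] by (simp add: f)
    show "of_int (m - n) * w (m + n) p = f n p * w m (n + p) - f m p * w n (m + p)"
    proof (cases "m + n + p = 0")
      case True
      then have "of_int m + of_int n + of_int p = (0 :: complex)"
        by (simp flip: of_int_add)
      from zLL_law[OF this X0 X0] True show ?thesis by (simp add: f w add_ac)
    qed (simp add: w add_ac)
    show "of_int (m - n) * g (m + n) k = g n k * g m (k + n) - g m k * g n (k + m)"
      using cLG_law[OF V0 V0] by (simp add: g wt_add)
    show "(of_int m / 2 - wt k) * h (k + m) n = h k n * g m (k + n) - f m n * h k (m + n)"
      using cGL_law[OF V0 X0] by (simp add: f g h wt_add)
    show "(of_int m / 2 - wt k) * d (k + m) l = d k l * f m (k + l + T) - g m l * d k (l + m)"
      unfolding f g d wt_add of_int_weights by (rule cGG_law[OF W0 V0])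
    show "(of_int m / 2 - wt k) * v (k + m) l = d k l * w m (k + l + T) - g m l * v k (l + m)"
    proof (cases "m + (k + l + T) = 0")
      case True
      then have "of_int m + wt k + wt l = 0"
        using arg_cong[OF True, of complex_of_int] unfolding of_int_add[of m] of_int_weights by (simp add: add.assoc)
      note law = zGG_law[OF this W0 V0]
      have "k + m + l + T = 0" "k + (l + m) + T = 0" using True by simp_all
      with True law show ?thesis
        by (simp only: d w g v simp_thms if_True wt_add of_int_weights)
    qed (simp add: w v add_ac)
    show "2 * f (k + l + T) n = h l n * d k (l + n) + h k n * d l (k + n)"
      unfolding f h d wt_add of_int_weights by (rule cGL_cGG_law[OF V0 V0])
    show "2 * w (k + l + T) n = h l n * v k (l + n) + h k n * v l (k + n)"
    proof (cases "k + l + T + n = 0")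
      case True
      then have "wt k + wt l + of_int n = 0"
        using arg_cong[OF True, of complex_of_int] unfolding of_int_add[of _ n] of_int_weights by simp
      note law = cGL_zGG_law[OF this V0 V0]
      have "k + (l + n) + T = 0" "l + (k + n) + T = 0" using True by simp_all
      with True law show ?thesis
        by (simp only: h w v simp_thms if_True wt_add of_int_weights)
    qed (simp add: w v add_ac)
    show "2 * g (k + l + T) j = d l j * h k (l + j + T) + d k j * h l (k + j + T)"
      unfolding g h d of_int_weights by (rule cGG_cGL_law[OF W0 W0])
  qed
  then show ?thesis
    by (simp only: sv_prod_eq_graded compatible_graded_product_iff f_def w_def g_def h_def d_def v_def)
qed

end

section \<open>Every compatible product belongs to the family\<close>

context half_integer
begin

lemma index_in_shifted_ints: "of_int k + \<theta> \<in> shifted_ints \<theta>"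
  by (simp add: shifted_ints_def)

text \<open>
  Since \<open>c\<close> is even, the grading removes the central terms of \<open>L\<^sub>m \<cdot> G\<^sub>r\<close> and \<open>G\<^sub>r \<cdot> L\<^sub>m\<close>.
\<close>

lemma sv_form_eq_graded_product:
  assumes P: "sv_compatible \<theta> P" and form: "sv_form \<theta> f g h d \<omega> P"
  shows "P = graded_product T f (\<lambda>m n. \<omega> (sv_e (IL m)) (sv_e (IL n))) (\<lambda>m k. g m (of_int k + \<theta>))
    (\<lambda>k m. h (of_int k + \<theta>) m) (\<lambda>k l. d (of_int k + \<theta>) (of_int l + \<theta>))
    (\<lambda>k l. \<omega> (sv_e (IG k)) (sv_e (IG l)))" (is "P = ?Q")
proof (rule sv_bilinear_eqI)
  interpret left_symmetric_superalgebra sv_scale "sv_grade \<theta>" P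
    using P by (simp add: compatible_lss_def)
  show "sv_bilinear P" by (rule superalgebra_bilinear) unfold_locales
  show "sv_bilinear ?Q" by (rule graded_product_bilinear)
  have "P (sv_e (IL m)) (sv_e (IG k)) \<in> sv_grade \<theta> (sv_parity (IL m) + sv_parity (IG k))"
    "P (sv_e (IG k)) (sv_e (IL m)) \<in> sv_grade \<theta> (sv_parity (IG k) + sv_parity (IL m))" for m k
    by (rule mul_homogeneous[OF sv_e_in_grade sv_e_in_grade])+
  then have odd: "Poly_Mapping.lookup (P (sv_e (IL m)) (sv_e (IG k))) IC = 0"
    "Poly_Mapping.lookup (P (sv_e (IG k)) (sv_e (IL m))) IC = 0" for m k
    unfolding sv_grade_iff by force+
  note basis = sv_G_index sv_G_shift sv_L_def sv_c_def
  have "\<forall>m n. P (sv_e (IL m)) (sv_e (IL n)) =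
      sv_scale (f m n) (sv_e (IL (m + n))) + sv_scale (\<omega> (sv_e (IL m)) (sv_e (IL n))) (sv_e IC)"
    using form unfolding sv_form_def basis by blast
  moreover have LG: "P (sv_e (IL m)) (sv_e (IG k)) =
      sv_scale (g m (of_int k + \<theta>)) (sv_e (IG (k + m))) + sv_scale (\<omega> (sv_e (IL m)) (sv_e (IG k))) (sv_e IC)" for m k
  proof -
    have "P (sv_L m) (sv_G \<theta> (of_int k + \<theta>)) =
        sv_scale (g m (of_int k + \<theta>)) (sv_G \<theta> (of_int m + (of_int k + \<theta>)))
        + sv_scale (\<omega> (sv_L m) (sv_G \<theta> (of_int k + \<theta>))) sv_c"
      using form index_in_shifted_ints[of k] unfolding sv_form_def by blast
    then show ?thesis unfolding basis .
  qed
  moreover have GL: "P (sv_e (IG k)) (sv_e (IL m)) =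
      sv_scale (h (of_int k + \<theta>) m) (sv_e (IG (k + m))) + sv_scale (\<omega> (sv_e (IG k)) (sv_e (IL m))) (sv_e IC)" for m k
  proof -
    have "P (sv_G \<theta> (of_int k + \<theta>)) (sv_L m) =
        sv_scale (h (of_int k + \<theta>) m) (sv_G \<theta> (of_int m + (of_int k + \<theta>)))
        + sv_scale (\<omega> (sv_G \<theta> (of_int k + \<theta>)) (sv_L m)) sv_c"
      using form index_in_shifted_ints[of k] unfolding sv_form_def by blast
    then show ?thesis unfolding basis .
  qed
  moreover have "P (sv_e (IG k)) (sv_e (IG l)) =
      sv_scale (d (of_int k + \<theta>) (of_int l + \<theta>)) (sv_e (IL (k + l + T)))
      + sv_scale (\<omega> (sv_e (IG k)) (sv_e (IG l))) (sv_e IC)" for k l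
  proof -
    have "P (sv_G \<theta> (of_int k + \<theta>)) (sv_G \<theta> (of_int l + \<theta>)) =
        sv_scale (d (of_int k + \<theta>) (of_int l + \<theta>)) (sv_L \<lfloor>(of_int k + \<theta>) + (of_int l + \<theta>)\<rfloor>)
        + sv_scale (\<omega> (sv_G \<theta> (of_int k + \<theta>)) (sv_G \<theta> (of_int l + \<theta>))) sv_c"
      using form index_in_shifted_ints[of k] index_in_shifted_ints[of l] unfolding sv_form_def by blast
    then show ?thesis unfolding index_sum floor_of_int basis .
  qed
  moreover have "\<omega> (sv_e (IL m)) (sv_e (IG k)) = 0" "\<omega> (sv_e (IG k)) (sv_e (IL m)) = 0" for m k
    using odd(1)[of m k] odd(2)[of k m] by (simp_all add: LG GL sv_lookup_simps)
  moreover have "P (sv_e IC) (sv_e j) = 0 \<and> P (sv_e j) (sv_e IC) = 0" for j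
  proof -
    have "P sv_c sv_c = 0" "P sv_c (sv_L m) = 0 \<and> P (sv_L m) sv_c = 0"
      "P sv_c (sv_G \<theta> (of_int k + \<theta>)) = 0 \<and> P (sv_G \<theta> (of_int k + \<theta>)) sv_c = 0" for m k
      using form index_in_shifted_ints[of k] unfolding sv_form_def by blast+
    then show ?thesis unfolding basis by (cases j) simp_all
  qed
  ultimately show "P (sv_e i) (sv_e j) = ?Q (sv_e i) (sv_e j)" for i j
    by (cases i; cases j) (simp_all add: graded_product_e)
qed

lemma compatible_graded_product_eq_sv_prod:
  assumes "sv_compatible \<theta> (graded_product T f w g h d v)"
  obtains \<epsilon> where "nondegenerate \<epsilon>" "graded_product T f w g h d v = sv_prod \<theta> \<epsilon>"
proof -
  interpret c: super_structure_constants T f w g h d v "\<lambda>k. of_int (2 * k + T) / 2"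
    using assms compatible_graded_product_iff by blast
  obtain \<epsilon> where \<epsilon>: "\<epsilon> \<noteq> 0" "\<And>n. 1 + \<epsilon> * of_int n \<noteq> 0"
    and f: "\<And>m n. f m n * (1 + \<epsilon> * of_int (m + n)) = - of_int n * (1 + \<epsilon> * of_int n)"
    using c.f_formula[OF c.f_1_1_neq] by blast
  have V: "1 + \<epsilon> * of_int (2 * k + T) = 1 + 2 * \<epsilon> * wt k" for k
    by (simp add: wt_def)
  have idx: "2 * k + 2 * m + T = 2 * (k + m) + T" for k m :: int by simp
  have "f m n = prod_f \<epsilon> m n" for m n
    using f[of m n] \<epsilon>(2)[of "m + n"] by (simp only: nonzero_eq_divide_eq not_False_eq_True)
  moreover have "w m n = prod_w \<epsilon> m n" for m n
  proof (cases "m + n = 0")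
    case True
    then have "n = - m" by simp
    then show ?thesis using c.w_formula[OF \<epsilon> f, of m] by simp
  qed (simp add: c.w_off_diagonal)
  moreover have "g m k = prod_g \<epsilon> m k" for m k
    using c.g_formula[OF \<epsilon> f, of m k] unfolding c.u_def[OF \<epsilon> f] idx V wt_def[symmetric] .
  moreover have "h k m = prod_h \<epsilon> k m" for m k
    using c.h_formula[OF \<epsilon> f, of k m] unfolding c.u_def[OF \<epsilon> f] idx V wt_def[symmetric] .
  moreover have "d k l = prod_d \<epsilon> k l" for k l
    using c.d_formula[OF \<epsilon> f, of k l] unfolding c.u_def[OF \<epsilon> f] V .
  moreover have "v k l = prod_v \<epsilon> k l" for k l
    using c.v_formula[OF \<epsilon> f, of k l] unfolding wt_def[symmetric] .
  ultimately have "f = prod_f \<epsilon>" "w = prod_w \<epsilon>" "g = prod_g \<epsilon>" "h = prod_h \<epsilon>" "d = prod_d \<epsilon>" "v = prod_v \<epsilon>"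
    by (intro ext; simp only:)+
  then have "graded_product T f w g h d v = sv_prod \<theta> \<epsilon>"
    by (simp only: sv_prod_eq_graded)
  moreover have "nondegenerate \<epsilon>" using \<epsilon> by (simp add: nondegenerate_def)
  ultimately show ?thesis by (rule that[rotated])
qed

section \<open>The reflection\<close>

text \<open>
  The automorphism \<open>L\<^sub>m \<mapsto> -L\<^bsub>-m\<^esub>\<close>, \<open>G\<^sub>r \<mapsto> \<i> G\<^bsub>-r\<^esub>\<close>, \<open>c \<mapsto> -c\<close> of the super-Virasoro algebra. The factor \<open>\<i>\<close> makes
  \<open>[G\<^sub>r, G\<^sub>s] = 2 L\<^bsub>r+s\<^esub> + \<dots>\<close> pick up the sign that the even part requires.
\<close>

fun reflect_basis :: "sv_index \<Rightarrow> sv" where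
  "reflect_basis (IL m) = - sv_e (IL (- m))"
| "reflect_basis (IG k) = sv_scale \<i> (sv_e (IG (- k - T)))"
| "reflect_basis IC = - sv_e IC"

text \<open>
  The linear extension is obtained from the bilinear one by freezing the second argument.
\<close>

definition reflect :: "sv \<Rightarrow> sv" where
  "reflect x = bilinear_extension (\<lambda>i _. reflect_basis i) x (sv_e IC)"

lemma reflect_linear: "sv_linear reflect"
  using bilinear_extension_bilinear unfolding sv_bilinear_def reflect_def[abs_def] by blast

lemma reflect_simps:
  "reflect (sv_e i) = reflect_basis i" "reflect (x + y) = reflect x + reflect y"
  "reflect (sv_scale a x) = sv_scale a (reflect x)" "reflect 0 = 0" "reflect (- x) = - reflect x"
proof -
  show "reflect (sv_e i) = reflect_basis i"
    by (simp add: reflect_def bilinear_extension_single)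
  have add: "reflect (x + y) = reflect x + reflect y"
    and scale: "reflect (sv_scale a x) = sv_scale a (reflect x)" for a x y
    using reflect_linear by (simp_all add: sv_linear_iff)
  show "reflect (x + y) = reflect x + reflect y" "reflect (sv_scale a x) = sv_scale a (reflect x)"
    by (rule add, rule scale)
  show "reflect 0 = 0" using scale[of 0 0] by simp
  show "reflect (- x) = - reflect x" using scale[of "-1" x] by simp
qed

text \<open>
  The square of \<open>reflect\<close> is the parity automorphism, so \<open>reflect\<close> has order four.
\<close>

lemma reflect_four: "reflect (reflect (reflect (reflect x))) = x"
proof (rule sv_linear_eqI[of "\<lambda>x. reflect (reflect (reflect (reflect x)))" "\<lambda>x. x"])
  show "sv_linear (\<lambda>x. reflect (reflect (reflect (reflect x))))" "sv_linear (\<lambda>x. x)"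
    by (simp_all add: sv_linear_iff reflect_simps)
  show "reflect (reflect (reflect (reflect (sv_e i)))) = sv_e i" for i
    by (cases i) (simp_all add: reflect_simps)
qed

lemma reflect_grade: "x \<in> sv_grade \<theta> \<alpha> \<Longrightarrow> reflect x \<in> sv_grade \<theta> \<alpha>"
proof -
  have "sv.subspace {x. reflect x \<in> sv_grade \<theta> \<alpha>}"
    by (rule sv.subspaceI) (auto simp: reflect_simps sv_grade_eq_span sv.span_zero sv.span_add sv.span_scale)
  moreover have "reflect (sv_e i) \<in> sv_grade \<theta> (sv_parity i)" for i
    by (cases i) (auto simp: reflect_simps sv_grade_iff lookup_sv_scale lookup_sv_e split: if_splits)
  ultimately have "sv_grade \<theta> \<alpha> \<subseteq> {x. reflect x \<in> sv_grade \<theta> \<alpha>}"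
    unfolding sv_grade_eq_span[of _ \<alpha>] by (intro sv.span_minimal) (auto simp: sv_grade_eq_span)
  then show "x \<in> sv_grade \<theta> \<alpha> \<Longrightarrow> reflect x \<in> sv_grade \<theta> \<alpha>" by auto
qed

lemma reflect_graded_product:
  assumes "\<And>m n. f' (- m) (- n) = - f m n" "\<And>m n. w' (- m) (- n) = - w m n"
    and "\<And>m k. g' (- m) (- k - T) = - g m k" "\<And>m k. h' (- k - T) (- m) = - h k m"
    and "\<And>k l. d' (- k - T) (- l - T) = d k l" "\<And>k l. v' (- k - T) (- l - T) = v k l"
  shows "reflect (graded_product T f w g h d v x y) = graded_product T f' w' g' h' d' v' (reflect x) (reflect y)"
proof -
  let ?P = "graded_product T f w g h d v" and ?Q = "graded_product T f' w' g' h' d' v'"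
  have minus: "?Q (- x) y = - ?Q x y" "?Q x (- y) = - ?Q x y" for x y
    using sv_bilinear_scale_left[OF graded_product_bilinear, of T f' w' g' h' d' v' "-1" x y]
      sv_bilinear_scale_right[OF graded_product_bilinear, of T f' w' g' h' d' v' x "-1" y] by simp_all
  have "(\<lambda>x y. reflect (?P x y)) = (\<lambda>x y. ?Q (reflect x) (reflect y))"
  proof (rule sv_bilinear_eqI)
    show "sv_bilinear (\<lambda>x y. reflect (?P x y))" "sv_bilinear (\<lambda>x y. ?Q (reflect x) (reflect y))"
      by (simp_all add: sv_bilinear_def sv_linear_iff reflect_simps graded_simps)
    show "reflect (?P (sv_e i) (sv_e j)) = ?Q (reflect (sv_e i)) (reflect (sv_e j))" for i j
      by (cases i; cases j; intro sv_poly_eqI)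
        (auto simp: reflect_simps graded_simps minus sv_lookup_simps assms)
  qed
  then show ?thesis by (simp add: fun_eq_iff)
qed

text \<open>
  Each structure constant of the family is unchanged, up to the sign required by the reflection, when
  \<open>\<epsilon>\<close> and all weights change sign.
\<close>

lemma sv_prod_isomorphic_minus: "sv_isomorphic \<theta> (sv_prod \<theta> \<epsilon>) (sv_prod \<theta> (- \<epsilon>))"
proof -
  let ?P = "sv_prod \<theta> \<epsilon>" and ?Q = "sv_prod \<theta> (- \<epsilon>)"
  have "bij reflect"
    by (rule o_bij[of "reflect \<circ> reflect \<circ> reflect"]) (simp_all add: fun_eq_iff reflect_four)
  moreover have "reflect ` sv_grade \<theta> \<alpha> = sv_grade \<theta> \<alpha>" for \<alpha>
  proof
    show "reflect ` sv_grade \<theta> \<alpha> \<subseteq> sv_grade \<theta> \<alpha>" using reflect_grade by auto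
    show "sv_grade \<theta> \<alpha> \<subseteq> reflect ` sv_grade \<theta> \<alpha>"
    proof
      fix x assume "x \<in> sv_grade \<theta> \<alpha>"
      then have "reflect (reflect (reflect x)) \<in> sv_grade \<theta> \<alpha>"
        by (intro reflect_grade)
      then show "x \<in> reflect ` sv_grade \<theta> \<alpha>"
        by (rule rev_image_eqI) (simp add: reflect_four)
    qed
  qed
  moreover have "reflect (?P x y) = ?Q (reflect x) (reflect y)" for x y
  proof -
    have wt_reflect: "wt (- k - T) = - wt k" for k by (simp add: wt_def field_simps)
    have wt_reflect': "wt (- k - T - m) = - wt (k + m)" for k m by (simp add: wt_def field_simps)
    show ?thesis
      unfolding sv_prod_eq_graded
    proof (rule reflect_graded_product)
      fix m n k l :: int
      have "1 + - \<epsilon> * of_int (- m + - n) = 1 + \<epsilon> * of_int (m + n)" by (simp add: algebra_simps)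
      then show "prod_f (- \<epsilon>) (- m) (- n) = - prod_f \<epsilon> m n" by (simp only:) simp
      show "prod_w (- \<epsilon>) (- m) (- n) = - prod_w \<epsilon> m n"
      proof -
        have "- m + - n = 0 \<longleftrightarrow> m + n = 0" by arith
        moreover have "((- x) ^ 3 - (- x) + (- \<epsilon> - - i) * (- x) ^ 2) / 24 = - ((x ^ 3 - x + (\<epsilon> - i) * x ^ 2) / 24)"
          for x i :: complex
          by (simp add: power3_eq_cube power2_eq_square field_simps)
        ultimately show ?thesis by (cases "m + n = 0") (simp_all only: if_True if_False inverse_minus_eq of_int_minus simp_thms minus_zero)
      qed
      have V: "1 + 2 * - \<epsilon> * wt (- k - T + - m) = 1 + 2 * \<epsilon> * wt (k + m)"
        using wt_reflect'[of k m] by simp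
      show "prod_g (- \<epsilon>) (- m) (- k - T) = - prod_g \<epsilon> m k"
      proof -
        have "- (of_int (- m) / 2 + wt (- k - T)) * (1 + 2 * - \<epsilon> * wt (- k - T))
            = - (- (of_int m / 2 + wt k) * (1 + 2 * \<epsilon> * wt k))"
          by (simp add: wt_reflect algebra_simps)
        then show ?thesis unfolding V by (simp only: minus_divide_left)
      qed
      show "prod_h (- \<epsilon>) (- k - T) (- m) = - prod_h \<epsilon> k m"
        unfolding V by simp
      have "1 + - \<epsilon> * of_int (- k - T + (- l - T) + T) = 1 + \<epsilon> * of_int (k + l + T)"
        by (simp add: algebra_simps)
      then show "prod_d (- \<epsilon>) (- k - T) (- l - T) = prod_d \<epsilon> k l"
        by (simp only: wt_reflect) simp
      have "- k - T + (- l - T) + T = 0 \<longleftrightarrow> k + l + T = 0" by arith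
      then show "prod_v (- \<epsilon>) (- k - T) (- l - T) = prod_v \<epsilon> k l"
        by (simp only: wt_reflect inverse_minus_eq) (simp add: algebra_simps)
    qed
  qed
  ultimately have "superalgebra_iso sv_scale (sv_grade \<theta>) ?P sv_scale (sv_grade \<theta>) ?Q reflect"
    using reflect_linear by (simp add: superalgebra_iso_def)
  then show ?thesis by (auto simp: sv_isomorphic_def)
qed

end

section \<open>Isomorphisms within the family\<close>

lemma lookup_eqI:
  assumes f: "sv_linear f" and eq: "\<And>i. Poly_Mapping.lookup (f (sv_e i)) j = c * Poly_Mapping.lookup (sv_e i) k"
  shows "Poly_Mapping.lookup (f x) j = c * Poly_Mapping.lookup x k"
proof -
  \<comment> \<open>linear functionals are compared as linear maps into the line spanned by \<open>c\<close>\<close>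
  have "sv_scale (Poly_Mapping.lookup (f x) j) (sv_e IC) = sv_scale (c * Poly_Mapping.lookup x k) (sv_e IC)"
  proof (rule sv_linear_eqI[of "\<lambda>x. sv_scale (Poly_Mapping.lookup (f x) j) (sv_e IC)"
        "\<lambda>x. sv_scale (c * Poly_Mapping.lookup x k) (sv_e IC)"])
    show "sv_linear (\<lambda>x. sv_scale (Poly_Mapping.lookup (f x) j) (sv_e IC))"
      "sv_linear (\<lambda>x. sv_scale (c * Poly_Mapping.lookup x k) (sv_e IC))"
      using f by (simp_all add: sv_linear_iff lookup_add lookup_sv_scale sv.scale_left_distrib distrib_left
          mult.left_commute)
  qed (simp add: eq)
  from arg_cong[OF this, of "\<lambda>v. Poly_Mapping.lookup v IC"] show ?thesis
    by (simp add: sv_lookup_simps)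
qed

context half_integer
begin

lemma sv_prod_bilinear: "sv_bilinear (sv_prod \<theta> \<epsilon>)"
  by (simp add: sv_prod_def bilinear_extension_bilinear)

lemma sv_prod_e: "sv_prod \<theta> \<epsilon> (sv_e i) (sv_e j)
    = graded_table T (prod_f \<epsilon>) (prod_w \<epsilon>) (prod_g \<epsilon>) (prod_h \<epsilon>) (prod_d \<epsilon>) (prod_v \<epsilon>) i j"
  by (simp only: sv_prod_eq_graded graded_product_e)

lemma sv_prod_linear: "sv_linear (sv_prod \<theta> \<epsilon> x)"
  using sv_prod_bilinear by (simp add: sv_bilinear_def)

lemma sv_prod_c_left: "sv_prod \<theta> \<epsilon> (sv_e IC) x = 0"
  by (simp only: sv_prod_eq_graded graded_product_c_left)

lemmas sv_prod_simps = sv_bilinear_simps[OF sv_prod_bilinear] sv_prod_c_left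

lemma sv_prod_L0_right: "sv_prod \<theta> \<epsilon> x (sv_e (IL 0)) = 0"
proof (rule sv_linear_eqI[of "\<lambda>x. sv_prod \<theta> \<epsilon> x (sv_e (IL 0))" "\<lambda>_. 0"])
  show "sv_linear (\<lambda>x. sv_prod \<theta> \<epsilon> x (sv_e (IL 0)))"
    using sv_prod_bilinear by (simp add: sv_bilinear_def)
  show "sv_prod \<theta> \<epsilon> (sv_e i) (sv_e (IL 0)) = 0" for i
    by (cases i) (simp_all add: sv_prod_e)
qed (simp add: sv_linear_iff)

lemma sv_prod_c_right: "sv_prod \<theta> \<epsilon> x (sv_e IC) = 0"
proof (rule sv_linear_eqI[of "\<lambda>x. sv_prod \<theta> \<epsilon> x (sv_e IC)" "\<lambda>_. 0"])
  show "sv_linear (\<lambda>x. sv_prod \<theta> \<epsilon> x (sv_e IC))"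
    using sv_prod_bilinear by (simp add: sv_bilinear_def)
  show "sv_prod \<theta> \<epsilon> (sv_e i) (sv_e IC) = 0" for i
    by (cases i) (simp_all add: sv_prod_e)
qed (simp add: sv_linear_iff)

context
  fixes \<epsilon> :: complex
  assumes nondeg: "nondegenerate \<epsilon>"
begin

lemma denom: "1 + \<epsilon> * of_int n \<noteq> 0" "1 + 2 * \<epsilon> * wt k \<noteq> 0"
proof -
  have *: "1 + \<epsilon> * of_int n \<noteq> 0" for n using nondeg by (simp add: nondegenerate_def)
  show "1 + \<epsilon> * of_int n \<noteq> 0" by (rule *)
  have "1 + 2 * \<epsilon> * wt k = 1 + \<epsilon> * of_int (2 * k + T)" by (simp add: wt_def)
  then show "1 + 2 * \<epsilon> * wt k \<noteq> 0" using * by (simp only: not_False_eq_True)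
qed

text \<open>
  Together with \<open>sv_prod_L0_right\<close> and \<open>sv_prod_c_right\<close> this identifies the elements killed by all left
  multiplications as the span of \<open>L\<^sub>0\<close> and \<open>c\<close>, a subspace that every isomorphism must preserve.
  Left multiplication by \<open>G\<^sub>0\<close> (in the numbering by integers) detects all other coefficients.
\<close>

lemma right_annihilator:
  assumes "\<And>x. sv_prod \<theta> \<epsilon> x y = 0"
  shows "n \<noteq> 0 \<Longrightarrow> Poly_Mapping.lookup y (IL n) = 0" and "Poly_Mapping.lookup y (IG k) = 0"
proof -
  have coeff: "Poly_Mapping.lookup (sv_prod \<theta> \<epsilon> (sv_e (IG 0)) y) (IG n) = prod_h \<epsilon> 0 n * Poly_Mapping.lookup y (IL n)" for n
    by (rule lookup_eqI[OF sv_prod_linear], rename_tac i, case_tac i)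
      (auto simp: sv_prod_e sv_lookup_simps)
  show "n \<noteq> 0 \<Longrightarrow> Poly_Mapping.lookup y (IL n) = 0"
    using coeff[of n] assms[of "sv_e (IG 0)"] denom(1)[of n] denom(2)[of "0 + n"] by simp
  have coeff': "Poly_Mapping.lookup (sv_prod \<theta> \<epsilon> (sv_e (IG 0)) y) (IL (k + T)) = prod_d \<epsilon> 0 k * Poly_Mapping.lookup y (IG k)" for k
    by (rule lookup_eqI[OF sv_prod_linear], rename_tac i, case_tac i)
      (auto simp: sv_prod_e sv_lookup_simps)
  have "prod_d \<epsilon> 0 k \<noteq> 0"
    using denom(1)[of "0 + k + T"] denom(2)[of k] by (simp only: divide_eq_0_iff not_False_eq_True simp_thms)
  then show "Poly_Mapping.lookup y (IG k) = 0"
    using coeff'[of k] assms[of "sv_e (IG 0)"] by simp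
qed

lemma L0_left: "Poly_Mapping.lookup (sv_prod \<theta> \<epsilon> (sv_e (IL 0)) x) (IL n) = - of_int n * Poly_Mapping.lookup x (IL n)"
proof (rule lookup_eqI[OF sv_prod_linear])
  fix i
  show "Poly_Mapping.lookup (sv_prod \<theta> \<epsilon> (sv_e (IL 0)) (sv_e i)) (IL n) = - of_int n * Poly_Mapping.lookup (sv_e i) (IL n)"
    using denom(1)[of n] by (cases i) (auto simp: sv_prod_e sv_lookup_simps)
qed

text \<open>
  An even element without such a component is a combination of \<open>L\<^sub>0\<close> and \<open>c\<close>, which all left multiplications
  annihilate.
\<close>

lemma exists_L_component:
  assumes "x \<in> sv_grade \<theta> 0" "sv_prod \<theta> \<epsilon> y x \<noteq> 0"
  obtains n where "n \<noteq> 0" "Poly_Mapping.lookup x (IL n) \<noteq> 0"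
proof (rule ccontr)
  assume "\<not> thesis"
  then have none: "Poly_Mapping.lookup x (IL n) = 0" if "n \<noteq> 0" for n using that \<open>\<And>n. n \<noteq> 0 \<Longrightarrow> Poly_Mapping.lookup x (IL n) \<noteq> 0 \<Longrightarrow> thesis\<close> by blast
  have "x = sv_scale (Poly_Mapping.lookup x (IL 0)) (sv_e (IL 0)) + sv_scale (Poly_Mapping.lookup x IC) (sv_e IC)"
    using assms(1) none by (intro sv_poly_eqI) (auto simp: sv_lookup_simps sv_grade_iff)
  then have "sv_prod \<theta> \<epsilon> y x = 0"
    by (metis (no_types) sv_bilinear_simps(2,4)[OF sv_prod_bilinear] sv_prod_L0_right sv_prod_c_right
        sv.scale_zero_right add.right_neutral)
  with assms(2) show False by simp
qed

end

text \<open>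
  An isomorphism \<open>\<phi>\<close> maps the right annihilators onto each other, so \<open>\<phi> L\<^sub>0 = \<alpha> L\<^sub>0 + \<beta> c\<close>. Left
  multiplication by \<open>L\<^sub>0\<close> has the eigenvalues \<open>\<int>\<close> on the even part for both products, hence \<open>\<alpha> = \<plusminus>1\<close>, and
  \<open>\<phi>\<close> maps \<open>L\<^bsub>\<plusminus>1\<^esub>\<close> to multiples of \<open>L\<^bsub>\<plusminus>\<alpha>\<^esub>\<close> modulo \<open>c\<close>. The products of \<open>L\<^sub>1\<close> and \<open>L\<^bsub>-1\<^esub>\<close> in either order, which
  are \<open>(1 - \<epsilon>) L\<^sub>0\<close> and \<open>-(1 + \<epsilon>) L\<^sub>0\<close> modulo \<open>c\<close>, then yield \<open>\<epsilon> = \<alpha> \<epsilon>'\<close>.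
\<close>

lemma isomorphism_parameters:
  assumes nd: "nondegenerate \<epsilon>" "nondegenerate \<epsilon>'"
    and iso: "sv_isomorphic \<theta> (sv_prod \<theta> \<epsilon>) (sv_prod \<theta> \<epsilon>')"
  shows "\<epsilon> = \<epsilon>' \<or> \<epsilon> = - \<epsilon>'"
proof -
  let ?P = "sv_prod \<theta> \<epsilon>" and ?Q = "sv_prod \<theta> \<epsilon>'" and ?l = "Poly_Mapping.lookup"
  obtain \<phi> where "superalgebra_iso sv_scale (sv_grade \<theta>) ?P sv_scale (sv_grade \<theta>) ?Q \<phi>"
    using iso by (auto simp: sv_isomorphic_def)
  then have lin: "sv_linear \<phi>" and bij: "bij \<phi>" and grade: "\<And>\<alpha>. \<phi> ` sv_grade \<theta> \<alpha> = sv_grade \<theta> \<alpha>"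
    and mult: "\<And>x y. \<phi> (?P x y) = ?Q (\<phi> x) (\<phi> y)"
    by (auto simp: superalgebra_iso_def)
  have \<phi>_add: "\<phi> (x + y) = \<phi> x + \<phi> y" and \<phi>_scale: "\<phi> (sv_scale a x) = sv_scale a (\<phi> x)" for a x y
    using lin by (simp_all add: sv_linear_iff)
  have \<phi>_0: "\<phi> 0 = 0" using \<phi>_scale[of 0 0] by simp
  have \<phi>_eq_0: "\<phi> x = 0 \<longleftrightarrow> x = 0" for x
    using bij \<phi>_0 by (metis bij_is_inj inj_eq)
  have even_e: "sv_e (IL n) \<in> sv_grade \<theta> 0" "sv_e IC \<in> sv_grade \<theta> 0" for n
    using sv_e_in_grade[of "IL n" \<theta>] sv_e_in_grade[of IC \<theta>] by simp_all
  have even: "\<phi> (sv_e (IL n)) \<in> sv_grade \<theta> 0" for n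
    using grade[of 0] even_e by blast
  have no_odd: "?l x (IG k) = 0" if "x \<in> sv_grade \<theta> 0" for x k
    using that by (auto simp: sv_grade_iff)
  have annihilated: "?Q x (\<phi> y) = 0" if "\<And>x. ?P x y = 0" for x y
  proof -
    obtain x' where "x = \<phi> x'" using bij by (metis bij_pointE)
    then show ?thesis using mult[of x' y] that \<phi>_0 by simp
  qed
  define \<alpha> where "\<alpha> = ?l (\<phi> (sv_e (IL 0))) (IL 0)"
  have \<phi>L0: "\<phi> (sv_e (IL 0)) = sv_scale \<alpha> (sv_e (IL 0)) + sv_scale (?l (\<phi> (sv_e (IL 0))) IC) (sv_e IC)"
    using right_annihilator[OF nd(2) annihilated[OF sv_prod_L0_right]]
    by (intro sv_poly_eqI) (auto simp: sv_lookup_simps \<alpha>_def)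
  have \<phi>c: "?l (\<phi> (sv_e IC)) (IL 0) = 0"
  proof -
    have *: "\<phi> (sv_e IC) = sv_scale (?l (\<phi> (sv_e IC)) (IL 0)) (sv_e (IL 0)) + sv_scale (?l (\<phi> (sv_e IC)) IC) (sv_e IC)"
      using right_annihilator[OF nd(2) annihilated[OF sv_prod_c_right]]
      by (intro sv_poly_eqI) (auto simp: sv_lookup_simps)
    obtain x' where x': "sv_e (IL 1) = \<phi> x'" using bij by (metis bij_pointE)
    have "?Q (\<phi> (sv_e IC)) (sv_e (IL 1)) = 0"
      using mult[of "sv_e IC" x'] by (simp add: x' sv_prod_c_left \<phi>_0)
    then have "sv_scale (?l (\<phi> (sv_e IC)) (IL 0)) (?Q (sv_e (IL 0)) (sv_e (IL 1))) = 0"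
      using arg_cong[OF *, of "\<lambda>x. ?Q x (sv_e (IL 1))"]
      by (simp only: sv_prod_simps sv.scale_zero_right add_0_right)
    then have "?l (\<phi> (sv_e IC)) (IL 0) * ?l (?Q (sv_e (IL 0)) (sv_e (IL 1))) (IL 1) = 0"
      by (metis lookup_sv_scale lookup_zero)
    then show ?thesis using L0_left[OF nd(2), of "sv_e (IL 1)" 1] by (simp add: lookup_sv_e)
  qed
  have eigen: "\<alpha> * of_int n * ?l (\<phi> x) (IL n) = - ?l (\<phi> (?P (sv_e (IL 0)) x)) (IL n)" for x n
  proof -
    have "?Q (\<phi> (sv_e (IL 0))) (\<phi> x) = sv_scale \<alpha> (?Q (sv_e (IL 0)) (\<phi> x))"
      by (subst \<phi>L0) (simp add: sv_prod_simps)
    then show ?thesis by (simp add: mult lookup_sv_scale L0_left[OF nd(2)])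
  qed
  have L0_e: "?P (sv_e (IL 0)) (sv_e (IL n)) = sv_scale (- of_int n) (sv_e (IL n))"
    and L0_e': "?Q (sv_e (IL 0)) (sv_e (IL n)) = sv_scale (- of_int n) (sv_e (IL n))" for n
    using denom(1)[OF nd(1), of n] denom(1)[OF nd(2), of n] by (simp_all add: sv_prod_e)
  have support: "\<alpha> * of_int n = of_int m" if "?l (\<phi> (sv_e (IL m))) (IL n) \<noteq> 0" for m n
  proof -
    have "\<alpha> * of_int n * ?l (\<phi> (sv_e (IL m))) (IL n) = of_int m * ?l (\<phi> (sv_e (IL m))) (IL n)"
      using eigen[of n "sv_e (IL m)"] by (simp add: L0_e \<phi>_scale lookup_sv_scale del: sv.scale_minus_left)
    with that show ?thesis by simp
  qed
  \<comment> \<open>\<open>\<phi> L\<^sub>1\<close> is an eigenvector, so \<open>1/\<alpha>\<close> is an integer\<close>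
  obtain n1 :: int where n1: "\<alpha> * of_int n1 = 1"
  proof -
    have "?Q (\<phi> (sv_e (IL 0))) (\<phi> (sv_e (IL 1))) \<noteq> 0"
      by (simp add: mult[symmetric] L0_e \<phi>_eq_0 sv_e_nonzero)
    then obtain n where "?l (\<phi> (sv_e (IL 1))) (IL n) \<noteq> 0"
      using exists_L_component[OF nd(2) even] by blast
    from support[OF this] show thesis using that by simp
  qed
  \<comment> \<open>\<open>L\<^sub>1\<close> is the image of an eigenvector, so \<open>\<alpha>\<close> is an integer\<close>
  obtain n2 :: int where n2: "\<alpha> = of_int n2"
  proof -
    obtain x where x: "x \<in> sv_grade \<theta> 0" "\<phi> x = sv_e (IL 1)"
      using grade[of 0] even_e by (metis imageE)
    have "?Q (\<phi> (sv_e (IL 0))) (\<phi> x) = sv_scale (- \<alpha>) (\<phi> x)"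
      unfolding x(2) by (subst \<phi>L0) (simp add: sv_prod_simps L0_e')
    then have "\<phi> (?P (sv_e (IL 0)) x) = \<phi> (sv_scale (- \<alpha>) x)"
      by (simp only: mult \<phi>_scale)
    then have Px: "?P (sv_e (IL 0)) x = sv_scale (- \<alpha>) x"
      using bij by (simp add: bij_is_inj inj_eq del: sv.scale_minus_left)
    have "\<alpha> \<noteq> 0" using n1 by auto
    moreover have "x \<noteq> 0" using x(2) \<phi>_0 sv_e_nonzero by metis
    ultimately have "?P (sv_e (IL 0)) x \<noteq> 0" unfolding Px by (simp del: sv.scale_minus_left)
    then obtain n where "?l x (IL n) \<noteq> 0" using exists_L_component[OF nd(1) x(1)] by blast
    moreover have "- of_int n * ?l x (IL n) = - \<alpha> * ?l x (IL n)"
      using L0_left[OF nd(1), of x n] unfolding Px lookup_sv_scale by auto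
    ultimately show thesis using that[of n] by simp
  qed
  have "n2 * n1 = 1" using n1 by (simp add: n2 flip: of_int_mult)
  then have sq: "n2 = 1 \<or> n2 = - 1" by (auto simp: zmult_eq_1_iff)
  then have n2n2: "n2 * n2 = 1" by auto
  \<comment> \<open>\<open>n2\<close> is its own inverse\<close>
  have image: "\<exists>a b. \<phi> (sv_e (IL m)) = sv_scale a (sv_e (IL (n2 * m))) + sv_scale b (sv_e IC)" for m
  proof (intro exI)
    have "?l (\<phi> (sv_e (IL m))) (IL n) = 0" if "n \<noteq> n2 * m" for n
    proof (rule ccontr)
      assume "?l (\<phi> (sv_e (IL m))) (IL n) \<noteq> 0"
      then have "n2 * n = m" using support[of m n] by (simp add: n2 flip: of_int_mult)
      then have "n2 * m = (n2 * n2) * n" by simp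
      then show False using that n2n2 by simp
    qed
    then show "\<phi> (sv_e (IL m)) = sv_scale (?l (\<phi> (sv_e (IL m))) (IL (n2 * m))) (sv_e (IL (n2 * m)))
        + sv_scale (?l (\<phi> (sv_e (IL m))) IC) (sv_e IC)"
      by (intro sv_poly_eqI) (auto simp: sv_lookup_simps no_odd[OF even])
  qed
  obtain a a' where a: "\<phi> (sv_e (IL 1)) = sv_scale a (sv_e (IL n2)) + sv_scale a' (sv_e IC)"
    using image[of 1] by auto
  obtain b b' where b: "\<phi> (sv_e (IL (- 1))) = sv_scale b (sv_e (IL (- n2))) + sv_scale b' (sv_e IC)"
    using image[of "- 1"] by auto
  have "?l (\<phi> (?P (sv_e (IL 1)) (sv_e (IL (- 1))))) (IL 0) = (1 - \<epsilon>) * of_int n2"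
    by (simp add: sv_prod_e \<phi>_add \<phi>_scale sv_lookup_simps \<phi>c n2[symmetric] flip: \<alpha>_def)
  moreover have "?l (?Q (\<phi> (sv_e (IL 1))) (\<phi> (sv_e (IL (- 1))))) (IL 0) = a * b * (of_int n2 * (1 - \<epsilon>' * of_int n2))"
    unfolding a b by (simp add: sv_prod_simps sv_prod_c_right sv_prod_e sv_lookup_simps)
  ultimately have 1: "(1 - \<epsilon>) * of_int n2 = a * b * (of_int n2 * (1 - \<epsilon>' * of_int n2))"
    by (simp only: mult)
  have "?l (\<phi> (?P (sv_e (IL (- 1))) (sv_e (IL 1)))) (IL 0) = - (1 + \<epsilon>) * of_int n2"
    by (simp add: sv_prod_e \<phi>_add \<phi>_scale sv_lookup_simps \<phi>c n2[symmetric] flip: \<alpha>_def)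
  moreover have "?l (?Q (\<phi> (sv_e (IL (- 1)))) (\<phi> (sv_e (IL 1)))) (IL 0) = a * b * (- of_int n2 * (1 + \<epsilon>' * of_int n2))"
    unfolding a b by (simp add: sv_prod_simps sv_prod_c_right sv_prod_e sv_lookup_simps)
  ultimately have 2: "- (1 + \<epsilon>) * of_int n2 = a * b * (- of_int n2 * (1 + \<epsilon>' * of_int n2))"
    by (simp only: mult)
  from sq show ?thesis
  proof
    assume "n2 = 1"
    then have "1 - \<epsilon> = a * b * (1 - \<epsilon>')" "1 + \<epsilon> = a * b * (1 + \<epsilon>')"
      using 1 2 by (simp_all add: algebra_simps)
    then have "2 * \<epsilon> = 2 * \<epsilon>'" by algebra
    then show ?thesis by simp
  next
    assume "n2 = - 1"
    then have "1 - \<epsilon> = a * b * (1 + \<epsilon>')" "1 + \<epsilon> = a * b * (1 - \<epsilon>')"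
      using 1 2 by (simp_all add: algebra_simps)
    then have "2 * \<epsilon> = 2 * - \<epsilon>'" by algebra
    then show ?thesis by simp
  qed
qed

end

section \<open>The classification\<close>

theorem theorem4p3:
  fixes \<theta> :: real
  assumes "\<theta> \<in> {0, 1/2}"
  shows "(\<forall>P f g h d \<omega>. sv_compatible \<theta> P \<and> sv_form \<theta> f g h d \<omega> P
            \<longrightarrow> (\<exists>\<epsilon>. admissible \<epsilon> \<and> sv_isomorphic \<theta> P (sv_prod \<theta> \<epsilon>)))
       \<and> (\<forall>\<epsilon>. admissible \<epsilon> \<longrightarrow> sv_compatible \<theta> (sv_prod \<theta> \<epsilon>))
       \<and> (\<forall>\<epsilon> \<epsilon>'. admissible \<epsilon> \<and> admissible \<epsilon>' \<and> \<epsilon> \<noteq> \<epsilon>'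
            \<longrightarrow> \<not> sv_isomorphic \<theta> (sv_prod \<theta> \<epsilon>) (sv_prod \<theta> \<epsilon>'))"
proof -
  define T where "T = (if \<theta> = 0 then 0 else 1 :: int)"
  interpret half_integer \<theta> T
    using assms by unfold_locales (auto simp: T_def)
  have refl: "sv_isomorphic \<theta> P P" for P
  proof -
    have "superalgebra_iso sv_scale (sv_grade \<theta>) P sv_scale (sv_grade \<theta>) P (\<lambda>x. x)"
      by (simp add: superalgebra_iso_def sv_linear_iff bij_id[unfolded id_def])
    then show ?thesis by (auto simp: sv_isomorphic_def)
  qed
  show ?thesis
  proof (intro conjI allI impI)
    fix P f g h d \<omega>
    assume *: "sv_compatible \<theta> P \<and> sv_form \<theta> f g h d \<omega> P"
    then obtain \<epsilon> where nd: "nondegenerate \<epsilon>" and P: "P = sv_prod \<theta> \<epsilon>"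
      using sv_form_eq_graded_product compatible_graded_product_eq_sv_prod by metis
    from nondegenerate_cases[OF nd] show "\<exists>\<epsilon>. admissible \<epsilon> \<and> sv_isomorphic \<theta> P (sv_prod \<theta> \<epsilon>)"
      using refl sv_prod_isomorphic_minus unfolding P by blast
  next
    fix \<epsilon> assume "admissible \<epsilon>"
    then show "sv_compatible \<theta> (sv_prod \<theta> \<epsilon>)"
      by (intro sv_prod_compatible admissible_nondegenerate)
  next
    fix \<epsilon> \<epsilon>'
    assume adm: "admissible \<epsilon> \<and> admissible \<epsilon>' \<and> \<epsilon> \<noteq> \<epsilon>'"
    show "\<not> sv_isomorphic \<theta> (sv_prod \<theta> \<epsilon>) (sv_prod \<theta> \<epsilon>')"
    proof
      assume "sv_isomorphic \<theta> (sv_prod \<theta> \<epsilon>) (sv_prod \<theta> \<epsilon>')"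
      then have "\<epsilon> = - \<epsilon>'"
        using adm isomorphism_parameters admissible_nondegenerate by blast
      then show False using adm by (auto simp: admissible_def)
    qed
  qed
qed

end
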